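(* Let $P=\langle\Sigma,R\rangle^+$ be a monoid given by a presentation $(\Sigma,R)$ which is complete for $\curvearrowright_R$. Assume that for all $u\in\Sigma$ there is $v\in\Sigma$ with $v\neq u$ such that there is no relation of the form $u\cdots=v\cdots$ in $R$. Also, suppose that $P$ embeds into a group $G$ such that $P\subseteq G$ is quasi-lattice ordered. Then $G_0=\{e\}$ and the boundary quotient $\partial C^*_\lambda(P)$ is simple.
   Context: All semigroups and groups are discrete and countable. $\langle\Sigma,R\rangle^+$ is the monoid with generators $\Sigma$ and relations $R$, all of the form $w_1=w_2$ with $w_1,w_2$ words in $\Sigma$ (a relation is regarded as unordered). Consider words in $\Sigma\sqcup\Sigma^{-1}$, where $\Sigma^{-1}=\{\sigma^{-1}:\sigma\in\Sigma\}$ are formal symbols; for a word $u=\sigma_1\cdots\sigma_k$ in $\Sigma$, $u^{-1}=\sigma_k^{-1}\cdots\sigma_1^{-1}$. Write $w\curvearrowright_Rw'$ if $w$ can be transformed into $w'$ by finitely many steps of the types: delete a subword $\sigma^{-1}\sigma$; replace a subword $\sigma_i^{-1}\sigma_j$ by $uv^{-1}$ if $\sigma_iu=\sigma_jv$ is a relation in $R$. The presentation is complete for $\curvearrowright_R$ if for all words $u,v$ in $\Sigma$: $u^{-1}v\curvearrowright_R\varepsilon$ (empty word) if and only if $u$ and $v$ define the same element of $P$. $P\subseteq G$ is quasi-lattice ordered if $P^*=\{e\}$ (trivial units) and for every $g\in G$ with $gP\cap P\neq\emptyset$ there is $p\in P$ with $gP\cap P=pP$. Moreover $$G_0=\{g\in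 G: pP\cap gP\neq\emptyset\neq pP\cap g^{-1}P\text{ for all }p\in P\}.$$ Boundary quotient: The left inverse hull $I_l(P)$ is the smallest semigroup of partial bijections of $P$ (product = composition on the largest possible domain) closed under inverses and containing all maps $P\to pP$, $x\mapsto px$; $I_l(P)^\times$ is the set of its elements other than the nowhere defined map. $\mathcal J_P=\{\mathrm{dom}(s):s\in I_l(P)\}$. $\widehat{\mathcal J_P}$ is the set of non-zero maps $\chi:\mathcal J_P\to\{0,1\}$ with $\chi(X\cap Y)=\chi(X)\chi(Y)$ and $\chi(\emptyset)=0$ if $\emptyset\in\mathcal J_P$, with pointwise convergence. $\partial\Omega_P$ is the closure in $\widehat{\mathcal J_P}$ of the set of $\chi$ for which $\{X:\chi(X)=1\}$ is maximal (with respect to inclusion) among all characters. For $s\in I_l(P)^\times$, $\sigma(s)\in G$ is the unique element with $s(x)=\sigma(s)x$ on $\mathrm{dom}(s)$. $G$ acts partially on $\widehat{\mathcal J_P}$: $U_{g^{-1}}=\{\chi:\chi(\mathrm{dom}(s))=1\text{ for some }s\in I_l(P)^\times,\sigma(s)=g\}$, $(g.\chi)(X)=\chi(s^{-1}(X\cap\mathrm{im}(s)))$; $\partial\Omega_P$ is invariant. The transformation groupoid is $G\ltimes\partial\Omega_P=\{(g,\chi):\chi\in U_{g^{-1}}\cap\partial\Omega_P\}$ (source $\chi$, range $g.\chi$, product $(g_1,g_2.\chi)(g_2,\chi)=(g_1g_2,\chi)$), and $\partial C^*_\lambda(P)$ is its reduced groupoid C*-algebra $C^*_r(G\ltimes\partial\Omega_P)\cong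 C(\partial\Omega_P)\rtimes_rG$. *)

theory Defs
  imports "HOL-Analysis.Analysis" "HOL-Algebra.Coset"
begin

section \<open>Monoid presentations and word reversing\<close>

definition presentation :: "'a set \<Rightarrow> ('a list \<times> 'a list) set \<Rightarrow> bool" where
  "presentation \<Sigma> R \<longleftrightarrow> R \<subseteq> lists \<Sigma> \<times> lists \<Sigma>"

text \<open>Relations are unordered, so a pair in \<open>R\<close> may be read in both directions.\<close>

definition is_relation :: "('a list \<times> 'a list) set \<Rightarrow> 'a list \<Rightarrow> 'a list \<Rightarrow> bool" where
  "is_relation R w\<^sub>1 w\<^sub>2 \<longleftrightarrow> (w\<^sub>1, w\<^sub>2) \<in> R \<or> (w\<^sub>2, w\<^sub>1) \<in> R"

inductive_set presentation_congruence ::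
  "'a set \<Rightarrow> ('a list \<times> 'a list) set \<Rightarrow> ('a list \<times> 'a list) set"
  for \<Sigma> :: "'a set" and R :: "('a list \<times> 'a list) set" where
  refl: "w \<in> lists \<Sigma> \<Longrightarrow> (w, w) \<in> presentation_congruence \<Sigma> R"
| step: "(w, x @ w\<^sub>1 @ y) \<in> presentation_congruence \<Sigma> R \<Longrightarrow> is_relation R w\<^sub>1 w\<^sub>2
         \<Longrightarrow> (w, x @ w\<^sub>2 @ y) \<in> presentation_congruence \<Sigma> R"

definition presented_monoid ::
  "'a set \<Rightarrow> ('a list \<times> 'a list) set \<Rightarrow> 'a list set monoid" where
  "presented_monoid \<Sigma> R =
     \<lparr>carrier = lists \<Sigma> // presentation_congruence \<Sigma> R,
      mult = (\<lambda>A B. \<Union>u\<in>A. \<Union>v\<in>B. presentation_congruence \<Sigma> R `` {u @ v}),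
      one = presentation_congruence \<Sigma> R `` {[]}\<rparr>"

datatype 'a letter = Pos 'a | Neg 'a

definition pos_word :: "'a list \<Rightarrow> 'a letter list" where
  "pos_word w = map Pos w"

definition inv_word :: "'a list \<Rightarrow> 'a letter list" where
  "inv_word w = map Neg (rev w)"

inductive reversing_step ::
  "('a list \<times> 'a list) set \<Rightarrow> 'a letter list \<Rightarrow> 'a letter list \<Rightarrow> bool"
  for R :: "('a list \<times> 'a list) set" where
  cancel: "reversing_step R (x @ [Neg a, Pos a] @ y) (x @ y)"
| replace: "is_relation R (a # u) (b # v)
            \<Longrightarrow> reversing_step R (x @ [Neg a, Pos b] @ y) (x @ pos_word u @ inv_word v @ y)"

definition complete_presentation :: "'a set \<Rightarrow> ('a list \<times> 'a list) set \<Rightarrow> bool" where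
  "complete_presentation \<Sigma> R \<longleftrightarrow>
     (\<forall>u\<in>lists \<Sigma>. \<forall>v\<in>lists \<Sigma>.
        (reversing_step R)\<^sup>*\<^sup>* (inv_word u @ pos_word v) [] \<longleftrightarrow>
        (u, v) \<in> presentation_congruence \<Sigma> R)"

section \<open>Submonoids of groups\<close>

text \<open>From here on, \<open>P\<close> is a submonoid of the group \<open>G\<close>.\<close>

definition quasi_lattice_ordered :: "('g, 'm) monoid_scheme \<Rightarrow> 'g set \<Rightarrow> bool" where
  "quasi_lattice_ordered G P \<longleftrightarrow>
     Units (G\<lparr>carrier := P\<rparr>) = {\<one>\<^bsub>G\<^esub>} \<and>
     (\<forall>g\<in>carrier G. (g <#\<^bsub>G\<^esub> P) \<inter> P \<noteq> {} \<longrightarrow>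
        (\<exists>p\<in>P. (g <#\<^bsub>G\<^esub> P) \<inter> P = p <#\<^bsub>G\<^esub> P))"

definition G0 :: "('g, 'm) monoid_scheme \<Rightarrow> 'g set \<Rightarrow> 'g set" where
  "G0 G P = {g \<in> carrier G. \<forall>p\<in>P.
     (p <#\<^bsub>G\<^esub> P) \<inter> (g <#\<^bsub>G\<^esub> P) \<noteq> {} \<and>
     (p <#\<^bsub>G\<^esub> P) \<inter> ((inv\<^bsub>G\<^esub> g) <#\<^bsub>G\<^esub> P) \<noteq> {}}"

definition partial_inverse :: "('g \<rightharpoonup> 'g) \<Rightarrow> ('g \<rightharpoonup> 'g)" where
  "partial_inverse s = (\<lambda>y. if y \<in> ran s then Some (THE x. s x = Some y) else None)"

inductive_set left_inverse_hull :: "('g, 'm) monoid_scheme \<Rightarrow> 'g set \<Rightarrow> ('g \<rightharpoonup> 'g) set"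
  for G :: "('g, 'm) monoid_scheme" and P :: "'g set" where
  translation: "p \<in> P \<Longrightarrow>
     (\<lambda>x. if x \<in> P then Some (p \<otimes>\<^bsub>G\<^esub> x) else None) \<in> left_inverse_hull G P"
| inverse: "s \<in> left_inverse_hull G P \<Longrightarrow> partial_inverse s \<in> left_inverse_hull G P"
| comp: "s \<in> left_inverse_hull G P \<Longrightarrow> t \<in> left_inverse_hull G P
     \<Longrightarrow> s \<circ>\<^sub>m t \<in> left_inverse_hull G P"

definition nonzero_hull :: "('g, 'm) monoid_scheme \<Rightarrow> 'g set \<Rightarrow> ('g \<rightharpoonup> 'g) set" where
  "nonzero_hull G P = left_inverse_hull G P - {Map.empty}"

definition constructible_ideals :: "('g, 'm) monoid_scheme \<Rightarrow> 'g set \<Rightarrow> 'g set set" where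
  "constructible_ideals G P = dom ` left_inverse_hull G P"

definition group_part :: "('g, 'm) monoid_scheme \<Rightarrow> ('g \<rightharpoonup> 'g) \<Rightarrow> 'g" where
  "group_part G s =
     (THE g. g \<in> carrier G \<and> (\<forall>x\<in>dom s. s x = Some (g \<otimes>\<^bsub>G\<^esub> x)))"

section \<open>Characters and the boundary\<close>

type_synonym 'g character = "'g set \<Rightarrow> nat"

definition characters :: "('g, 'm) monoid_scheme \<Rightarrow> 'g set \<Rightarrow> 'g character set" where
  "characters G P = {\<phi> \<in> constructible_ideals G P \<rightarrow>\<^sub>E {0, 1}.
     (\<exists>X\<in>constructible_ideals G P. \<phi> X \<noteq> 0) \<and>
     (\<forall>X\<in>constructible_ideals G P. \<forall>Y\<in>constructible_ideals G P. \<phi> (X \<inter> Y) = \<phi> X * \<phi> Y) \<and>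
     ({} \<in> constructible_ideals G P \<longrightarrow> \<phi> {} = 0)}"

definition character_topology ::
  "('g, 'm) monoid_scheme \<Rightarrow> 'g set \<Rightarrow> 'g character topology" where
  "character_topology G P =
     subtopology (product_topology (\<lambda>_. discrete_topology {0, 1}) (constructible_ideals G P))
       (characters G P)"

definition char_support ::
  "('g, 'm) monoid_scheme \<Rightarrow> 'g set \<Rightarrow> 'g character \<Rightarrow> 'g set set" where
  "char_support G P \<phi> = {X \<in> constructible_ideals G P. \<phi> X = 1}"

definition maximal_characters :: "('g, 'm) monoid_scheme \<Rightarrow> 'g set \<Rightarrow> 'g character set" where
  "maximal_characters G P = {\<phi> \<in> characters G P. \<forall>\<psi>\<in>characters G P.
     char_support G P \<phi> \<subseteq> char_support G P \<psi> \<longrightarrow> char_support G P \<psi> = char_support G P \<phi>}"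

definition boundary :: "('g, 'm) monoid_scheme \<Rightarrow> 'g set \<Rightarrow> 'g character set" where
  "boundary G P = character_topology G P closure_of maximal_characters G P"

definition acts_via ::
  "('g, 'm) monoid_scheme \<Rightarrow> 'g set \<Rightarrow> 'g \<Rightarrow> 'g character \<Rightarrow> ('g \<rightharpoonup> 'g) \<Rightarrow> bool" where
  "acts_via G P g \<phi> s \<longleftrightarrow> s \<in> nonzero_hull G P \<and> group_part G s = g \<and> \<phi> (dom s) = 1"

text \<open>\<open>action_domain G P g\<close> is the set written \<open>U\<close> with index \<open>g\<close> inverse, on which \<open>g\<close> acts.\<close>

definition action_domain ::
  "('g, 'm) monoid_scheme \<Rightarrow> 'g set \<Rightarrow> 'g \<Rightarrow> 'g character set" where
  "action_domain G P g = {\<phi> \<in> characters G P. \<exists>s. acts_via G P g \<phi> s}"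

text \<open>
  The value does not depend on the chosen \<open>s\<close>: if \<open>s\<close> and \<open>t\<close> both qualify, they
  agree on \<open>dom s \<inter> dom t\<close>, and \<open>\<phi>\<close> is \<open>1\<close> on this set by multiplicativity.
  The set \<open>{x \<in> dom s. the (s x) \<in> X}\<close> is the preimage of \<open>X \<inter> ran s\<close> under \<open>s\<close>.
\<close>

definition char_action ::
  "('g, 'm) monoid_scheme \<Rightarrow> 'g set \<Rightarrow> 'g \<Rightarrow> 'g character \<Rightarrow> 'g character" where
  "char_action G P g \<phi> =
     (let s = (SOME s. acts_via G P g \<phi> s)
      in restrict (\<lambda>X. \<phi> {x \<in> dom s. the (s x) \<in> X}) (constructible_ideals G P))"

section \<open>Topological groupoids and the transformation groupoid\<close>

text \<open>The arrows are the points of \<open>arrow_topology\<close>; \<open>'u\<close> is the type of the units.\<close>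

record ('a, 'u) top_groupoid =
  arrow_topology :: "'a topology"
  src :: "'a \<Rightarrow> 'u"
  rng :: "'a \<Rightarrow> 'u"
  gprod :: "'a \<Rightarrow> 'a \<Rightarrow> 'a"

definition boundary_groupoid ::
  "('g, 'm) monoid_scheme \<Rightarrow> 'g set \<Rightarrow> ('g \<times> 'g character, 'g character) top_groupoid" where
  "boundary_groupoid G P =
     \<lparr>arrow_topology = subtopology
        (prod_topology (discrete_topology (carrier G)) (character_topology G P))
        {(g, \<phi>). g \<in> carrier G \<and> \<phi> \<in> action_domain G P g \<inter> boundary G P},
      src = (\<lambda>(g, \<phi>). \<phi>),
      rng = (\<lambda>(g, \<phi>). char_action G P g \<phi>),
      gprod = (\<lambda>(g\<^sub>1, \<phi>\<^sub>1) (g\<^sub>2, \<phi>\<^sub>2). (g\<^sub>1 \<otimes>\<^bsub>G\<^esub> g\<^sub>2, \<phi>\<^sub>2))\<rparr>"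

section \<open>Square-summable functions\<close>

lemma summable_inner:
  fixes f g :: "'a \<Rightarrow> complex"
  assumes "(\<lambda>x. (norm (f x))\<^sup>2) summable_on UNIV" "(\<lambda>x. (norm (g x))\<^sup>2) summable_on UNIV"
  shows "(\<lambda>x. f x \<bullet> g x) summable_on UNIV"
proof -
  have s: "(\<lambda>x. (norm (f x))\<^sup>2 + (norm (g x))\<^sup>2) summable_on UNIV"
    by (rule summable_on_add[OF assms])
  have "norm (f x \<bullet> g x) \<le> (norm (f x))\<^sup>2 + (norm (g x))\<^sup>2" for x
  proof -
    have "\<bar>f x \<bullet> g x\<bar> \<le> norm (f x) * norm (g x)"
      by (rule Cauchy_Schwarz_ineq2)
    moreover have "2 * (norm (f x) * norm (g x)) \<le> (norm (f x))\<^sup>2 + (norm (g x))\<^sup>2"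
      using sum_squares_bound[of "norm (f x)" "norm (g x)"] by simp
    moreover have "0 \<le> norm (f x) * norm (g x)"
      by simp
    ultimately show ?thesis
      by simp
  qed
  then have "(\<lambda>x. norm (f x \<bullet> g x)) summable_on UNIV"
    by (intro summable_on_comparison_test[OF s]) auto
  then show ?thesis
    by (rule abs_summable_summable)
qed

typedef 'a ell2 = "{f :: 'a \<Rightarrow> complex. (\<lambda>x. (norm (f x))\<^sup>2) summable_on UNIV}"
  morphisms ell2_fun Abs_ell2
  by (rule exI[of _ "\<lambda>_. 0"]) simp

setup_lifting type_definition_ell2

lemma ell2_fun_summable: "(\<lambda>x. (norm (ell2_fun f x))\<^sup>2) summable_on UNIV"
  using ell2_fun[of f] by simp

lemma ell2_fun_inner_summable: "(\<lambda>x. ell2_fun f x \<bullet> ell2_fun g x) summable_on UNIV"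
  by (intro summable_inner ell2_fun_summable)

lemma ell2_eqI: "(\<And>x. ell2_fun f x = ell2_fun g x) \<Longrightarrow> f = g"
  by (metis ell2_fun_inject ext)

lemma summable_sq_add:
  fixes f g :: "'a \<Rightarrow> complex"
  assumes "(\<lambda>x. (norm (f x))\<^sup>2) summable_on UNIV" "(\<lambda>x. (norm (g x))\<^sup>2) summable_on UNIV"
  shows "(\<lambda>x. (norm (f x + g x))\<^sup>2) summable_on UNIV"
proof -
  have "(\<lambda>x. (norm (f x))\<^sup>2 + (norm (g x))\<^sup>2 + 2 * (f x \<bullet> g x)) summable_on UNIV"
    by (intro summable_on_add summable_on_cmult_right assms summable_inner)
  moreover have "(norm (f x + g x))\<^sup>2 = (norm (f x))\<^sup>2 + (norm (g x))\<^sup>2 + 2 * (f x \<bullet> g x)" for x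
    by (simp add: dot_norm field_simps)
  ultimately show ?thesis
    by simp
qed

lemma summable_sq_mult:
  fixes f :: "'a \<Rightarrow> complex"
  assumes "(\<lambda>x. (norm (f x))\<^sup>2) summable_on UNIV"
  shows "(\<lambda>x. (norm (c * f x))\<^sup>2) summable_on UNIV"
  using summable_on_cmult_right[OF assms, of "(norm c)\<^sup>2"]
  by (simp add: norm_mult power_mult_distrib)

text \<open>
  \<open>ell2\<close> is used with its underlying real structure. The inner product below is
  the real part of the usual Hermitian one and induces the usual norm, the square root of the
  sum of all squared absolute values.
\<close>

instantiation ell2 :: (type) real_inner
begin

lift_definition zero_ell2 :: "'a ell2" is "\<lambda>_. 0"
  by simp

lift_definition plus_ell2 :: "'a ell2 \<Rightarrow> 'a ell2 \<Rightarrow> 'a ell2" is "\<lambda>f g x. f x + g x"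
  by (rule summable_sq_add)

lift_definition uminus_ell2 :: "'a ell2 \<Rightarrow> 'a ell2" is "\<lambda>f x. - f x"
  by simp

lift_definition minus_ell2 :: "'a ell2 \<Rightarrow> 'a ell2 \<Rightarrow> 'a ell2" is "\<lambda>f g x. f x - g x"
  using summable_sq_add[where g = "\<lambda>x. - g x" for g] by simp

lift_definition scaleR_ell2 :: "real \<Rightarrow> 'a ell2 \<Rightarrow> 'a ell2" is "\<lambda>r f x. r *\<^sub>R f x"
  unfolding scaleR_conv_of_real by (rule summable_sq_mult)

definition inner_ell2 :: "'a ell2 \<Rightarrow> 'a ell2 \<Rightarrow> real" where
  "inner_ell2 f g = (\<Sum>\<^sub>\<infinity>x. ell2_fun f x \<bullet> ell2_fun g x)"

definition norm_ell2 :: "'a ell2 \<Rightarrow> real" where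
  "norm_ell2 f = sqrt (\<Sum>\<^sub>\<infinity>x. (norm (ell2_fun f x))\<^sup>2)"

definition sgn_ell2 :: "'a ell2 \<Rightarrow> 'a ell2" where
  "sgn_ell2 f = inverse (norm f) *\<^sub>R f"

definition dist_ell2 :: "'a ell2 \<Rightarrow> 'a ell2 \<Rightarrow> real" where
  "dist_ell2 f g = norm (f - g)"

definition uniformity_ell2 :: "('a ell2 \<times> 'a ell2) filter" where
  "uniformity_ell2 = (INF e\<in>{0 <..}. principal {(f, g). dist f g < e})"

definition open_ell2 :: "'a ell2 set \<Rightarrow> bool" where
  "open_ell2 U \<longleftrightarrow> (\<forall>x\<in>U. \<forall>\<^sub>F (x', y) in uniformity. x' = x \<longrightarrow> y \<in> U)"

instance
proof
  fix f g h :: "'a ell2" and r s :: real and U :: "'a ell2 set"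
  show "f + g + h = f + (g + h)" "f + g = g + f" "0 + f = f" "- f + f = 0" "f - g = f + - g"
    "r *\<^sub>R (f + g) = r *\<^sub>R f + r *\<^sub>R g" "(r + s) *\<^sub>R f = r *\<^sub>R f + s *\<^sub>R f"
    "r *\<^sub>R s *\<^sub>R f = (r * s) *\<^sub>R f" "1 *\<^sub>R f = f"
    by (transfer; simp add: algebra_simps)+
  show "dist f g = norm (f - g)" "sgn f = inverse (norm f) *\<^sub>R f"
    "(uniformity :: ('a ell2 \<times> 'a ell2) filter) = (INF e\<in>{0 <..}. principal {(f, g). dist f g < e})"
    "open U \<longleftrightarrow> (\<forall>x\<in>U. \<forall>\<^sub>F (x', y) in uniformity. x' = x \<longrightarrow> y \<in> U)"
    by (simp_all add: dist_ell2_def sgn_ell2_def uniformity_ell2_def open_ell2_def)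
  show "f \<bullet> g = g \<bullet> f"
    by (simp add: inner_ell2_def inner_commute)
  show "(f + g) \<bullet> h = f \<bullet> h + g \<bullet> h"
    by (simp add: inner_ell2_def plus_ell2.rep_eq inner_add_left infsum_add
        ell2_fun_inner_summable)
  show "r *\<^sub>R f \<bullet> g = r * (f \<bullet> g)"
    by (simp add: inner_ell2_def scaleR_ell2.rep_eq infsum_cmult_right ell2_fun_inner_summable)
  show "0 \<le> f \<bullet> f"
    by (simp add: inner_ell2_def infsum_nonneg)
  show "f \<bullet> f = 0 \<longleftrightarrow> f = 0"
  proof
    assume "f \<bullet> f = 0"
    then have "ell2_fun f x \<bullet> ell2_fun f x = 0" for x
      using nonneg_infsum_le_0D[of "\<lambda>x. ell2_fun f x \<bullet> ell2_fun f x" UNIV x]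
      by (simp add: inner_ell2_def ell2_fun_inner_summable)
    then show "f = 0"
      by (intro ell2_eqI) (simp add: zero_ell2.rep_eq)
  qed (simp add: inner_ell2_def zero_ell2.rep_eq)
  show "norm f = sqrt (f \<bullet> f)"
    by (simp add: norm_ell2_def inner_ell2_def power2_norm_eq_inner)
qed

end

lift_definition scaleC_ell2 :: "complex \<Rightarrow> 'a ell2 \<Rightarrow> 'a ell2" is "\<lambda>c f x. c * f x"
  by (rule summable_sq_mult)

lemma bounded_linear_scaleC_ell2: "bounded_linear (scaleC_ell2 c)"
proof (rule bounded_linear_intro[where K = "norm c"])
  fix f g :: "'a ell2" and r :: real
  show "scaleC_ell2 c (f + g) = scaleC_ell2 c f + scaleC_ell2 c g"
    by transfer (simp add: algebra_simps)
  show "scaleC_ell2 c (r *\<^sub>R f) = r *\<^sub>R scaleC_ell2 c f"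
    by transfer simp
  show "norm (scaleC_ell2 c f) \<le> norm f * norm c"
    by (simp add: norm_ell2_def scaleC_ell2.rep_eq norm_mult power_mult_distrib
        infsum_cmult_right ell2_fun_summable real_sqrt_mult)
qed

lift_definition scaleC_op :: "complex \<Rightarrow> 'a ell2 \<Rightarrow>\<^sub>L 'a ell2" is scaleC_ell2
  by (rule bounded_linear_scaleC_ell2)

section \<open>The reduced groupoid C*-algebra\<close>

text \<open>
  Functions on the arrows are extended by zero to the whole type. This is the usual definition
  of compactly supported continuous functions for a groupoid with Hausdorff arrow space, such as
  \<open>boundary_groupoid\<close>.
\<close>

definition Cc :: "('a, 'u) top_groupoid \<Rightarrow> ('a \<Rightarrow> complex) set" where
  "Cc \<G> = {f. (\<forall>\<gamma>. \<gamma> \<notin> topspace (arrow_topology \<G>) \<longrightarrow> f \<gamma> = 0) \<and>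
     continuous_map (arrow_topology \<G>) euclidean f \<and>
     compactin (arrow_topology \<G>)
       (arrow_topology \<G> closure_of {\<gamma> \<in> topspace (arrow_topology \<G>). f \<gamma> \<noteq> 0})}"

definition factorizations :: "('a, 'u) top_groupoid \<Rightarrow> 'a \<Rightarrow> ('a \<times> 'a) set" where
  "factorizations \<G> \<gamma> = {(\<alpha>, \<beta>).
     \<alpha> \<in> topspace (arrow_topology \<G>) \<and> \<beta> \<in> topspace (arrow_topology \<G>) \<and>
     src \<G> \<alpha> = rng \<G> \<beta> \<and> gprod \<G> \<alpha> \<beta> = \<gamma>}"

definition convolution ::
  "('a, 'u) top_groupoid \<Rightarrow> ('a \<Rightarrow> complex) \<Rightarrow> ('a \<Rightarrow> complex) \<Rightarrow> ('a \<Rightarrow> complex)" where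
  "convolution \<G> f \<xi> \<gamma> = (\<Sum>\<^sub>\<infinity>(\<alpha>, \<beta>)\<in>factorizations \<G> \<gamma>. f \<alpha> * \<xi> \<beta>)"

text \<open>
  The reduced C*-algebra of an etale groupoid is the completion of the convolution algebra
  \<open>Cc\<close> in the supremum, over all units \<open>x\<close>, of the norms of its left
  convolution representations on \<open>ell2\<close> of the source fibre of \<open>x\<close>. The direct sum of these
  representations is the left convolution representation on \<open>ell2\<close> of the set of all
  arrows, so the completion is the operator norm closure of its image. Here the operators act
  on \<open>ell2\<close> of the whole type and vanish on functions supported off the arrows.
\<close>

definition reduced_algebra :: "('a, 'u) top_groupoid \<Rightarrow> ('a ell2 \<Rightarrow>\<^sub>L 'a ell2) set" where
  "reduced_algebra \<G> = closure {T. \<exists>f\<in>Cc \<G>. \<forall>\<xi>.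
     ell2_fun (blinfun_apply T \<xi>) = convolution \<G> f (ell2_fun \<xi>)}"

definition closed_ideal ::
  "('a ell2 \<Rightarrow>\<^sub>L 'a ell2) set \<Rightarrow> ('a ell2 \<Rightarrow>\<^sub>L 'a ell2) set \<Rightarrow> bool" where
  "closed_ideal A I \<longleftrightarrow> I \<subseteq> A \<and> closed I \<and> 0 \<in> I \<and>
     (\<forall>S\<in>I. \<forall>T\<in>I. S + T \<in> I) \<and>
     (\<forall>c. \<forall>T\<in>I. scaleC_op c o\<^sub>L T \<in> I) \<and>
     (\<forall>S\<in>A. \<forall>T\<in>I. S o\<^sub>L T \<in> I \<and> T o\<^sub>L S \<in> I)"

definition simple_algebra :: "('a ell2 \<Rightarrow>\<^sub>L 'a ell2) set \<Rightarrow> bool" where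
  "simple_algebra A \<longleftrightarrow> A \<noteq> {0} \<and> (\<forall>I. closed_ideal A I \<longrightarrow> I = {0} \<or> I = A)"

definition boundary_quotient ::
  "('g, 'm) monoid_scheme \<Rightarrow> 'g set
     \<Rightarrow> (('g \<times> 'g character) ell2 \<Rightarrow>\<^sub>L ('g \<times> 'g character) ell2) set" where
  "boundary_quotient G P = reduced_algebra (boundary_groupoid G P)"

end

theory Submission
  imports Defs
begin

text \<open>
  Write \<open>aP\<close> for the right ideal of \<open>a\<close>. The proof has two halves.

  \<^emph>\<open>Why \<open>G\<^sub>0\<close> is trivial.\<close> If \<open>u \<noteq> v\<close> are generators and no relation has
  the form \<open>u\<dots> = v\<dots>\<close>, then \<open>uP\<close> and \<open>vP\<close> are disjoint: a common multiple \<open>ux = vy\<close> would reverse \<open>x\<inverse>u\<inverse>vy\<close> to the empty word, but no reversing step can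
  ever touch the factor \<open>u\<inverse>v\<close>. So for every \<open>a \<noteq> 1\<close> in \<open>P\<close>, which lies in \<open>uP\<close> for some generator \<open>u\<close>,
  there is an ideal \<open>vP\<close> disjoint from \<open>aP\<close>. For \<open>g\<close> in \<open>G\<^sub>0\<close> the ideal \<open>gP \<inter> P = aP\<close> meets every
  \<open>vP\<close>, so \<open>a = 1\<close> and \<open>g\<inverse> \<in> P\<close>. The same holds for \<open>g\<inverse>\<close>, and \<open>P\<close> has no non-trivial unit
  (\<open>presented_monoid_G0_trivial\<close>).

  \<^emph>\<open>Why the boundary quotient is simple.\<close> Quasi-lattice order makes every constructible ideal empty
  or principal. So a character is the same as a filter of elements of \<open>P\<close>, and every nonzero element
  of the left inverse hull is left translation by a group element between principal ideals. A
  character belongs to the boundary exactly if each of its basic neighbourhoods contains a cylinder,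
  the set of all characters that are \<open>1\<close> on some given \<open>rP\<close> (\<open>boundary_iff\<close>). This description
  shows that the boundary is invariant.

  Let \<open>V\<^sub>g\<close> be the operator of left convolution with the indicator function of the arrows over \<open>g\<close>; it
  is a partial isometry, and \<open>V\<^sub>1\<close> is the unit. Let \<open>T \<noteq> 0\<close> be in a closed ideal. Some matrix
  coefficient of \<open>T\<close> at an arrow \<open>(g, \<phi>)\<close> is nonzero. Approximate \<open>T\<close> by convolution with a
  compactly supported \<open>f\<close>. Write \<open>g = qp\<inverse>\<close> with \<open>\<phi>\<close> equal to \<open>1\<close> on \<open>pP\<close>, and replace \<open>(p, q)\<close> by
  \<open>(pr, qr)\<close>. A first choice of \<open>r\<close> makes \<open>f\<close> almost constant over \<open>g\<close> on the cylinder of \<open>pr\<close>. For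
  each of the finitely many other \<open>k\<close> over which \<open>f\<close> is supported, \<open>q\<inverse>kp \<noteq> 1\<close> is not in \<open>G\<^sub>0\<close>, so a
  further choice makes \<open>r\<inverse>q\<inverse>kprP\<close> disjoint from \<open>P\<close>. Then compression to \<open>V\<^sub>q\<^sup>* T V\<^sub>p\<close> kills everything
  over these \<open>k\<close> and leaves an operator close to \<open>f(g, \<phi>) V\<^sub>1\<close> (\<open>compression_near_scalar\<close>). After
  division by \<open>f(g, \<phi>)\<close> this is an element of the ideal at distance less than \<open>1\<close> from the unit, so
  the ideal contains the unit. The choice of \<open>r\<close> takes the place of topological freeness. Minimality
  is present in the form \<open>V\<^sub>p\<^sup>* V\<^sub>p = V\<^sub>1\<close>: each cylinder is a translate of the whole boundary.
\<close>

section \<open>Word reversing detects disjoint right ideals\<close>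

lemma is_relation_sym: "is_relation R u v \<Longrightarrow> is_relation R v u"
  by (auto simp: is_relation_def)

lemma is_relation_in_lists:
  assumes "presentation \<Sigma> R" "is_relation R u v"
  shows "u \<in> lists \<Sigma>" "v \<in> lists \<Sigma>"
  using assms by (auto simp: presentation_def is_relation_def)

lemma presentation_congruence_in_lists:
  assumes "presentation \<Sigma> R" "(u, v) \<in> presentation_congruence \<Sigma> R"
  shows "u \<in> lists \<Sigma>" "v \<in> lists \<Sigma>"
proof -
  from assms(2) have "u \<in> lists \<Sigma> \<and> v \<in> lists \<Sigma>"
  proof induction
    case (step w x w\<^sub>1 y w\<^sub>2)
    then show ?case
      using is_relation_in_lists[OF assms(1) step.hyps(2)] by simp
  qed simp
  then show "u \<in> lists \<Sigma>" "v \<in> lists \<Sigma>"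
    by simp_all
qed

lemma presentation_congruence_trans:
  assumes "(v, w) \<in> presentation_congruence \<Sigma> R" "(u, v) \<in> presentation_congruence \<Sigma> R"
  shows "(u, w) \<in> presentation_congruence \<Sigma> R"
  using assms
proof induction
  case (step v x w\<^sub>1 y w\<^sub>2)
  then show ?case
    by (blast intro: presentation_congruence.step)
qed

lemma presentation_congruence_sym:
  assumes "presentation \<Sigma> R" "(u, v) \<in> presentation_congruence \<Sigma> R"
  shows "(v, u) \<in> presentation_congruence \<Sigma> R"
  using assms(2)
proof induction
  case (refl w)
  then show ?case
    by (rule presentation_congruence.refl)
next
  case (step w x w\<^sub>1 y w\<^sub>2)
  have "x @ w\<^sub>1 @ y \<in> lists \<Sigma>"
    using presentation_congruence_in_lists[OF assms(1) step.hyps(1)] by simp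
  then have "x @ w\<^sub>2 @ y \<in> lists \<Sigma>"
    using is_relation_in_lists[OF assms(1) step.hyps(2)] by simp
  then have "(x @ w\<^sub>2 @ y, x @ w\<^sub>2 @ y) \<in> presentation_congruence \<Sigma> R"
    by (rule presentation_congruence.refl)
  then have "(x @ w\<^sub>2 @ y, x @ w\<^sub>1 @ y) \<in> presentation_congruence \<Sigma> R"
    using is_relation_sym[OF step.hyps(2)] by (rule presentation_congruence.step)
  then show ?case
    using step.IH by (rule presentation_congruence_trans[rotated])
qed

lemma equiv_presentation_congruence:
  assumes "presentation \<Sigma> R"
  shows "equiv (lists \<Sigma>) (presentation_congruence \<Sigma> R)"
proof (rule equivI)
  show "presentation_congruence \<Sigma> R \<subseteq> lists \<Sigma> \<times> lists \<Sigma>"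
    by (intro subrelI SigmaI) (blast dest: presentation_congruence_in_lists[OF assms(1)])+
  show "refl_on (lists \<Sigma>) (presentation_congruence \<Sigma> R)"
    by (auto simp: refl_on_def intro: presentation_congruence.refl)
  show "sym (presentation_congruence \<Sigma> R)"
    by (auto intro: symI presentation_congruence_sym[OF assms])
  show "trans (presentation_congruence \<Sigma> R)"
    by (auto intro: transI presentation_congruence_trans)
qed

lemma presentation_congruence_append:
  assumes "presentation \<Sigma> R" "(u, u') \<in> presentation_congruence \<Sigma> R"
    "(v, v') \<in> presentation_congruence \<Sigma> R"
  shows "(u @ v, u' @ v') \<in> presentation_congruence \<Sigma> R"
proof -
  have left: "(u @ v, u @ v') \<in> presentation_congruence \<Sigma> R" if "u \<in> lists \<Sigma>"
    using assms(3)
  proof induction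
    case (refl w)
    then show ?case
      using that by (intro presentation_congruence.refl) simp
  next
    case (step w x w\<^sub>1 y w\<^sub>2)
    then show ?case
      using presentation_congruence.step[of "u @ w" "u @ x" w\<^sub>1 y \<Sigma> R w\<^sub>2] by simp
  qed
  have right: "(u @ v', u' @ v') \<in> presentation_congruence \<Sigma> R" if "v' \<in> lists \<Sigma>"
    using assms(2)
  proof induction
    case (refl w)
    then show ?case
      using that by (intro presentation_congruence.refl) simp
  next
    case (step w x w\<^sub>1 y w\<^sub>2)
    then show ?case
      using presentation_congruence.step[of "w @ v'" x w\<^sub>1 "y @ v'" \<Sigma> R w\<^sub>2] by simp
  qed
  show ?thesis
    using left right presentation_congruence_in_lists[OF assms(1)] assms(2,3)
    by (metis presentation_congruence_trans)
qed

definition word_class :: "'a set \<Rightarrow> ('a list \<times> 'a list) set \<Rightarrow> 'a list \<Rightarrow> 'a list set" where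
  "word_class \<Sigma> R w = presentation_congruence \<Sigma> R `` {w}"

lemma word_class_eq_iff:
  assumes "presentation \<Sigma> R" "u \<in> lists \<Sigma>" "v \<in> lists \<Sigma>"
  shows "word_class \<Sigma> R u = word_class \<Sigma> R v \<longleftrightarrow> (u, v) \<in> presentation_congruence \<Sigma> R"
  unfolding word_class_def
  by (rule eq_equiv_class_iff[OF equiv_presentation_congruence[OF assms(1)] assms(2,3)])

lemma carrier_presented_monoid:
  "carrier (presented_monoid \<Sigma> R) = word_class \<Sigma> R ` lists \<Sigma>"
  by (auto simp: presented_monoid_def quotient_def word_class_def)

lemma one_presented_monoid: "\<one>\<^bsub>presented_monoid \<Sigma> R\<^esub> = word_class \<Sigma> R []"
  by (simp add: presented_monoid_def word_class_def)

lemma mult_presented_monoid: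
  assumes "presentation \<Sigma> R" "u \<in> lists \<Sigma>" "v \<in> lists \<Sigma>"
  shows "word_class \<Sigma> R u \<otimes>\<^bsub>presented_monoid \<Sigma> R\<^esub> word_class \<Sigma> R v = word_class \<Sigma> R (u @ v)"
proof -
  have "presentation_congruence \<Sigma> R `` {u' @ v'} = presentation_congruence \<Sigma> R `` {u @ v}"
    if "u' \<in> word_class \<Sigma> R u" "v' \<in> word_class \<Sigma> R v" for u' v'
  proof -
    have "(u @ v, u' @ v') \<in> presentation_congruence \<Sigma> R"
      using that presentation_congruence_append[OF assms(1)] by (auto simp: word_class_def)
    then show ?thesis
      using equiv_class_eq[OF equiv_presentation_congruence[OF assms(1)]] by blast
  qed
  moreover have "u \<in> word_class \<Sigma> R u" "v \<in> word_class \<Sigma> R v"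
    using assms by (auto simp: word_class_def intro: presentation_congruence.refl)
  ultimately have "(\<Union>u'\<in>word_class \<Sigma> R u. \<Union>v'\<in>word_class \<Sigma> R v.
      presentation_congruence \<Sigma> R `` {u' @ v'}) = presentation_congruence \<Sigma> R `` {u @ v}"
    by blast
  then show ?thesis
    by (simp add: presented_monoid_def word_class_def)
qed

text \<open>
  A step rewrites some factor \<open>[Neg a, Pos b]\<close>. It cannot overlap \<open>[Neg u, Pos v]\<close> in a single
  letter, because the signs differ, and it cannot rewrite \<open>[Neg u, Pos v]\<close> itself. So this factor
  survives every step.
\<close>

lemma reversing_step_keeps_stuck_factor:
  assumes "u \<noteq> v" "\<nexists>x y. is_relation R (u # x) (v # y)"
    and "reversing_step R w w'" "w = x @ [Neg u, Pos v] @ y"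
  shows "\<exists>x' y'. w' = x' @ [Neg u, Pos v] @ y'"
proof -
  have split: "(\<exists>z. s = x @ [Neg u, Pos v] @ z) \<or> (\<exists>z. t = z @ [Neg u, Pos v] @ y) \<or> a = u \<and> b = v"
    if "s @ [Neg a, Pos b] @ t = x @ [Neg u, Pos v] @ y" for s t a b
    using that by (auto simp: append_eq_append_conv2 Cons_eq_append_conv append_eq_Cons_conv)
  from assms(3) show ?thesis
  proof cases
    case (cancel s a t)
    then have "(\<exists>z. s = x @ [Neg u, Pos v] @ z) \<or> (\<exists>z. t = z @ [Neg u, Pos v] @ y)"
      using split[of s a a t] assms(1,4) by auto
    then show ?thesis
    proof (elim disjE exE)
      fix z assume "s = x @ [Neg u, Pos v] @ z"
      then have "w' = x @ [Neg u, Pos v] @ (z @ t)"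
        using cancel by simp
      then show ?thesis by blast
    next
      fix z assume "t = z @ [Neg u, Pos v] @ y"
      then have "w' = (s @ z) @ [Neg u, Pos v] @ y"
        using cancel by simp
      then show ?thesis by blast
    qed
  next
    case (replace a p b q s t)
    then have "(\<exists>z. s = x @ [Neg u, Pos v] @ z) \<or> (\<exists>z. t = z @ [Neg u, Pos v] @ y)"
      using split[of s a b t] assms(2,4) by auto
    then show ?thesis
    proof (elim disjE exE)
      fix z assume "s = x @ [Neg u, Pos v] @ z"
      then have "w' = x @ [Neg u, Pos v] @ (z @ pos_word p @ inv_word q @ t)"
        using replace by simp
      then show ?thesis by blast
    next
      fix z assume "t = z @ [Neg u, Pos v] @ y"
      then have "w' = (s @ pos_word p @ inv_word q @ z) @ [Neg u, Pos v] @ y"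
        using replace by simp
      then show ?thesis by blast
    qed
  qed
qed

text \<open>
  If the two words were equal in the monoid, completeness would reverse
  \<open>x\<inverse> u\<inverse> v y\<close> to the empty word; but its middle factor \<open>u\<inverse> v\<close> can never be removed.
\<close>

lemma no_common_multiple_of_unrelated_generators:
  assumes "presentation \<Sigma> R" "complete_presentation \<Sigma> R"
    and "u \<noteq> v" "\<nexists>x y. is_relation R (u # x) (v # y)"
    and "u # x \<in> lists \<Sigma>" "v # y \<in> lists \<Sigma>"
  shows "(u # x, v # y) \<notin> presentation_congruence \<Sigma> R"
proof
  assume "(u # x, v # y) \<in> presentation_congruence \<Sigma> R"
  then have "(reversing_step R)\<^sup>*\<^sup>* (inv_word (u # x) @ pos_word (v # y)) []"
    using assms(2,5,6) by (auto simp: complete_presentation_def)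
  moreover have "\<exists>s t. w = s @ [Neg u, Pos v] @ t"
    if "(reversing_step R)\<^sup>*\<^sup>* (inv_word (u # x) @ pos_word (v # y)) w" for w
    using that
  proof induction
    case base
    show ?case
      by (rule exI[of _ "inv_word x"], rule exI[of _ "pos_word y"])
        (simp add: inv_word_def pos_word_def)
  next
    case (step w w')
    then show ?case
      using reversing_step_keeps_stuck_factor[OF assms(3,4)] by blast
  qed
  ultimately show False
    by fastforce
qed

section \<open>Operators on square-summable functions\<close>

lemma infsum_single_term:
  assumes "\<And>x. x \<in> A \<Longrightarrow> x \<noteq> a \<Longrightarrow> f x = 0"
  shows "infsum f A = (if a \<in> A then f a else 0)"
proof (cases "a \<in> A")
  case True
  then have "infsum f A = infsum f {a}"
    using assms by (intro infsum_cong_neutral) auto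
  then show ?thesis
    using True by simp
next
  case False
  then show ?thesis
    using assms by (auto intro!: infsum_0)
qed

lemma ell2_coefficient_le_norm: "cmod (ell2_fun \<xi> x) \<le> norm \<xi>"
proof -
  have "(cmod (ell2_fun \<xi> x))\<^sup>2 \<le> (\<Sum>\<^sub>\<infinity>y. (cmod (ell2_fun \<xi> y))\<^sup>2)"
    using finite_sum_le_infsum[of "\<lambda>y. (cmod (ell2_fun \<xi> y))\<^sup>2" UNIV "{x}"]
    by (simp add: ell2_fun_summable)
  then show ?thesis
    unfolding norm_ell2_def by (rule real_le_rsqrt)
qed

lemma ell2_norm_le_pointwise:
  assumes "0 \<le> C" "\<And>x. cmod (ell2_fun \<xi> x) \<le> C * cmod (ell2_fun \<eta> x)"
  shows "norm \<xi> \<le> C * norm \<eta>"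
proof -
  have "(\<Sum>\<^sub>\<infinity>x. (cmod (ell2_fun \<xi> x))\<^sup>2) \<le> (\<Sum>\<^sub>\<infinity>x. C\<^sup>2 * (cmod (ell2_fun \<eta> x))\<^sup>2)"
    using assms
    by (intro infsum_mono ell2_fun_summable summable_on_cmult_right)
      (metis norm_ge_zero power_mono power_mult_distrib)
  also have "\<dots> = C\<^sup>2 * (\<Sum>\<^sub>\<infinity>x. (cmod (ell2_fun \<eta> x))\<^sup>2)"
    by (intro infsum_cmult_right ell2_fun_summable)
  finally show ?thesis
    using assms(1) unfolding norm_ell2_def
    by (metis abs_of_nonneg real_sqrt_abs real_sqrt_le_iff real_sqrt_mult)
qed

lift_definition ell2_single :: "'a \<Rightarrow> complex \<Rightarrow> 'a ell2" is "\<lambda>b c x. if x = b then c else 0"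
proof -
  fix b :: 'a and c :: complex
  have "(\<lambda>x. (cmod (if x = b then c else 0))\<^sup>2) summable_on {b}"
    by simp
  then show "(\<lambda>x. (cmod (if x = b then c else 0))\<^sup>2) summable_on UNIV"
    by (rule summable_on_cong_neutral[THEN iffD1, rotated -1]) auto
qed

lemma norm_ell2_single: "norm (ell2_single b c) \<le> cmod c"
proof -
  have "(\<Sum>\<^sub>\<infinity>x. (cmod (ell2_fun (ell2_single b c) x))\<^sup>2) = (cmod c)\<^sup>2"
    by (subst infsum_single_term[of _ b]) (auto simp: ell2_single.rep_eq)
  then show ?thesis
    by (simp add: norm_ell2_def)
qed

lemma ell2_fun_sum: "ell2_fun (sum f A) x = (\<Sum>a\<in>A. ell2_fun (f a) x)"
proof (cases "finite A")
  case True
  then show ?thesis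
    by induction (simp_all add: zero_ell2.rep_eq plus_ell2.rep_eq)
qed (simp add: zero_ell2.rep_eq)

text \<open>
  The finitely supported functions are dense: the squared distance from \<open>\<xi>\<close> to its restriction to
  a finite set \<open>F\<close> is a tail of a convergent sum.
\<close>

lemma blinfun_eq_zero_on_singles:
  fixes T :: "'a ell2 \<Rightarrow>\<^sub>L 'b::real_normed_vector"
  assumes "\<And>b c. T (ell2_single b c) = 0"
  shows "T = 0"
proof (rule blinfun_eqI)
  fix \<xi> :: "'a ell2"
  let ?sq = "\<lambda>x. (cmod (ell2_fun \<xi> x))\<^sup>2"
  have "norm (T \<xi>) \<le> norm T * e" if "e > 0" for e
  proof -
    have "(sum ?sq \<longlongrightarrow> infsum ?sq UNIV) (finite_subsets_at_top UNIV)"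
      by (rule infsum_tendsto[OF ell2_fun_summable])
    then have "\<forall>\<^sub>F F in finite_subsets_at_top UNIV. dist (sum ?sq F) (infsum ?sq UNIV) < e\<^sup>2"
      using \<open>e > 0\<close> by (intro tendstoD) auto
    then obtain F :: "'a set" where F: "finite F" "dist (sum ?sq F) (infsum ?sq UNIV) < e\<^sup>2"
      unfolding eventually_finite_subsets_at_top by blast
    define \<eta> where "\<eta> = \<xi> - (\<Sum>b\<in>F. ell2_single b (ell2_fun \<xi> b))"
    have \<eta>: "ell2_fun \<eta> x = (if x \<in> F then 0 else ell2_fun \<xi> x)" for x
      using F(1) by (simp add: \<eta>_def minus_ell2.rep_eq ell2_fun_sum ell2_single.rep_eq)
    have "infsum ?sq UNIV = infsum ?sq F + infsum ?sq (- F)"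
      using infsum_Un_disjoint[of ?sq F "- F"] F(1)
      by (simp add: summable_on_subset_banach[OF ell2_fun_summable])
    moreover have "infsum (\<lambda>x. (cmod (ell2_fun \<eta> x))\<^sup>2) UNIV = infsum ?sq (- F)"
      by (intro infsum_cong_neutral) (auto simp: \<eta>)
    ultimately have "infsum (\<lambda>x. (cmod (ell2_fun \<eta> x))\<^sup>2) UNIV < e\<^sup>2"
      using F by (simp add: dist_real_def)
    then have "norm \<eta> \<le> e"
      using \<open>e > 0\<close> unfolding norm_ell2_def by (intro real_le_lsqrt) auto
    moreover have "T \<xi> = T \<eta>"
      using assms by (simp add: \<eta>_def blinfun.diff_right blinfun.sum_right)
    ultimately show ?thesis
      using norm_blinfun[of T \<eta>] mult_left_mono[of "norm \<eta>" e "norm T"] by simp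
  qed
  then have "norm (T \<xi>) \<le> 0"
  proof (cases "norm T = 0")
    case True
    then show ?thesis
      using norm_blinfun[of T \<xi>] by simp
  next
    case False
    have "norm (T \<xi>) \<le> 0 + e" if "e > 0" for e
      using \<open>\<And>e. e > 0 \<Longrightarrow> norm (T \<xi>) \<le> norm T * e\<close>[of "e / norm T"] that False by simp
    then show ?thesis
      by (rule field_le_epsilon)
  qed
  then show "blinfun_apply T \<xi> = blinfun_apply 0 \<xi>"
    by simp
qed

lemma pullback_operator_exists:
  fixes D :: "'a set" and \<tau> :: "'a \<Rightarrow> 'a"
  assumes "inj_on \<tau> D"
  shows "\<exists>T :: 'a ell2 \<Rightarrow>\<^sub>L 'a ell2. norm T \<le> 1 \<and>
    (\<forall>\<xi> x. ell2_fun (blinfun_apply T \<xi>) x = (if x \<in> D then ell2_fun \<xi> (\<tau> x) else 0))"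
proof -
  define pb :: "('a \<Rightarrow> complex) \<Rightarrow> 'a \<Rightarrow> complex" where
    "pb = (\<lambda>f x. if x \<in> D then f (\<tau> x) else 0)"
  define S where "S = (\<lambda>\<xi>. Abs_ell2 (pb (ell2_fun \<xi>)))"
  have sum_pb: "(\<lambda>x. (cmod (pb (ell2_fun \<xi>) x))\<^sup>2) summable_on UNIV"
    "(\<Sum>\<^sub>\<infinity>x. (cmod (pb (ell2_fun \<xi>) x))\<^sup>2) \<le> (\<Sum>\<^sub>\<infinity>x. (cmod (ell2_fun \<xi> x))\<^sup>2)" for \<xi>
  proof -
    let ?sq = "\<lambda>x. (cmod (ell2_fun \<xi> x))\<^sup>2"
    have im: "?sq summable_on \<tau> ` D"
      by (rule summable_on_subset_banach[OF ell2_fun_summable]) simp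
    then have D: "(?sq \<circ> \<tau>) summable_on D"
      by (rule summable_on_reindex[OF assms, THEN iffD1])
    have "(\<lambda>x. (cmod (pb (ell2_fun \<xi>) x))\<^sup>2) summable_on UNIV \<longleftrightarrow> (?sq \<circ> \<tau>) summable_on D"
      by (rule summable_on_cong_neutral) (auto simp: pb_def)
    then show "(\<lambda>x. (cmod (pb (ell2_fun \<xi>) x))\<^sup>2) summable_on UNIV"
      using D by blast
    have "(\<Sum>\<^sub>\<infinity>x. (cmod (pb (ell2_fun \<xi>) x))\<^sup>2) = infsum (?sq \<circ> \<tau>) D"
      by (rule infsum_cong_neutral) (auto simp: pb_def)
    also have "\<dots> = infsum ?sq (\<tau> ` D)"
      by (rule infsum_reindex[OF assms, symmetric])
    also have "\<dots> \<le> infsum ?sq UNIV"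
      by (intro infsum_mono_neutral im ell2_fun_summable) auto
    finally show "(\<Sum>\<^sub>\<infinity>x. (cmod (pb (ell2_fun \<xi>) x))\<^sup>2) \<le> (\<Sum>\<^sub>\<infinity>x. (cmod (ell2_fun \<xi> x))\<^sup>2)" .
  qed
  have S: "ell2_fun (S \<xi>) = pb (ell2_fun \<xi>)" for \<xi>
    unfolding S_def using sum_pb(1) by (simp add: Abs_ell2_inverse)
  have norm_S: "norm (S \<xi>) \<le> norm \<xi> * 1" for \<xi>
    using sum_pb(2) by (simp add: norm_ell2_def S)
  have "bounded_linear S"
  proof (rule bounded_linear_intro[OF _ _ norm_S])
    show "S (\<xi> + \<eta>) = S \<xi> + S \<eta>" for \<xi> \<eta>
      by (rule ell2_eqI) (simp add: S plus_ell2.rep_eq pb_def)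
    show "S (r *\<^sub>R \<xi>) = r *\<^sub>R S \<xi>" for r \<xi>
      by (rule ell2_eqI) (simp add: S scaleR_ell2.rep_eq pb_def)
  qed
  then have app: "blinfun_apply (Blinfun S) = S"
    by (rule bounded_linear_Blinfun_apply)
  show ?thesis
  proof (intro exI[of _ "Blinfun S"] conjI allI)
    show "norm (Blinfun S) \<le> 1"
      using norm_S by (intro norm_blinfun_bound) (simp_all add: app)
    show "ell2_fun (blinfun_apply (Blinfun S) \<xi>) x = (if x \<in> D then ell2_fun \<xi> (\<tau> x) else 0)" for \<xi> x
      by (simp add: app S pb_def)
  qed
qed

lemma blinfun_compose_diff:
  fixes S T :: "'b::real_normed_vector \<Rightarrow>\<^sub>L 'c::real_normed_vector"
    and U :: "'a::real_normed_vector \<Rightarrow>\<^sub>L 'b"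
    and V :: "'c \<Rightarrow>\<^sub>L 'd::real_normed_vector"
  shows "(S - T) o\<^sub>L U = (S o\<^sub>L U) - (T o\<^sub>L U)" "V o\<^sub>L (S - T) = (V o\<^sub>L S) - (V o\<^sub>L T)"
  by (auto intro!: blinfun_eqI simp: blinfun.diff_left blinfun.diff_right)

lemma norm_scaleC_op_compose_le:
  fixes T :: "'a ell2 \<Rightarrow>\<^sub>L 'a ell2"
  shows "norm (scaleC_op c o\<^sub>L T) \<le> cmod c * norm T"
proof (rule norm_blinfun_bound)
  fix \<xi> :: "'a ell2"
  have "norm (scaleC_ell2 c \<eta>) \<le> cmod c * norm \<eta>" for \<eta> :: "'a ell2"
    by (rule ell2_norm_le_pointwise) (simp_all add: scaleC_ell2.rep_eq norm_mult)
  then have "norm (scaleC_ell2 c (T \<xi>)) \<le> cmod c * norm (T \<xi>)" .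
  also have "\<dots> \<le> cmod c * (norm T * norm \<xi>)"
    by (intro mult_left_mono norm_blinfun) simp
  finally show "norm ((scaleC_op c o\<^sub>L T) \<xi>) \<le> cmod c * norm T * norm \<xi>"
    by (simp add: scaleC_op.rep_eq mult.assoc)
qed simp

lemma closed_ideal_diff:
  assumes "closed_ideal A I" "S \<in> I" "T \<in> I"
  shows "S - T \<in> I"
proof -
  have "scaleC_op (- 1) o\<^sub>L T = - T"
    by (rule blinfun_eqI, rule ell2_eqI)
      (simp add: scaleC_op.rep_eq scaleC_ell2.rep_eq uminus_blinfun.rep_eq uminus_ell2.rep_eq)
  then have "- T \<in> I"
    using assms unfolding closed_ideal_def by metis
  then have "S + - T \<in> I"
    using assms unfolding closed_ideal_def by blast
  then show ?thesis
    by simp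
qed

text \<open>
  A product of two operators of the form \<open>E\<close> minus an element of the ideal has this form again. So the
  powers of \<open>E - t\<close>, which tend to \<open>0\<close>, are \<open>E - i\<^sub>n\<close> with \<open>i\<^sub>n\<close> in the ideal, and \<open>i\<^sub>n\<close> tends to \<open>E\<close>.
\<close>

lemma closed_ideal_eq_if_near_unit:
  assumes ideal: "closed_ideal A I"
    and unit: "E \<in> A" "\<And>S. S \<in> A \<Longrightarrow> S o\<^sub>L E = S" "\<And>S. S \<in> A \<Longrightarrow> E o\<^sub>L S = S"
    and near: "t \<in> I" "norm (E - t) < 1"
  shows "I = A"
proof -
  have IA: "I \<subseteq> A" "closed I" "\<And>S T. S \<in> I \<Longrightarrow> T \<in> I \<Longrightarrow> S + T \<in> I"
    "\<And>S T. S \<in> A \<Longrightarrow> T \<in> I \<Longrightarrow> S o\<^sub>L T \<in> I"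
    using ideal by (auto simp: closed_ideal_def)
  \<comment> \<open>The recursion is \<open>E - i (n + 1) = (E - i n)(E - t)\<close>, multiplied out.\<close>
  define i where "i = rec_nat t (\<lambda>_ s. s + (t - (s o\<^sub>L t)))"
  have i: "i 0 = t" "\<And>n. i (Suc n) = i n + (t - (i n o\<^sub>L t))"
    by (simp_all add: i_def)
  have in_I: "i n \<in> I" for n
  proof (induction n)
    case (Suc n)
    then have "i n o\<^sub>L t \<in> I"
      using IA(1,4) near(1) by blast
    then show ?case
      unfolding i by (intro IA(3) Suc.IH closed_ideal_diff[OF ideal] near(1))
  qed (simp add: i near(1))
  have "norm (E - i n) \<le> norm (E - t) ^ Suc n" for n
  proof (induction n)
    case (Suc n)
    have "(E - i n) o\<^sub>L (E - t) = E - i (Suc n)"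
    proof -
      have "i n \<in> A" "t \<in> A"
        using IA(1) in_I near(1) by blast+
      then have "E o\<^sub>L E = E" "i n o\<^sub>L E = i n" "E o\<^sub>L t = t"
        using unit by blast+
      then show ?thesis
        unfolding i blinfun_compose_diff by simp
    qed
    then have "norm (E - i (Suc n)) \<le> norm (E - i n) * norm (E - t)"
      using norm_blinfun_compose[of "E - i n" "E - t"] by simp
    also have "\<dots> \<le> norm (E - t) ^ Suc n * norm (E - t)"
      by (intro mult_right_mono Suc.IH) simp
    finally show ?case
      by (simp add: mult.commute)
  qed (simp add: i)
  moreover have "(\<lambda>n. norm (E - t) ^ Suc n) \<longlonglongrightarrow> 0"
    using near(2) by (intro LIMSEQ_Suc LIMSEQ_power_zero) simp
  ultimately have "(\<lambda>n. E - i n) \<longlonglongrightarrow> 0"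
    by (metis (no_types, lifting) Lim_null_comparison always_eventually)
  then have "(\<lambda>n. E - (E - i n)) \<longlonglongrightarrow> E - 0"
    by (intro tendsto_diff tendsto_const)
  then have "i \<longlonglongrightarrow> E"
    by simp
  then have E: "E \<in> I"
    using IA(2) in_I closed_sequentially by blast
  have "S \<in> I" if "S \<in> A" for S
    using IA(4)[OF that E] unit(2)[OF that] by simp
  then show ?thesis
    using IA(1) by blast
qed

section \<open>Quasi-lattice ordered submonoids\<close>

locale quasi_lattice_submonoid = group G for G (structure) +
  fixes P :: "'a set"
  assumes submonoid: "P \<subseteq> carrier G" "\<one> \<in> P" "\<And>p q. p \<in> P \<Longrightarrow> q \<in> P \<Longrightarrow> p \<otimes> q \<in> P"
    and quasi_lattice: "quasi_lattice_ordered G P"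
begin

lemma P_carrier [simp]: "p \<in> P \<Longrightarrow> p \<in> carrier G"
  using submonoid(1) by blast

declare submonoid(2) [simp] submonoid(3) [simp]

lemma inv_mult_cancel [simp]:
  assumes "a \<in> carrier G" "x \<in> carrier G"
  shows "inv a \<otimes> (a \<otimes> x) = x" "a \<otimes> (inv a \<otimes> x) = x"
  using assms by (simp_all flip: m_assoc)

lemma in_ideal_iff:
  assumes "p \<in> carrier G"
  shows "x \<in> p <# P \<longleftrightarrow> x \<in> carrier G \<and> inv p \<otimes> x \<in> P"
proof
  assume "x \<in> p <# P"
  then obtain y where "y \<in> P" "x = p \<otimes> y"
    by (auto simp: l_coset_def)
  then show "x \<in> carrier G \<and> inv p \<otimes> x \<in> P"
    using assms by (simp flip: m_assoc)
next
  assume "x \<in> carrier G \<and> inv p \<otimes> x \<in> P"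
  moreover from this have "x = p \<otimes> (inv p \<otimes> x)"
    using assms by (simp flip: m_assoc)
  ultimately show "x \<in> p <# P"
    unfolding l_coset_def by blast
qed

lemma idealI: "y \<in> P \<Longrightarrow> p \<otimes> y \<in> p <# P"
  by (auto simp: l_coset_def)

lemma idealE:
  assumes "x \<in> p <# P"
  obtains y where "y \<in> P" "x = p \<otimes> y"
  using assms by (auto simp: l_coset_def)

lemma self_in_ideal [simp]: "p \<in> carrier G \<Longrightarrow> p \<in> p <# P"
  using idealI[of \<one> p] by simp

lemma ideal_one [simp]: "\<one> <# P = P"
  using submonoid(1) by (auto simp: l_coset_def)

lemma ideal_subset_P: "p \<in> P \<Longrightarrow> x \<in> p <# P \<Longrightarrow> x \<in> P"
  by (auto elim: idealE)

lemma ideal_mult_right: "p \<in> carrier G \<Longrightarrow> x \<in> p <# P \<Longrightarrow> y \<in> P \<Longrightarrow> x \<otimes> y \<in> p <# P"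
  by (elim idealE) (simp add: m_assoc idealI)

lemma ideal_mono: "p \<in> carrier G \<Longrightarrow> x \<in> p <# P \<Longrightarrow> x <# P \<subseteq> p <# P"
  by (auto elim: idealE[of _ x] intro: ideal_mult_right)

lemma translate_in_ideal_iff:
  assumes "g \<in> carrier G" "p \<in> carrier G" "x \<in> carrier G"
  shows "g \<otimes> x \<in> (g \<otimes> p) <# P \<longleftrightarrow> x \<in> p <# P"
proof -
  have "inv (g \<otimes> p) \<otimes> (g \<otimes> x) = inv p \<otimes> x"
    using assms by (simp add: inv_mult_group m_assoc inv_solve_left')
  then show ?thesis
    using assms by (simp add: in_ideal_iff)
qed

lemma translate_ideal:
  assumes "g \<in> carrier G" "p \<in> carrier G" "x \<in> p <# P"
  shows "g \<otimes> x \<in> (g \<otimes> p) <# P"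
proof -
  have "x \<in> carrier G"
    using assms by (simp add: in_ideal_iff)
  then show ?thesis
    using assms by (simp add: translate_in_ideal_iff)
qed

lemma ideal_inter_translate:
  assumes "g \<in> carrier G" "p \<in> carrier G" "q \<in> carrier G" "((g \<otimes> p) <# P) \<inter> ((g \<otimes> q) <# P) \<noteq> {}"
  shows "(p <# P) \<inter> (q <# P) \<noteq> {}"
proof -
  obtain x where x: "x \<in> (g \<otimes> p) <# P" "x \<in> (g \<otimes> q) <# P"
    using assms(4) by blast
  then have "x \<in> carrier G"
    using assms by (simp add: in_ideal_iff)
  then have "x = g \<otimes> (inv g \<otimes> x)" "inv g \<otimes> x \<in> carrier G"
    using assms(1) by (simp_all flip: m_assoc)
  then have "inv g \<otimes> x \<in> (p <# P) \<inter> (q <# P)"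
    using x assms translate_in_ideal_iff by (metis IntI)
  then show ?thesis
    by blast
qed

lemma trivial_units:
  assumes "p \<in> P" "inv p \<in> P"
  shows "p = \<one>"
proof -
  have "p \<in> Units (G\<lparr>carrier := P\<rparr>)"
    using assms by (auto simp: Units_def intro!: bexI[of _ "inv p"])
  then show ?thesis
    using quasi_lattice by (simp add: quasi_lattice_ordered_def)
qed

lemma principal_intersection:
  assumes "g \<in> carrier G" "(g <# P) \<inter> P \<noteq> {}"
  obtains p where "p \<in> P" "(g <# P) \<inter> P = p <# P"
  using assms quasi_lattice that unfolding quasi_lattice_ordered_def by blast

text \<open>
  Translation by \<open>p\<close> reduces this to the intersection of \<open>P\<close> with \<open>p\<inverse>qP\<close>, which is principal by
  quasi-lattice order.
\<close>

lemma right_lcm: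
  assumes "p \<in> P" "q \<in> P" "(p <# P) \<inter> (q <# P) \<noteq> {}"
  obtains m where "m \<in> P" "(p <# P) \<inter> (q <# P) = m <# P"
proof -
  let ?g = "inv p \<otimes> q"
  have g: "?g \<in> carrier G" "p \<otimes> ?g = q"
    using assms by (simp_all flip: m_assoc)
  have iff: "p \<otimes> y \<in> q <# P \<longleftrightarrow> y \<in> ?g <# P" if "y \<in> P" for y
    using translate_in_ideal_iff[of p ?g y] g that assms by simp
  have "(?g <# P) \<inter> P \<noteq> {}"
    using assms iff by (auto elim!: idealE[of _ p])
  then obtain c where c: "c \<in> P" "(?g <# P) \<inter> P = c <# P"
    using principal_intersection g by blast
  have "(p <# P) \<inter> (q <# P) = (p \<otimes> c) <# P"
  proof (intro equalityI subsetI)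
    fix x assume x: "x \<in> (p <# P) \<inter> (q <# P)"
    then obtain y where "y \<in> P" "x = p \<otimes> y"
      by (auto elim: idealE)
    then show "x \<in> (p \<otimes> c) <# P"
      using x iff c assms translate_in_ideal_iff[of p c y] by auto
  next
    fix x assume "x \<in> (p \<otimes> c) <# P"
    then obtain y where y: "y \<in> P" "x = p \<otimes> c \<otimes> y"
      by (auto elim: idealE)
    then have "c \<otimes> y \<in> (?g <# P) \<inter> P" "x = p \<otimes> (c \<otimes> y)"
      using c assms by (auto simp: m_assoc intro: idealI)
    then show "x \<in> (p <# P) \<inter> (q <# P)"
      using iff by (auto intro: idealI)
  qed
  then show thesis
    using that[of "p \<otimes> c"] c assms by simp
qed

text \<open>
  Since \<open>g\<close> is not in \<open>G\<^sub>0\<close>, some \<open>tP\<close> misses \<open>gP\<close> or \<open>g\<inverse>P\<close>. A common point of \<open>tP\<close> and \<open>gtP\<close> lies in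
  \<open>gP\<close>, and its translate by \<open>g\<inverse>\<close> lies in both \<open>g\<inverse>P\<close> and \<open>tP\<close>, so it is excluded in either case.
\<close>

lemma trivial_G0_separates:
  assumes "G0 G P = {\<one>}" "g \<in> carrier G" "g \<noteq> \<one>"
  obtains t where "t \<in> P" "(t <# P) \<inter> ((g \<otimes> t) <# P) = {}"
proof -
  have "g \<notin> G0 G P"
    using assms by simp
  then obtain t where t: "t \<in> P" "(t <# P) \<inter> (g <# P) = {} \<or> (t <# P) \<inter> (inv g <# P) = {}"
    using assms(2) by (auto simp: G0_def)
  have sub: "(g \<otimes> t) <# P \<subseteq> g <# P" "(inv g \<otimes> t) <# P \<subseteq> inv g <# P"
    using t assms(2) by (simp_all add: ideal_mono idealI)
  have "(t <# P) \<inter> ((g \<otimes> t) <# P) = {}"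
  proof (rule ccontr)
    assume ne: "(t <# P) \<inter> ((g \<otimes> t) <# P) \<noteq> {}"
    have "g \<otimes> (inv g \<otimes> t) = t"
      using t assms(2) by (simp flip: m_assoc)
    then have "((inv g \<otimes> t) <# P) \<inter> (t <# P) \<noteq> {}"
      using ideal_inter_translate[of g "inv g \<otimes> t" t] ne t assms(2) by simp
    then show False
      using ne sub t(2) by blast
  qed
  then show thesis
    using that t by blast
qed

text \<open>
  Disjointness of \<open>tP\<close> and \<open>gtP\<close> is inherited by every right multiple of \<open>t\<close>, so finitely many
  group elements can be treated one after the other.
\<close>

lemma trivial_G0_separates_finite:
  assumes "G0 G P = {\<one>}" "finite K" "K \<subseteq> carrier G - {\<one>}"
  obtains t where "t \<in> P" "\<forall>k\<in>K. (t <# P) \<inter> ((k \<otimes> t) <# P) = {}"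
proof -
  from assms(2,3) have "\<exists>t\<in>P. \<forall>k\<in>K. (t <# P) \<inter> ((k \<otimes> t) <# P) = {}"
  proof induction
    case empty
    show ?case
      using submonoid(2) by blast
  next
    case (insert g K)
    then obtain t where t: "t \<in> P" "\<forall>k\<in>K. (t <# P) \<inter> ((k \<otimes> t) <# P) = {}"
      by auto
    \<comment> \<open>Passing from \<open>t\<close> to \<open>ts\<close> conjugates \<open>g\<close> by \<open>t\<close>, and a conjugate of \<open>g\<close> is still not \<open>1\<close>.\<close>
    let ?h = "inv t \<otimes> g \<otimes> t"
    have g: "g \<in> carrier G" "g \<noteq> \<one>"
      using insert.prems by auto
    have "?h \<noteq> \<one>"
    proof
      assume h: "?h = \<one>"
      have "t \<otimes> ?h = g \<otimes> t"
        using t g by (simp flip: m_assoc)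
      then show False
        using h t g by simp
    qed
    then obtain s where s: "s \<in> P" "(s <# P) \<inter> ((?h \<otimes> s) <# P) = {}"
      using trivial_G0_separates[OF assms(1), of ?h] t g by auto
    have "((t \<otimes> s) <# P) \<inter> ((k \<otimes> (t \<otimes> s)) <# P) = {}" if "k \<in> K" for k
    proof -
      have "k \<in> carrier G"
        using insert.prems that by auto
      then have "(t \<otimes> s) <# P \<subseteq> t <# P" "(k \<otimes> (t \<otimes> s)) <# P \<subseteq> (k \<otimes> t) <# P"
        using t s idealI[of s "k \<otimes> t"] by (simp_all add: ideal_mono idealI m_assoc)
      then show ?thesis
        using t that by blast
    qed
    moreover have "((t \<otimes> s) <# P) \<inter> ((g \<otimes> (t \<otimes> s)) <# P) = {}"
    proof (rule ccontr)
      assume "((t \<otimes> s) <# P) \<inter> ((g \<otimes> (t \<otimes> s)) <# P) \<noteq> {}"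
      moreover have "t \<otimes> (?h \<otimes> s) = g \<otimes> (t \<otimes> s)"
        using t s g by (simp flip: m_assoc)
      ultimately show False
        using ideal_inter_translate[of t s "?h \<otimes> s"] t s g by simp
    qed
    ultimately show ?case
      using t s by (intro bexI[of _ "t \<otimes> s"]) auto
  qed
  then show thesis
    using that by blast
qed

section \<open>The left inverse hull\<close>

definition translation_map :: "'a \<Rightarrow> 'a \<Rightarrow> 'a \<rightharpoonup> 'a" where
  "translation_map g a = (\<lambda>x. if x \<in> a <# P then Some (g \<otimes> x) else None)"

lemma dom_translation_map [simp]: "dom (translation_map g a) = a <# P"
  by (auto simp: translation_map_def split: if_splits)

lemma ran_translation_map:
  assumes "g \<in> carrier G" "a \<in> P"
  shows "ran (translation_map g a) = (g \<otimes> a) <# P"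
proof (intro equalityI subsetI)
  fix y assume "y \<in> ran (translation_map g a)"
  then obtain x where "x \<in> a <# P" "y = g \<otimes> x"
    by (auto simp: translation_map_def ran_def split: if_splits)
  then show "y \<in> (g \<otimes> a) <# P"
    using assms by (simp add: translate_ideal)
next
  fix y assume "y \<in> (g \<otimes> a) <# P"
  then obtain z where "z \<in> P" "y = g \<otimes> (a \<otimes> z)"
    using assms by (auto elim!: idealE simp: m_assoc)
  then show "y \<in> ran (translation_map g a)"
    by (auto simp: translation_map_def ran_def intro!: exI[of _ "a \<otimes> z"] idealI)
qed

lemma partial_inverse_translation_map:
  assumes "g \<in> carrier G" "a \<in> P" "g \<otimes> a \<in> P"
  shows "partial_inverse (translation_map g a) = translation_map (inv g) (g \<otimes> a)"
proof
  fix y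
  show "partial_inverse (translation_map g a) y = translation_map (inv g) (g \<otimes> a) y"
  proof (cases "y \<in> (g \<otimes> a) <# P")
    case True
    then have y: "y \<in> carrier G"
      using assms by (simp add: in_ideal_iff)
    have "translation_map g a x = Some y \<longleftrightarrow> x = inv g \<otimes> y" for x
    proof
      assume "translation_map g a x = Some y"
      then have "x \<in> a <# P" "y = g \<otimes> x"
        by (auto simp: translation_map_def split: if_splits)
      then show "x = inv g \<otimes> y"
        using assms by (auto simp: in_ideal_iff simp flip: m_assoc)
    next
      assume "x = inv g \<otimes> y"
      then have x: "x \<in> carrier G" "g \<otimes> x = y"
        using y assms by (simp_all flip: m_assoc)
      then have "x \<in> a <# P"
        using True translate_in_ideal_iff[of g a x] assms by simp
      then show "translation_map g a x = Some y"
        using x by (simp add: translation_map_def)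
    qed
    then have "(THE x. translation_map g a x = Some y) = inv g \<otimes> y"
      by simp
    then show ?thesis
      using True assms
      by (simp add: partial_inverse_def ran_translation_map) (simp add: translation_map_def)
  next
    case False
    then show ?thesis
      using assms
      by (simp add: partial_inverse_def ran_translation_map) (simp add: translation_map_def)
  qed
qed

text \<open>
  The domain of the composite is the preimage under \<open>h\<close> of \<open>hbP \<inter> aP\<close>, which is empty or some \<open>mP\<close>
  because any two principal ideals have an empty or principal intersection.
\<close>

lemma comp_translation_map:
  assumes "g \<in> carrier G" "a \<in> P" "g \<otimes> a \<in> P" "h \<in> carrier G" "b \<in> P" "h \<otimes> b \<in> P"
  shows "translation_map g a \<circ>\<^sub>m translation_map h b = Map.empty \<or>
    (\<exists>c\<in>P. g \<otimes> h \<otimes> c \<in> P \<and>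
      translation_map g a \<circ>\<^sub>m translation_map h b = translation_map (g \<otimes> h) c)"
proof (cases "((h \<otimes> b) <# P) \<inter> (a <# P) = {}")
  case True
  have "(translation_map g a \<circ>\<^sub>m translation_map h b) x = None" for x
  proof (cases "x \<in> b <# P")
    case x: True
    then have "h \<otimes> x \<in> (h \<otimes> b) <# P"
      using assms by (simp add: translate_ideal)
    then show ?thesis
      using True x by (auto simp: map_comp_def translation_map_def)
  qed (simp add: map_comp_def translation_map_def)
  then show ?thesis
    by blast
next
  case False
  then obtain m where m: "m \<in> P" "((h \<otimes> b) <# P) \<inter> (a <# P) = m <# P"
    using right_lcm assms by blast
  define c where "c = inv h \<otimes> m"
  have hc: "c \<in> carrier G" "h \<otimes> c = m"
    using m assms by (simp_all add: c_def)
  have "m \<in> (h \<otimes> b) <# P" "m \<in> a <# P"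
    using m(2) self_in_ideal[OF P_carrier[OF m(1)]] by auto
  then have "c \<in> b <# P"
    using translate_in_ideal_iff[of h b c] hc assms by simp
  then have "c \<in> P"
    using assms ideal_subset_P by blast
  moreover have "g \<otimes> h \<otimes> c \<in> P"
  proof -
    have "g \<otimes> m \<in> (g \<otimes> a) <# P"
      using \<open>m \<in> a <# P\<close> assms m by (simp add: translate_ideal)
    then show ?thesis
      using hc assms ideal_subset_P by (simp add: m_assoc)
  qed
  moreover have "(translation_map g a \<circ>\<^sub>m translation_map h b) x = translation_map (g \<otimes> h) c x" for x
  proof (cases "x \<in> carrier G")
    case True
    have "x \<in> b <# P \<and> h \<otimes> x \<in> a <# P \<longleftrightarrow> h \<otimes> x \<in> m <# P"
      using m(2) translate_in_ideal_iff[of h b x] assms True by auto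
    also have "\<dots> \<longleftrightarrow> x \<in> c <# P"
      using translate_in_ideal_iff[of h c x] assms hc True by simp
    finally show ?thesis
      using assms True by (auto simp: map_comp_def translation_map_def m_assoc)
  next
    case False
    then have "x \<notin> b <# P" "x \<notin> c <# P"
      using assms hc by (simp_all add: in_ideal_iff)
    then show ?thesis
      by (simp add: map_comp_def translation_map_def)
  qed
  ultimately show ?thesis
    by blast
qed

lemma hull_cases:
  assumes "s \<in> left_inverse_hull G P" "s \<noteq> Map.empty"
  obtains g a where "g \<in> carrier G" "a \<in> P" "g \<otimes> a \<in> P" "s = translation_map g a"
proof -
  from assms(1) have "s = Map.empty \<or>
    (\<exists>g\<in>carrier G. \<exists>a\<in>P. g \<otimes> a \<in> P \<and> s = translation_map g a)"
  proof induction
    case (translation p)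
    then show ?case
      by (intro disjI2 bexI[of _ p] bexI[of _ \<one>]) (auto simp: translation_map_def)
  next
    case (inverse s)
    then show ?case
    proof (elim disjE bexE conjE)
      fix g a assume *: "g \<in> carrier G" "a \<in> P" "g \<otimes> a \<in> P" "s = translation_map g a"
      then have "inv g \<otimes> (g \<otimes> a) = a"
        by (simp flip: m_assoc)
      then show ?thesis
        using * partial_inverse_translation_map
        by (intro disjI2 bexI[of _ "inv g"] bexI[of _ "g \<otimes> a"]) auto
    qed (auto simp: partial_inverse_def)
  next
    case (comp s t)
    then show ?case
    proof (elim disjE bexE conjE)
      fix g a h b
      assume "g \<in> carrier G" "a \<in> P" "g \<otimes> a \<in> P" "s = translation_map g a"
        "h \<in> carrier G" "b \<in> P" "h \<otimes> b \<in> P" "t = translation_map h b"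
      then show ?thesis
        using comp_translation_map[of g a h b] by blast
    qed (simp_all add: map_comp_def split: option.splits)
  qed
  then show thesis
    using assms(2) that by blast
qed

text \<open>
  The translation is the composite of left multiplication by \<open>ga\<close> with the inverse of left
  multiplication by \<open>a\<close>.
\<close>

lemma translation_map_in_hull:
  assumes "g \<in> carrier G" "a \<in> P" "g \<otimes> a \<in> P"
  shows "translation_map g a \<in> left_inverse_hull G P"
proof -
  have tr: "translation_map p \<one> \<in> left_inverse_hull G P" if "p \<in> P" for p
    using left_inverse_hull.translation[OF that, of G] by (simp add: translation_map_def)
  have "partial_inverse (translation_map a \<one>) = translation_map (inv a) a"
    using partial_inverse_translation_map[of a \<one>] assms by simp
  then have inv: "translation_map (inv a) a \<in> left_inverse_hull G P"
    using left_inverse_hull.inverse[OF tr[OF assms(2)]] by simp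
  have "translation_map (g \<otimes> a) \<one> \<circ>\<^sub>m translation_map (inv a) a = translation_map g a"
  proof
    fix x
    have "g \<otimes> a \<otimes> (inv a \<otimes> x) = g \<otimes> x" "inv a \<otimes> x \<in> P" if "x \<in> a <# P"
      using that assms by (simp_all add: in_ideal_iff m_assoc)
    then show "(translation_map (g \<otimes> a) \<one> \<circ>\<^sub>m translation_map (inv a) a) x = translation_map g a x"
      by (auto simp: map_comp_def translation_map_def)
  qed
  then show ?thesis
    using left_inverse_hull.comp[OF tr[OF assms(3)] inv] by simp
qed

lemma translation_map_nonempty: "a \<in> P \<Longrightarrow> translation_map g a \<noteq> Map.empty"
  using dom_translation_map[of g a] self_in_ideal[of a] by (metis P_carrier dom_empty empty_iff)

lemma group_part_translation_map:
  assumes "g \<in> carrier G" "a \<in> P"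
  shows "group_part G (translation_map g a) = g"
  unfolding group_part_def
proof (rule the_equality)
  show "g \<in> carrier G \<and> (\<forall>x\<in>dom (translation_map g a). translation_map g a x = Some (g \<otimes> x))"
    using assms by (auto simp: translation_map_def split: if_splits)
next
  fix h assume h: "h \<in> carrier G \<and>
    (\<forall>x\<in>dom (translation_map g a). translation_map g a x = Some (h \<otimes> x))"
  then have "translation_map g a a = Some (h \<otimes> a)"
    using assms by simp
  then have "h \<otimes> a = g \<otimes> a"
    using assms by (simp add: translation_map_def)
  then show "h = g"
    using assms h by simp
qed

lemma ideal_constructible [simp]:
  assumes "p \<in> P"
  shows "p <# P \<in> constructible_ideals G P"
proof -
  have "translation_map \<one> p \<in> left_inverse_hull G P"
    using assms by (intro translation_map_in_hull) auto
  then show ?thesis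
    unfolding constructible_ideals_def by (metis dom_translation_map imageI)
qed

lemma P_constructible [simp]: "P \<in> constructible_ideals G P"
  using ideal_constructible[of \<one>] by simp

lemma constructible_cases:
  assumes "X \<in> constructible_ideals G P" "X \<noteq> {}"
  obtains p where "p \<in> P" "X = p <# P"
proof -
  obtain s where s: "s \<in> left_inverse_hull G P" "X = dom s"
    using assms(1) by (auto simp: constructible_ideals_def)
  then have "s \<noteq> Map.empty"
    using assms(2) by auto
  then show thesis
    using hull_cases[OF s(1)] s(2) that by (metis dom_translation_map)
qed

text \<open>
  The composite of the identity maps of two ideals is the identity map of their intersection. So the
  empty set is constructible as soon as it is such an intersection, and the multiplicativity of a
  character applies to any two constructible ideals.
\<close>

lemma constructible_Int:
  assumes "X \<in> constructible_ideals G P" "Y \<in> constructible_ideals G P"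
  shows "X \<inter> Y \<in> constructible_ideals G P"
proof (cases "X = {} \<or> Y = {}")
  case True
  then show ?thesis
    using assms by auto
next
  case False
  then obtain p q where pq: "p \<in> P" "X = p <# P" "q \<in> P" "Y = q <# P"
    using assms constructible_cases by metis
  then have "translation_map \<one> p \<circ>\<^sub>m translation_map \<one> q \<in> left_inverse_hull G P"
    by (intro left_inverse_hull.comp translation_map_in_hull) auto
  moreover have "dom (translation_map \<one> p \<circ>\<^sub>m translation_map \<one> q) = X \<inter> Y"
    using pq by (auto simp: map_comp_def translation_map_def in_ideal_iff split: if_splits)
  ultimately show ?thesis
    unfolding constructible_ideals_def by (metis imageI)
qed

section \<open>Characters and filters\<close>

definition ideal_filter :: "'a set \<Rightarrow> bool" where
  "ideal_filter F \<longleftrightarrow> F \<subseteq> P \<and> \<one> \<in> F \<and>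
     (\<forall>p\<in>F. \<forall>q\<in>P. p \<in> q <# P \<longrightarrow> q \<in> F) \<and>
     (\<forall>p\<in>F. \<forall>q\<in>F. \<exists>r\<in>F. r \<in> p <# P \<and> r \<in> q <# P)"

definition filter_of :: "'a character \<Rightarrow> 'a set" where
  "filter_of \<phi> = {p \<in> P. \<phi> (p <# P) = 1}"

text \<open>
  A filter meets a principal ideal exactly if it contains the generator. Unlike membership of the
  generator, meeting also makes sense for the empty ideal.
\<close>

definition character_of :: "'a set \<Rightarrow> 'a character" where
  "character_of F =
     restrict (\<lambda>X. if F \<inter> X \<noteq> {} then 1 else 0) (constructible_ideals G P)"

lemma ideal_filterD:
  assumes "ideal_filter F"
  shows "\<And>p. p \<in> F \<Longrightarrow> p \<in> P" "\<one> \<in> F" "\<And>p q. p \<in> F \<Longrightarrow> q \<in> P \<Longrightarrow> p \<in> q <# P \<Longrightarrow> q \<in> F"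
    "\<And>p q. p \<in> F \<Longrightarrow> q \<in> F \<Longrightarrow> \<exists>r\<in>F. r \<in> p <# P \<and> r \<in> q <# P"
  using assms unfolding ideal_filter_def by blast+

lemma filter_of_character:
  assumes "\<phi> \<in> characters G P"
  shows "ideal_filter (filter_of \<phi>)"
proof -
  let ?J = "constructible_ideals G P"
  have \<phi>: "\<phi> X = 0 \<or> \<phi> X = 1" if "X \<in> ?J" for X
    using assms that by (auto simp: characters_def)
  have mult: "\<phi> (X \<inter> Y) = \<phi> X * \<phi> Y" if "X \<in> ?J" "Y \<in> ?J" for X Y
    using assms that by (auto simp: characters_def)
  have empty: "\<phi> {} = 0" if "{} \<in> ?J"
    using assms that by (auto simp: characters_def)
  obtain X where X: "X \<in> ?J" "\<phi> X \<noteq> 0"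
    using assms by (auto simp: characters_def)
  have "X \<inter> P = X"
    using X(1) by (cases "X = {}") (auto elim!: constructible_cases dest: ideal_subset_P)
  then have one: "\<phi> P = 1"
    using mult[OF X(1) P_constructible] X(2) by simp
  show ?thesis
    unfolding ideal_filter_def
  proof (intro conjI ballI impI)
    show "filter_of \<phi> \<subseteq> P"
      by (auto simp: filter_of_def)
    show "\<one> \<in> filter_of \<phi>"
      using one by (simp add: filter_of_def)
  next
    fix p q assume "p \<in> filter_of \<phi>" "q \<in> P" "p \<in> q <# P"
    moreover from this have "(p <# P) \<inter> (q <# P) = p <# P"
      using ideal_mono[of q p] by auto
    ultimately show "q \<in> filter_of \<phi>"
      using mult[of "p <# P" "q <# P"] by (simp add: filter_of_def)
  next
    fix p q assume "p \<in> filter_of \<phi>" "q \<in> filter_of \<phi>"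
    then have pq: "p \<in> P" "q \<in> P" "\<phi> ((p <# P) \<inter> (q <# P)) = 1"
      using mult[of "p <# P" "q <# P"] by (auto simp: filter_of_def)
    then have "(p <# P) \<inter> (q <# P) \<noteq> {}"
      using empty constructible_Int[of "p <# P" "q <# P"] by auto
    then obtain m where m: "m \<in> P" "(p <# P) \<inter> (q <# P) = m <# P"
      using right_lcm pq by blast
    moreover have "m \<in> m <# P"
      using m by simp
    ultimately show "\<exists>r\<in>filter_of \<phi>. r \<in> p <# P \<and> r \<in> q <# P"
      using pq by (auto simp: filter_of_def intro!: bexI[of _ m])
  qed
qed

lemma filter_meets_ideal_iff:
  assumes "ideal_filter F" "p \<in> P"
  shows "F \<inter> (p <# P) \<noteq> {} \<longleftrightarrow> p \<in> F"
  using ideal_filterD(3)[OF assms(1) _ assms(2)] self_in_ideal[OF P_carrier[OF assms(2)]] by blast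

lemma character_of_filter:
  assumes "ideal_filter F"
  shows "character_of F \<in> characters G P"
proof -
  let ?J = "constructible_ideals G P"
  have "character_of F (X \<inter> Y) = character_of F X * character_of F Y" if XY: "X \<in> ?J" "Y \<in> ?J" for X Y
  proof -
    have "F \<inter> (X \<inter> Y) \<noteq> {}" if meet: "F \<inter> X \<noteq> {}" "F \<inter> Y \<noteq> {}"
    proof -
      obtain p q where pq: "p \<in> P" "X = p <# P" "q \<in> P" "Y = q <# P"
        using meet XY constructible_cases by (metis Int_empty_right)
      then show ?thesis
        using meet ideal_filterD(4)[OF assms] filter_meets_ideal_iff[OF assms] by blast
    qed
    then have "F \<inter> (X \<inter> Y) \<noteq> {} \<longleftrightarrow> F \<inter> X \<noteq> {} \<and> F \<inter> Y \<noteq> {}"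
      by blast
    then show ?thesis
      using XY constructible_Int by (simp add: character_of_def)
  qed
  moreover have "character_of F P \<noteq> 0"
    using ideal_filterD(1,2)[OF assms] by (auto simp: character_of_def)
  ultimately show ?thesis
    unfolding characters_def
    by (auto simp: character_of_def intro!: bexI[of _ P])
qed

lemma filter_of_character_of:
  assumes "ideal_filter F"
  shows "filter_of (character_of F) = F"
  using ideal_filterD(1)[OF assms] filter_meets_ideal_iff[OF assms]
  by (auto simp: filter_of_def character_of_def)

lemma character_of_filter_of:
  assumes "\<phi> \<in> characters G P"
  shows "character_of (filter_of \<phi>) = \<phi>"
proof
  fix X
  show "character_of (filter_of \<phi>) X = \<phi> X"
  proof (cases "X \<in> constructible_ideals G P")
    case True
    then have \<phi>: "\<phi> X = 0 \<or> \<phi> X = 1" "X = {} \<Longrightarrow> \<phi> X = 0"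
      using assms by (auto simp: characters_def)
    show ?thesis
    proof (cases "X = {}")
      case False
      then obtain p where p: "p \<in> P" "X = p <# P"
        using True constructible_cases by blast
      then show ?thesis
        using \<phi> True filter_meets_ideal_iff[OF filter_of_character[OF assms] p(1)]
        by (auto simp: character_of_def) (simp_all add: filter_of_def)
    qed (use \<phi> True in \<open>simp add: character_of_def\<close>)
  next
    case False
    then show ?thesis
      using assms by (auto simp: character_of_def characters_def)
  qed
qed

lemma character_eqI:
  assumes "\<phi> \<in> characters G P" "\<psi> \<in> characters G P" "filter_of \<phi> = filter_of \<psi>"
  shows "\<phi> = \<psi>"
  using assms character_of_filter_of by metis

lemma character_value:
  assumes "\<phi> \<in> characters G P" "X \<in> constructible_ideals G P"
  shows "\<phi> X = (if filter_of \<phi> \<inter> X \<noteq> {} then 1 else 0)"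
proof -
  have "character_of (filter_of \<phi>) X = (if filter_of \<phi> \<inter> X \<noteq> {} then 1 else 0)"
    using assms(2) by (simp add: character_of_def)
  then show ?thesis
    using character_of_filter_of[OF assms(1)] by simp
qed

lemma char_support_eq:
  assumes "\<phi> \<in> characters G P"
  shows "char_support G P \<phi> = (\<lambda>p. p <# P) ` filter_of \<phi>"
proof -
  have "X \<in> (\<lambda>p. p <# P) ` filter_of \<phi>" if X: "X \<in> char_support G P \<phi>" for X
  proof -
    have "X \<in> constructible_ideals G P" "X \<noteq> {}"
      using X assms by (auto simp: char_support_def characters_def)
    then obtain p where "p \<in> P" "X = p <# P"
      using constructible_cases by blast
    then show ?thesis
      using X by (auto simp: char_support_def filter_of_def)
  qed
  moreover have "p <# P \<in> char_support G P \<phi>" if "p \<in> filter_of \<phi>" for p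
    using that by (simp add: char_support_def filter_of_def)
  ultimately show ?thesis
    by blast
qed

lemma char_support_subset_iff:
  assumes "\<phi> \<in> characters G P" "\<psi> \<in> characters G P"
  shows "char_support G P \<phi> \<subseteq> char_support G P \<psi> \<longleftrightarrow> filter_of \<phi> \<subseteq> filter_of \<psi>"
proof
  assume sub: "char_support G P \<phi> \<subseteq> char_support G P \<psi>"
  show "filter_of \<phi> \<subseteq> filter_of \<psi>"
  proof
    fix p assume "p \<in> filter_of \<phi>"
    then have "p \<in> P" "p <# P \<in> char_support G P \<phi>"
      by (simp_all add: filter_of_def char_support_def)
    then have "p \<in> P" "p <# P \<in> char_support G P \<psi>"
      using sub by blast+
    then show "p \<in> filter_of \<psi>"
      by (simp add: filter_of_def char_support_def)
  qed
next
  assume "filter_of \<phi> \<subseteq> filter_of \<psi>"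
  then show "char_support G P \<phi> \<subseteq> char_support G P \<psi>"
    using assms by (auto simp: char_support_eq)
qed

lemma maximal_characters_iff:
  "\<phi> \<in> maximal_characters G P \<longleftrightarrow> \<phi> \<in> characters G P \<and>
    (\<forall>F. ideal_filter F \<longrightarrow> filter_of \<phi> \<subseteq> F \<longrightarrow> F = filter_of \<phi>)"
proof (intro iffI conjI allI impI)
  assume \<phi>: "\<phi> \<in> maximal_characters G P"
  then show char: "\<phi> \<in> characters G P"
    by (simp add: maximal_characters_def)
  fix F assume F: "ideal_filter F" "filter_of \<phi> \<subseteq> F"
  then have "char_support G P \<phi> \<subseteq> char_support G P (character_of F)"
    using char_support_subset_iff[OF char character_of_filter[OF F(1)]]
    by (simp add: filter_of_character_of)
  then have "char_support G P (character_of F) = char_support G P \<phi>"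
    using \<phi> character_of_filter[OF F(1)] unfolding maximal_characters_def by blast
  then have "filter_of (character_of F) \<subseteq> filter_of \<phi>"
    using char_support_subset_iff[OF character_of_filter[OF F(1)] char] by simp
  then have "filter_of (character_of F) = filter_of \<phi>"
    using F by (simp add: filter_of_character_of)
  then show "F = filter_of \<phi>"
    using F by (simp add: filter_of_character_of)
next
  assume \<phi>: "\<phi> \<in> characters G P \<and> (\<forall>F. ideal_filter F \<longrightarrow> filter_of \<phi> \<subseteq> F \<longrightarrow> F = filter_of \<phi>)"
  have "char_support G P \<psi> = char_support G P \<phi>"
    if "\<psi> \<in> characters G P" "char_support G P \<phi> \<subseteq> char_support G P \<psi>" for \<psi>
  proof -
    have "filter_of \<psi> = filter_of \<phi>"
      using that \<phi> char_support_subset_iff filter_of_character by simp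
    then show ?thesis
      using that(1) \<phi> character_eqI by blast
  qed
  then show "\<phi> \<in> maximal_characters G P"
    using \<phi> by (simp add: maximal_characters_def)
qed

lemma ideal_filter_Union:
  assumes "\<C> \<noteq> {}" "\<forall>F\<in>\<C>. ideal_filter F" "\<And>F H. F \<in> \<C> \<Longrightarrow> H \<in> \<C> \<Longrightarrow> F \<subseteq> H \<or> H \<subseteq> F"
  shows "ideal_filter (\<Union>\<C>)"
  unfolding ideal_filter_def
proof (intro conjI ballI impI)
  show "\<Union>\<C> \<subseteq> P" "\<one> \<in> \<Union>\<C>"
    using assms(1,2) by (auto dest: ideal_filterD(1,2))
next
  fix p q assume "p \<in> \<Union>\<C>" "q \<in> P" "p \<in> q <# P"
  then show "q \<in> \<Union>\<C>"
    using assms(2) ideal_filterD(3) by blast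
next
  fix p q assume "p \<in> \<Union>\<C>" "q \<in> \<Union>\<C>"
  then obtain F where "F \<in> \<C>" "p \<in> F" "q \<in> F"
    using assms(3) by blast
  then show "\<exists>r\<in>\<Union>\<C>. r \<in> p <# P \<and> r \<in> q <# P"
    using assms(2) ideal_filterD(4) by blast
qed

lemma exists_maximal_character:
  assumes "r \<in> P"
  obtains \<omega> where "\<omega> \<in> maximal_characters G P" "r \<in> filter_of \<omega>"
proof -
  let ?A = "{F. ideal_filter F \<and> r \<in> F}"
  have "ideal_filter {q \<in> P. r \<in> q <# P}"
    unfolding ideal_filter_def
  proof (intro conjI ballI impI)
    fix p q assume *: "p \<in> {q \<in> P. r \<in> q <# P}" "q \<in> P" "p \<in> q <# P"
    then show "q \<in> {q \<in> P. r \<in> q <# P}"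
      using ideal_mono[of q p] by auto
  next
    fix p q assume *: "p \<in> {q \<in> P. r \<in> q <# P}" "q \<in> {q \<in> P. r \<in> q <# P}"
    then show "\<exists>s\<in>{q \<in> P. r \<in> q <# P}. s \<in> p <# P \<and> s \<in> q <# P"
      using assms by (auto intro!: bexI[of _ r])
  qed (use assms in auto)
  then have ne: "?A \<noteq> {}"
    using assms by auto
  have "\<exists>M\<in>?A. \<forall>F\<in>?A. M \<subseteq> F \<longrightarrow> F = M"
  proof (rule subset_Zorn_nonempty[OF ne])
    fix \<C> assume "\<C> \<noteq> {}" "subset.chain ?A \<C>"
    then show "\<Union>\<C> \<in> ?A"
      using ideal_filter_Union[of \<C>] by (auto simp: subset_chain_def)
  qed
  then obtain M where M: "ideal_filter M" "r \<in> M" "\<And>F. ideal_filter F \<Longrightarrow> M \<subseteq> F \<Longrightarrow> F = M"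
    by blast
  show thesis
  proof (rule that)
    show "character_of M \<in> maximal_characters G P" "r \<in> filter_of (character_of M)"
      using M by (auto simp: maximal_characters_iff character_of_filter filter_of_character_of)
  qed
qed

lemma filter_finite_lower_bound:
  assumes "ideal_filter F" "finite A" "A \<subseteq> F"
  obtains r where "r \<in> F" "\<forall>a\<in>A. r \<in> a <# P"
proof -
  from assms(2,3) have "\<exists>r\<in>F. \<forall>a\<in>A. r \<in> a <# P"
  proof induction
    case empty
    show ?case
      using ideal_filterD(2)[OF assms(1)] by blast
  next
    case (insert a A)
    then obtain r where r: "r \<in> F" "\<forall>a\<in>A. r \<in> a <# P"
      by auto
    then obtain s where s: "s \<in> F" "s \<in> a <# P" "s \<in> r <# P"
      using ideal_filterD(4)[OF assms(1), of a r] insert.prems by auto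
    have "s \<in> b <# P" if "b \<in> A" for b
    proof -
      have "b \<in> P"
        using that insert.prems ideal_filterD(1)[OF assms(1)] by blast
      then show ?thesis
        using that r s ideal_mono[of b r] by auto
    qed
    then show ?case
      using s by blast
  qed
  then show thesis
    using that by blast
qed

text \<open>
  If \<open>q\<close> had a common multiple with every element of \<open>F\<close>, the ideals \<open>pP \<inter> qP\<close> with \<open>p \<in> F\<close>
  would generate a larger filter.
\<close>

lemma maximal_filter_separates:
  assumes "ideal_filter F" "\<And>H. ideal_filter H \<Longrightarrow> F \<subseteq> H \<Longrightarrow> H = F"
    and "q \<in> P" "q \<notin> F"
  shows "\<exists>r\<in>F. (r <# P) \<inter> (q <# P) = {}"
proof (rule ccontr)
  assume meet: "\<not> (\<exists>r\<in>F. (r <# P) \<inter> (q <# P) = {})"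
  define H where "H = {a \<in> P. \<exists>p\<in>F. (p <# P) \<inter> (q <# P) \<subseteq> a <# P}"
  note F = ideal_filterD[OF assms(1)]
  have "ideal_filter H"
    unfolding ideal_filter_def
  proof (intro conjI ballI impI)
    show "H \<subseteq> P"
      by (auto simp: H_def)
    show "\<one> \<in> H"
      using F(2) ideal_subset_P[OF assms(3)] by (auto simp: H_def intro!: bexI[of _ \<one>])
  next
    fix a b assume "a \<in> H" "b \<in> P" "a \<in> b <# P"
    then show "b \<in> H"
      using ideal_mono[of b a] by (auto simp: H_def)
  next
    fix a b assume "a \<in> H" "b \<in> H"
    then obtain p p' where p: "p \<in> F" "(p <# P) \<inter> (q <# P) \<subseteq> a <# P"
      and p': "p' \<in> F" "(p' <# P) \<inter> (q <# P) \<subseteq> b <# P"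
      by (auto simp: H_def)
    obtain r where r: "r \<in> F" "r \<in> p <# P" "r \<in> p' <# P"
      using F(4) p p' by blast
    then have sub: "r <# P \<subseteq> p <# P" "r <# P \<subseteq> p' <# P"
      using F(1) p p' by (simp_all add: ideal_mono)
    obtain m where m: "m \<in> P" "(r <# P) \<inter> (q <# P) = m <# P"
      using right_lcm[OF F(1)[OF r(1)] assms(3)] meet r(1) by blast
    then have "m \<in> (r <# P) \<inter> (q <# P)"
      using self_in_ideal[OF P_carrier[OF m(1)]] by blast
    then have "m \<in> r <# P" "m \<in> q <# P"
      by blast+
    then have "m \<in> H" "m \<in> a <# P" "m \<in> b <# P"
      using m r p p' sub by (auto simp: H_def)
    then show "\<exists>m\<in>H. m \<in> a <# P \<and> m \<in> b <# P"
      by blast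
  qed
  moreover have "F \<subseteq> H"
    using F(1) by (auto simp: H_def)
  moreover have "q \<in> H"
    using F(2) assms(3) by (auto simp: H_def)
  ultimately show False
    using assms(2,4) by blast
qed

section \<open>The boundary\<close>

text \<open>
  The condition says that every basic neighbourhood of the character with filter \<open>F\<close>, given by
  \<open>p \<in> F\<close> and finitely many \<open>q \<notin> F\<close>, contains all characters that are \<open>1\<close> on some \<open>rP\<close>.
\<close>

definition boundary_filter :: "'a set \<Rightarrow> bool" where
  "boundary_filter F \<longleftrightarrow> ideal_filter F \<and>
     (\<forall>p\<in>F. \<forall>Q. finite Q \<longrightarrow> Q \<subseteq> P - F \<longrightarrow>
       (\<exists>r\<in>P. r \<in> p <# P \<and> (\<forall>q\<in>Q. (r <# P) \<inter> (q <# P) = {})))"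

lemma maximal_filter_boundary:
  assumes "ideal_filter F" "\<And>H. ideal_filter H \<Longrightarrow> F \<subseteq> H \<Longrightarrow> H = F"
  shows "boundary_filter F"
  unfolding boundary_filter_def
proof (intro conjI ballI allI impI assms(1))
  fix p Q assume p: "p \<in> F" and Q: "finite Q" "Q \<subseteq> P - F"
  have "\<forall>q\<in>Q. \<exists>r\<in>F. (r <# P) \<inter> (q <# P) = {}"
    using maximal_filter_separates[OF assms] Q(2) by blast
  then obtain s where s: "\<And>q. q \<in> Q \<Longrightarrow> s q \<in> F \<and> (s q <# P) \<inter> (q <# P) = {}"
    by metis
  then have "insert p (s ` Q) \<subseteq> F"
    using p by auto
  then obtain r where r: "r \<in> F" "\<forall>a\<in>insert p (s ` Q). r \<in> a <# P"
    using filter_finite_lower_bound[OF assms(1), of "insert p (s ` Q)"] Q(1) by blast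
  have "(r <# P) \<inter> (q <# P) = {}" if "q \<in> Q" for q
  proof -
    have "s q \<in> P" "r \<in> s q <# P"
      using r s[OF that] that ideal_filterD(1)[OF assms(1)] by auto
    then have "r <# P \<subseteq> s q <# P"
      by (simp add: ideal_mono)
    then show ?thesis
      using s[OF that] by blast
  qed
  then show "\<exists>r\<in>P. r \<in> p <# P \<and> (\<forall>q\<in>Q. (r <# P) \<inter> (q <# P) = {})"
    using r ideal_filterD(1)[OF assms(1)] by auto
qed

lemma maximal_character_boundary:
  assumes "\<omega> \<in> maximal_characters G P"
  shows "boundary_filter (filter_of \<omega>)"
proof (rule maximal_filter_boundary)
  show "ideal_filter (filter_of \<omega>)"
    using assms maximal_characters_iff filter_of_character by blast
  show "H = filter_of \<omega>" if "ideal_filter H" "filter_of \<omega> \<subseteq> H" for H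
    using assms that maximal_characters_iff by blast
qed

lemma topspace_character_topology [simp]:
  "topspace (character_topology G P) = characters G P"
  by (auto simp: character_topology_def characters_def)

lemma openin_evaluation:
  assumes "X \<in> constructible_ideals G P"
  shows "openin (character_topology G P) {\<phi> \<in> characters G P. \<phi> X \<in> A}"
proof -
  have "continuous_map (character_topology G P) (discrete_topology {0, 1}) (\<lambda>\<phi>. \<phi> X)"
    unfolding character_topology_def
    by (intro continuous_map_from_subtopology continuous_map_product_projection assms)
  then have "openin (character_topology G P) {\<phi> \<in> topspace (character_topology G P). \<phi> X \<in> A \<inter> {0, 1}}"
    by (rule openin_continuous_map_preimage) simp
  moreover have "\<phi> X \<in> {0, 1}" if "\<phi> \<in> characters G P" for \<phi>
    using that assms by (auto simp: characters_def)
  ultimately show ?thesis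
    by (auto elim!: back_subst[of "openin _"])
qed

lemma openin_basic_neighbourhood:
  assumes "p \<in> P" "finite Q" "Q \<subseteq> P"
  shows "openin (character_topology G P) {\<phi> \<in> characters G P. p \<in> filter_of \<phi> \<and> Q \<inter> filter_of \<phi> = {}}"
proof -
  let ?T = "character_topology G P"
  have rest: "openin ?T ((\<Inter>q\<in>Q. {\<phi> \<in> characters G P. \<phi> (q <# P) \<in> - {1}}) \<inter> topspace ?T)"
    using assms(2,3)
  proof (induction rule: finite_induct)
    case (insert q Q)
    have "openin ?T ({\<phi> \<in> characters G P. \<phi> (q <# P) \<in> - {1}} \<inter>
        ((\<Inter>q\<in>Q. {\<phi> \<in> characters G P. \<phi> (q <# P) \<in> - {1}}) \<inter> topspace ?T))"
      using insert by (intro openin_Int openin_evaluation insert.IH ideal_constructible) auto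
    then show ?case
      by (simp add: Int_assoc)
  next
    case empty
    show ?case
      using openin_topspace[of ?T] by simp
  qed
  have "openin ?T ({\<phi> \<in> characters G P. \<phi> (p <# P) \<in> {1}} \<inter>
      ((\<Inter>q\<in>Q. {\<phi> \<in> characters G P. \<phi> (q <# P) \<in> - {1}}) \<inter> topspace ?T))"
    using assms by (intro openin_Int openin_evaluation rest) simp
  then show ?thesis
    using assms by (auto simp: filter_of_def elim!: back_subst[of "openin _"])
qed

lemma openin_contains_basic_neighbourhood:
  assumes "openin (character_topology G P) V" "\<phi> \<in> V"
  obtains p Q where "p \<in> filter_of \<phi>" "finite Q" "Q \<subseteq> P - filter_of \<phi>"
    "\<And>\<psi>. \<psi> \<in> characters G P \<Longrightarrow> p \<in> filter_of \<psi> \<Longrightarrow> Q \<inter> filter_of \<psi> = {} \<Longrightarrow> \<psi> \<in> V"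
proof -
  let ?J = "constructible_ideals G P"
  obtain W where W: "openin (product_topology (\<lambda>_. discrete_topology {0, 1 :: nat}) ?J) W"
    "V = W \<inter> characters G P"
    using assms(1) by (auto simp: character_topology_def openin_subtopology)
  have \<phi>: "\<phi> \<in> characters G P" "\<phi> \<in> W"
    using W assms(2) by auto
  obtain U where U: "finite {X \<in> ?J. U X \<noteq> {0, 1 :: nat}}" "\<phi> \<in> Pi\<^sub>E ?J U" "Pi\<^sub>E ?J U \<subseteq> W"
    using W(1) \<phi>(2) unfolding openin_product_topology_alt by auto
  define K where "K = {X \<in> ?J. U X \<noteq> {0, 1 :: nat}}"
  define gen where "gen = (\<lambda>X. SOME p. p \<in> P \<and> X = p <# P)"
  have gen: "gen X \<in> P \<and> X = gen X <# P" if "X \<in> ?J" "X \<noteq> {}" for X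
    unfolding gen_def by (rule someI_ex) (use that constructible_cases in blast)
  note F = filter_of_character[OF \<phi>(1)]
  have K: "finite K"
    using U(1) by (simp add: K_def)
  then have "finite (gen ` {X \<in> K. \<phi> X = 1})"
    by simp
  moreover have "gen X \<in> filter_of \<phi>" if "X \<in> K" "\<phi> X = 1" for X
  proof -
    have "X \<noteq> {}"
      using that \<phi>(1) by (auto simp: K_def characters_def)
    then show ?thesis
      using gen[of X] that by (auto simp: K_def filter_of_def)
  qed
  then have "gen ` {X \<in> K. \<phi> X = 1} \<subseteq> filter_of \<phi>"
    by auto
  ultimately obtain p where p: "p \<in> filter_of \<phi>" "\<forall>a\<in>gen ` {X \<in> K. \<phi> X = 1}. p \<in> a <# P"
    by (rule filter_finite_lower_bound[OF F])
  define Q where "Q = gen ` {X \<in> K. \<phi> X = 0 \<and> X \<noteq> {}}"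
  show thesis
  proof (rule that[OF p(1)])
    show "finite Q"
      using K by (simp add: Q_def)
    show "Q \<subseteq> P - filter_of \<phi>"
    proof
      fix q assume "q \<in> Q"
      then obtain X where X: "X \<in> K" "\<phi> X = 0" "X \<noteq> {}" "q = gen X"
        by (auto simp: Q_def)
      then have "q \<in> P \<and> X = q <# P"
        using gen[of X] by (auto simp: K_def)
      then show "q \<in> P - filter_of \<phi>"
        using X(2) by (auto simp: filter_of_def)
    qed
  next
    fix \<psi> assume \<psi>: "\<psi> \<in> characters G P" "p \<in> filter_of \<psi>" "Q \<inter> filter_of \<psi> = {}"
    note F' = ideal_filterD[OF filter_of_character[OF \<psi>(1)]]
    have "\<psi> X \<in> U X" if X: "X \<in> ?J" for X
    proof (cases "X \<in> K")
      case False
      then show ?thesis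
        using X \<psi>(1) by (auto simp: K_def characters_def)
    next
      case True
      have "\<psi> X = \<phi> X"
      proof (cases "X = {}")
        case ne: False
        note g = gen[OF X ne]
        have "\<phi> X = 0 \<or> \<phi> X = 1" "\<psi> X = 0 \<or> \<psi> X = 1"
          using \<phi>(1) \<psi>(1) X by (auto simp: characters_def)
        moreover have "\<psi> X = 1" if "\<phi> X = 1"
        proof -
          have "gen X \<in> filter_of \<psi>"
            using F'(3)[OF \<psi>(2)] p(2) g that True by blast
          then show ?thesis
            using g by (auto simp: filter_of_def)
        qed
        moreover have "\<psi> X \<noteq> 1" if "\<phi> X = 0"
        proof
          assume "\<psi> X = 1"
          then have "gen X \<in> filter_of \<psi>"
            using g by (auto simp: filter_of_def)
          moreover have "gen X \<in> Q"
            using True that ne by (auto simp: Q_def)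
          ultimately show False
            using \<psi>(3) by blast
        qed
        ultimately show ?thesis
          by auto
      qed (use X \<phi>(1) \<psi>(1) in \<open>auto simp: characters_def\<close>)
      then show ?thesis
        using U(2) X by (auto simp: PiE_iff)
    qed
    then have "\<psi> \<in> Pi\<^sub>E ?J U"
      using \<psi>(1) by (auto simp: PiE_iff characters_def)
    then show "\<psi> \<in> V"
      using U(3) W(2) \<psi>(1) by blast
  qed
qed

text \<open>
  The upgrade from basic neighbourhoods to all open sets. Moving \<open>r\<close> below a prescribed \<open>p\<close> costs
  nothing, because filters are directed.
\<close>

lemma boundary_filter_open:
  assumes "\<phi> \<in> characters G P" "boundary_filter (filter_of \<phi>)"
    and "openin (character_topology G P) V" "\<phi> \<in> V" "p \<in> filter_of \<phi>"
  obtains r where "r \<in> P" "r \<in> p <# P" "\<And>\<psi>. \<psi> \<in> characters G P \<Longrightarrow> r \<in> filter_of \<psi> \<Longrightarrow> \<psi> \<in> V"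
proof -
  note F = ideal_filterD[OF filter_of_character[OF assms(1)]]
  obtain p' Q where V: "p' \<in> filter_of \<phi>" "finite Q" "Q \<subseteq> P - filter_of \<phi>"
    "\<And>\<psi>. \<psi> \<in> characters G P \<Longrightarrow> p' \<in> filter_of \<psi> \<Longrightarrow> Q \<inter> filter_of \<psi> = {} \<Longrightarrow> \<psi> \<in> V"
    using openin_contains_basic_neighbourhood[OF assms(3,4)] by metis
  obtain m where m: "m \<in> filter_of \<phi>" "m \<in> p <# P" "m \<in> p' <# P"
    using F(4)[OF assms(5) V(1)] by blast
  obtain r where r: "r \<in> P" "r \<in> m <# P" "\<forall>q\<in>Q. (r <# P) \<inter> (q <# P) = {}"
    using assms(2) m(1) V(2,3) unfolding boundary_filter_def by blast
  have P: "p \<in> P" "p' \<in> P" "m \<in> P"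
    using F(1) assms(5) V(1) m(1) by auto
  then have sub: "r \<in> p <# P" "r \<in> p' <# P"
    using ideal_mono[of p m] ideal_mono[of p' m] m r by auto
  show thesis
  proof (rule that[OF r(1) sub(1)])
    fix \<psi> assume \<psi>: "\<psi> \<in> characters G P" "r \<in> filter_of \<psi>"
    note F' = ideal_filterD[OF filter_of_character[OF \<psi>(1)]]
    have "Q \<inter> filter_of \<psi> = {}"
    proof (rule ccontr)
      assume "Q \<inter> filter_of \<psi> \<noteq> {}"
      then obtain q where "q \<in> Q" "q \<in> filter_of \<psi>"
        by blast
      then show False
        using F'(4)[OF \<psi>(2)] r(3) by blast
    qed
    then show "\<psi> \<in> V"
      using V(4) \<psi> F'(3)[OF \<psi>(2) P(2) sub(2)] by blast
  qed
qed

text \<open>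
  The maximal characters satisfy the condition because each \<open>q\<close> outside a maximal filter is
  incompatible with some element of it. The condition is inherited by limits, as it only concerns basic
  neighbourhoods. Conversely, under this condition each neighbourhood contains all characters that are
  \<open>1\<close> on some \<open>rP\<close>, and by Zorn's lemma one of these is maximal.
\<close>

lemma boundary_iff:
  "\<phi> \<in> boundary G P \<longleftrightarrow> \<phi> \<in> characters G P \<and> boundary_filter (filter_of \<phi>)"
proof (intro iffI conjI)
  assume \<phi>: "\<phi> \<in> boundary G P"
  then show char: "\<phi> \<in> characters G P"
    by (auto simp: boundary_def in_closure_of)
  show "boundary_filter (filter_of \<phi>)"
    unfolding boundary_filter_def
  proof (intro conjI ballI allI impI filter_of_character[OF char])
    fix p Q assume p: "p \<in> filter_of \<phi>" and Q: "finite Q" "Q \<subseteq> P - filter_of \<phi>"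
    let ?N = "{\<psi> \<in> characters G P. p \<in> filter_of \<psi> \<and> Q \<inter> filter_of \<psi> = {}}"
    have "openin (character_topology G P) ?N"
      using p Q by (intro openin_basic_neighbourhood) (auto simp: filter_of_def)
    moreover have "\<phi> \<in> ?N"
      using p Q char by auto
    moreover have "\<And>T. \<phi> \<in> T \<Longrightarrow> openin (character_topology G P) T \<Longrightarrow>
        \<exists>\<omega>. \<omega> \<in> maximal_characters G P \<and> \<omega> \<in> T"
      using \<phi> by (simp add: boundary_def in_closure_of)
    ultimately have "\<exists>\<omega>. \<omega> \<in> maximal_characters G P \<and> \<omega> \<in> ?N"
      by iprover
    then obtain \<omega> where \<omega>: "\<omega> \<in> maximal_characters G P" "p \<in> filter_of \<omega>" "Q \<inter> filter_of \<omega> = {}"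
      by blast
    from \<omega>(1) have "boundary_filter (filter_of \<omega>)"
      by (rule maximal_character_boundary)
    moreover have "Q \<subseteq> P - filter_of \<omega>"
      using \<omega>(3) Q(2) by blast
    ultimately show "\<exists>r\<in>P. r \<in> p <# P \<and> (\<forall>q\<in>Q. (r <# P) \<inter> (q <# P) = {})"
      using \<omega>(2) Q(1) unfolding boundary_filter_def by blast
  qed
next
  assume \<phi>: "\<phi> \<in> characters G P \<and> boundary_filter (filter_of \<phi>)"
  have "\<exists>\<omega>. \<omega> \<in> maximal_characters G P \<and> \<omega> \<in> V" if V: "\<phi> \<in> V" "openin (character_topology G P) V" for V
  proof -
    have "\<one> \<in> filter_of \<phi>"
      using \<phi> filter_of_character ideal_filterD(2) by blast
    then obtain r where r: "r \<in> P" "\<And>\<psi>. \<psi> \<in> characters G P \<Longrightarrow> r \<in> filter_of \<psi> \<Longrightarrow> \<psi> \<in> V"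
      using boundary_filter_open \<phi> V by metis
    then show ?thesis
      using exists_maximal_character[OF r(1)] by (metis maximal_characters_iff)
  qed
  then show "\<phi> \<in> boundary G P"
    using \<phi> by (auto simp: boundary_def in_closure_of)
qed

lemma boundary_nonempty: "boundary G P \<noteq> {}"
proof -
  obtain \<omega> where "\<omega> \<in> maximal_characters G P"
    using exists_maximal_character[OF submonoid(2)] by blast
  then have "\<omega> \<in> boundary G P"
    using maximal_characters_iff maximal_character_boundary boundary_iff by blast
  then show ?thesis
    by blast
qed

text \<open>
  The defining conditions of a character only involve finitely many of its values at a time. So
  they cut out a closed subset of a product of finite discrete spaces.
\<close>

lemma compact_characters: "compact_space (character_topology G P)"
proof -
  let ?J = "constructible_ideals G P"
  let ?T = "product_topology (\<lambda>_. discrete_topology {0, 1 :: nat}) ?J"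
  have comp: "compact_space ?T"
    by (simp add: compact_space_product_topology compact_space_discrete_topology)
  have eval: "closedin ?T {\<phi> \<in> topspace ?T. \<phi> X = a}" if "X \<in> ?J" "a \<in> {0, 1}" for X a
  proof -
    have "closedin ?T {\<phi> \<in> topspace ?T. \<phi> X \<in> {a}}"
      using that(2)
      by (intro closedin_continuous_map_preimage[OF continuous_map_product_projection[OF that(1)]])
        simp
    then show ?thesis
      by simp
  qed
  have closed: "closedin ?T {\<phi> \<in> topspace ?T. R (\<phi> X) (\<phi> Y) (\<phi> Z)}"
    if "X \<in> ?J" "Y \<in> ?J" "Z \<in> ?J" for X Y Z R
  proof -
    define D where "D = {(a, b, c) \<in> {0, 1} \<times> {0, 1} \<times> {0, 1 :: nat}. R a b c}"
    define C where "C = (\<lambda>(a, b, c). {\<phi> \<in> topspace ?T. \<phi> X = a} \<inter>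
      {\<phi> \<in> topspace ?T. \<phi> Y = b} \<inter> {\<phi> \<in> topspace ?T. \<phi> Z = c})"
    have "D \<subseteq> {0, 1} \<times> {0, 1} \<times> {0, 1}"
      by (auto simp: D_def)
    then have "finite D"
      by (rule finite_subset) simp
    moreover have "closedin ?T (C d)" if d: "d \<in> D" for d
    proof -
      obtain a b c where "d = (a, b, c)" "a \<in> {0, 1}" "b \<in> {0, 1}" "c \<in> {0, 1}"
        using d unfolding D_def by blast
      then show ?thesis
        unfolding C_def prod.case using \<open>X \<in> ?J\<close> \<open>Y \<in> ?J\<close> \<open>Z \<in> ?J\<close>
        by (simp only: prod.case) (intro closedin_Int eval)
    qed
    ultimately have "closedin ?T (\<Union>(C ` D))"
      by (intro closedin_Union) auto
    moreover have "\<Union>(C ` D) = {\<phi> \<in> topspace ?T. R (\<phi> X) (\<phi> Y) (\<phi> Z)}"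
    proof (intro equalityI subsetI)
      fix \<phi> assume "\<phi> \<in> \<Union>(C ` D)"
      then obtain d where "d \<in> D" "\<phi> \<in> C d"
        by blast
      moreover obtain a b c where "d = (a, b, c)"
        by (rule prod_cases3)
      ultimately have "(a, b, c) \<in> D" "\<phi> \<in> C (a, b, c)"
        by simp_all
      then show "\<phi> \<in> {\<phi> \<in> topspace ?T. R (\<phi> X) (\<phi> Y) (\<phi> Z)}"
        by (auto simp: C_def D_def simp del: topspace_product_topology)
    next
      fix \<phi> assume \<phi>: "\<phi> \<in> {\<phi> \<in> topspace ?T. R (\<phi> X) (\<phi> Y) (\<phi> Z)}"
      then have "\<phi> X \<in> {0, 1}" "\<phi> Y \<in> {0, 1}" "\<phi> Z \<in> {0, 1}"
        using \<open>X \<in> ?J\<close> \<open>Y \<in> ?J\<close> \<open>Z \<in> ?J\<close> by (simp_all add: PiE_iff)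
      then have "(\<phi> X, \<phi> Y, \<phi> Z) \<in> D"
        using \<phi> by (auto simp: D_def)
      moreover have "\<phi> \<in> C (\<phi> X, \<phi> Y, \<phi> Z)"
        using \<phi> by (simp add: C_def)
      ultimately show "\<phi> \<in> \<Union>(C ` D)"
        by blast
    qed
    ultimately show ?thesis
      by simp
  qed
  have "characters G P = {\<phi> \<in> topspace ?T. \<phi> P = 1} \<inter>
      (\<Inter>X\<in>?J. \<Inter>Y\<in>?J. {\<phi> \<in> topspace ?T. \<phi> (X \<inter> Y) = \<phi> X * \<phi> Y}) \<inter>
      (if {} \<in> ?J then {\<phi> \<in> topspace ?T. \<phi> {} = 0} else topspace ?T)" (is "_ = ?C")
  proof (intro equalityI subsetI)
    fix \<phi> assume \<phi>: "\<phi> \<in> characters G P"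
    then have "\<one> \<in> filter_of \<phi>"
      using filter_of_character ideal_filterD(2) by blast
    then show "\<phi> \<in> ?C"
      using \<phi> by (auto simp: characters_def filter_of_def)
  next
    fix \<phi> assume \<phi>: "\<phi> \<in> ?C"
    moreover from \<phi> have "\<exists>X\<in>?J. \<phi> X \<noteq> 0"
      by (intro bexI[of _ P]) auto
    ultimately show "\<phi> \<in> characters G P"
      by (auto simp: characters_def split: if_splits)
  qed
  moreover have "closedin ?T ?C"
  proof (intro closedin_Int)
    show "closedin ?T {\<phi> \<in> topspace ?T. \<phi> P = 1}"
      using closed[of P P P "\<lambda>x _ _. x = 1"] by simp
    show "closedin ?T (\<Inter>X\<in>?J. \<Inter>Y\<in>?J. {\<phi> \<in> topspace ?T. \<phi> (X \<inter> Y) = \<phi> X * \<phi> Y})"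
      using closed[where R = "\<lambda>x y z. x = y * z"] constructible_Int P_constructible
      by (intro closedin_INT) blast+
    show "closedin ?T (if {} \<in> ?J then {\<phi> \<in> topspace ?T. \<phi> {} = 0} else topspace ?T)"
      using closed[of "{}" "{}" "{}" "\<lambda>x _ _. x = 0"] closedin_topspace[of ?T] by simp
  qed
  ultimately have "closedin ?T (characters G P)"
    by simp
  then show ?thesis
    unfolding character_topology_def
    by (intro compact_space_subtopology closedin_compact_space comp)
qed

lemma compactin_boundary_piece:
  assumes "p \<in> P"
  shows "compactin (character_topology G P) {\<phi> \<in> boundary G P. p \<in> filter_of \<phi>}"
proof -
  let ?T = "character_topology G P"
  have "openin ?T {\<phi> \<in> characters G P. \<phi> (p <# P) \<in> - {1}}"
    using assms by (intro openin_evaluation) simp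
  then have "closedin ?T (topspace ?T - {\<phi> \<in> characters G P. \<phi> (p <# P) \<in> - {1}})"
    by blast
  then have "closedin ?T ((topspace ?T - {\<phi> \<in> characters G P. \<phi> (p <# P) \<in> - {1}}) \<inter> boundary G P)"
    by (intro closedin_Int) (simp_all add: boundary_def)
  moreover have "(topspace ?T - {\<phi> \<in> characters G P. \<phi> (p <# P) \<in> - {1}}) \<inter> boundary G P =
      {\<phi> \<in> boundary G P. p \<in> filter_of \<phi>}"
    using assms by (auto simp: boundary_iff filter_of_def)
  ultimately show ?thesis
    using closedin_compact_space[OF compact_characters] by simp
qed

section \<open>The partial action on the boundary\<close>

definition translate_filter :: "'a \<Rightarrow> 'a set \<Rightarrow> 'a set" where
  "translate_filter g F = {r \<in> P. \<exists>c\<in>F. g \<otimes> c \<in> r <# P}"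

lemma translate_filterI: "c \<in> F \<Longrightarrow> g \<otimes> c \<in> P \<Longrightarrow> g \<otimes> c \<in> translate_filter g F"
  unfolding translate_filter_def using self_in_ideal[OF P_carrier] by blast

lemma acts_via_iff:
  "acts_via G P g \<phi> s \<longleftrightarrow>
    g \<in> carrier G \<and> (\<exists>a\<in>filter_of \<phi>. g \<otimes> a \<in> P \<and> s = translation_map g a)"
proof
  assume *: "acts_via G P g \<phi> s"
  then have "s \<in> left_inverse_hull G P" "s \<noteq> Map.empty"
    by (auto simp: acts_via_def nonzero_hull_def)
  then obtain h a where "h \<in> carrier G" "a \<in> P" "h \<otimes> a \<in> P" "s = translation_map h a"
    by (rule hull_cases)
  then show "g \<in> carrier G \<and> (\<exists>a\<in>filter_of \<phi>. g \<otimes> a \<in> P \<and> s = translation_map g a)"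
    using * by (auto simp: acts_via_def group_part_translation_map filter_of_def)
next
  assume "g \<in> carrier G \<and> (\<exists>a\<in>filter_of \<phi>. g \<otimes> a \<in> P \<and> s = translation_map g a)"
  then show "acts_via G P g \<phi> s"
    using translation_map_in_hull translation_map_nonempty
    by (auto simp: acts_via_def group_part_translation_map filter_of_def nonzero_hull_def)
qed

lemma action_domain_iff:
  "\<phi> \<in> action_domain G P g \<longleftrightarrow>
    \<phi> \<in> characters G P \<and> g \<in> carrier G \<and> (\<exists>a\<in>filter_of \<phi>. g \<otimes> a \<in> P)"
  by (auto simp: action_domain_def acts_via_iff)

lemma preimage_constructible:
  assumes "g \<in> carrier G" "a \<in> P" "g \<otimes> a \<in> P" "X \<in> constructible_ideals G P"
  shows "{x \<in> a <# P. g \<otimes> x \<in> X} \<in> constructible_ideals G P"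
proof (cases "X = {}")
  case True
  then show ?thesis
    using assms(4) by simp
next
  case False
  then obtain r where r: "r \<in> P" "X = r <# P"
    using assms(4) constructible_cases by blast
  then have "translation_map \<one> r \<circ>\<^sub>m translation_map g a \<in> left_inverse_hull G P"
    using assms by (intro left_inverse_hull.comp translation_map_in_hull) auto
  moreover have "dom (translation_map \<one> r \<circ>\<^sub>m translation_map g a) = {x \<in> a <# P. g \<otimes> x \<in> X}"
    using r by (auto simp: map_comp_def translation_map_def split: if_splits)
  ultimately show ?thesis
    unfolding constructible_ideals_def by (metis imageI)
qed

lemma filter_lower_bound3:
  assumes "ideal_filter F" "a \<in> F" "b \<in> F" "c \<in> F"
  obtains d where "d \<in> F" "d \<in> a <# P" "d \<in> b <# P" "d \<in> c <# P"
  using filter_finite_lower_bound[OF assms(1), of "{a, b, c}"] assms(2-) by auto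

lemma translate_mono:
  assumes "g \<in> carrier G" "c \<in> carrier G" "r \<in> carrier G" "g \<otimes> c \<in> r <# P" "d \<in> c <# P"
  shows "g \<otimes> d \<in> r <# P"
  using translate_ideal[OF assms(1,2,5)] ideal_mono[OF assms(3,4)] by blast

lemma translate_mono_P:
  assumes "g \<in> carrier G" "c \<in> carrier G" "g \<otimes> c \<in> P" "d \<in> c <# P"
  shows "g \<otimes> d \<in> P"
  using translate_mono[of g c \<one> d] assms by simp

text \<open>
  By directedness, any member \<open>c\<close> of the filter with \<open>gc\<close> in the given ideal can be replaced by one in
  the domain of the chosen partial bijection. So the choice does not affect the result.
\<close>

lemma char_action_eq:
  assumes "\<phi> \<in> action_domain G P g"
  shows "char_action G P g \<phi> = character_of (translate_filter g (filter_of \<phi>))"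
proof -
  let ?F = "filter_of \<phi>"
  define s where "s = (SOME s. acts_via G P g \<phi> s)"
  have char: "\<phi> \<in> characters G P"
    using assms by (simp add: action_domain_def)
  note F = ideal_filterD[OF filter_of_character[OF char]]
  have "acts_via G P g \<phi> s"
    using assms unfolding s_def action_domain_def by (auto intro: someI[of "acts_via G P g \<phi>"])
  then obtain a where g: "g \<in> carrier G" and a: "a \<in> ?F" "g \<otimes> a \<in> P" "s = translation_map g a"
    by (auto simp: acts_via_iff)
  have aP: "a \<in> P"
    using a F(1) by blast
  have meets: "?F \<inter> {x \<in> a <# P. g \<otimes> x \<in> X} \<noteq> {} \<longleftrightarrow> translate_filter g ?F \<inter> X \<noteq> {}"
    if X: "X \<in> constructible_ideals G P" for X
  proof
    assume "?F \<inter> {x \<in> a <# P. g \<otimes> x \<in> X} \<noteq> {}"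
    then obtain c where c: "c \<in> ?F" "c \<in> a <# P" "g \<otimes> c \<in> X"
      by blast
    then have "g \<otimes> c \<in> P"
      using translate_mono_P[of g a c] g a aP by simp
    then have "g \<otimes> c \<in> translate_filter g ?F"
      using c(1) by (intro translate_filterI)
    then show "translate_filter g ?F \<inter> X \<noteq> {}"
      using c by blast
  next
    assume ne: "translate_filter g ?F \<inter> X \<noteq> {}"
    then obtain r c where r: "r \<in> P" "r \<in> X" "c \<in> ?F" "g \<otimes> c \<in> r <# P"
      unfolding translate_filter_def by blast
    obtain x where x: "x \<in> P" "X = x <# P"
      using X ne constructible_cases by (metis Int_empty_right)
    obtain d where d: "d \<in> ?F" "d \<in> a <# P" "d \<in> c <# P"
      using F(4) a(1) r(3) by blast
    have "g \<otimes> c \<in> x <# P"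
      using ideal_mono[of x r] x r by auto
    then have "g \<otimes> d \<in> X"
      using translate_mono[of g c x d] g F(1) r x d by simp
    then show "?F \<inter> {x \<in> a <# P. g \<otimes> x \<in> X} \<noteq> {}"
      using d by blast
  qed
  show ?thesis
  proof
    fix X
    show "char_action G P g \<phi> X = character_of (translate_filter g ?F) X"
    proof (cases "X \<in> constructible_ideals G P")
      case True
      have "{x \<in> dom s. the (s x) \<in> X} = {x \<in> a <# P. g \<otimes> x \<in> X}"
        unfolding a(3) by (auto simp: translation_map_def split: if_splits)
      then have "char_action G P g \<phi> X = \<phi> {x \<in> a <# P. g \<otimes> x \<in> X}"
        using True by (simp add: char_action_def Let_def s_def)
      then show ?thesis
        using True meets[OF True] character_value[OF char preimage_constructible[OF g aP a(2) True]]
        by (simp add: character_of_def)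
    qed (simp add: char_action_def character_of_def Let_def)
  qed
qed

lemma ideal_filter_translate:
  assumes "ideal_filter F" "g \<in> carrier G" "a \<in> F" "g \<otimes> a \<in> P"
  shows "ideal_filter (translate_filter g F)"
  unfolding ideal_filter_def
proof (intro conjI ballI impI)
  note F = ideal_filterD[OF assms(1)]
  show "translate_filter g F \<subseteq> P"
    by (auto simp: translate_filter_def)
  show "\<one> \<in> translate_filter g F"
    using assms by (auto simp: translate_filter_def)
next
  fix p q assume "p \<in> translate_filter g F" "q \<in> P" "p \<in> q <# P"
  then show "q \<in> translate_filter g F"
    using ideal_mono[of q p] by (auto simp: translate_filter_def)
next
  note F = ideal_filterD[OF assms(1)]
  fix p q assume "p \<in> translate_filter g F" "q \<in> translate_filter g F"
  then obtain c d where c: "p \<in> P" "c \<in> F" "g \<otimes> c \<in> p <# P" and d: "q \<in> P" "d \<in> F" "g \<otimes> d \<in> q <# P"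
    by (auto simp: translate_filter_def)
  obtain e where e: "e \<in> F" "e \<in> a <# P" "e \<in> c <# P" "e \<in> d <# P"
    using filter_lower_bound3[OF assms(1,3) c(2) d(2)] .
  have "g \<otimes> e \<in> P"
    using translate_mono_P[of g a e] assms F(1) e by simp
  then have "g \<otimes> e \<in> translate_filter g F"
    using e(1) by (intro translate_filterI)
  moreover have "g \<otimes> e \<in> p <# P" "g \<otimes> e \<in> q <# P"
    using translate_mono[of g c p e] translate_mono[of g d q e] assms(2) F(1) c d e by simp_all
  ultimately show "\<exists>r\<in>translate_filter g F. r \<in> p <# P \<and> r \<in> q <# P"
    by blast
qed

text \<open>
  Below \<open>c \<in> F\<close> with \<open>gc \<in> P\<close>, translation by \<open>g\<close> is an order isomorphism from the multiples of
  \<open>c\<close> to those of \<open>gc\<close>. The least common multiples of \<open>gc\<close> with the elements to be avoided pull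
  back to elements outside \<open>F\<close>, and a solution for these translates to the required one.
\<close>

lemma boundary_filter_translate:
  assumes "boundary_filter F" "g \<in> carrier G" "a \<in> F" "g \<otimes> a \<in> P"
  shows "boundary_filter (translate_filter g F)"
  unfolding boundary_filter_def
proof (intro conjI ballI allI impI)
  have filt: "ideal_filter F"
    using assms(1) by (simp add: boundary_filter_def)
  note F = ideal_filterD[OF filt]
  show "ideal_filter (translate_filter g F)"
    using ideal_filter_translate[OF filt assms(2-4)] .
  fix p Q assume "p \<in> translate_filter g F" and Q: "finite Q" "Q \<subseteq> P - translate_filter g F"
  then obtain b where b: "p \<in> P" "b \<in> F" "g \<otimes> b \<in> p <# P"
    by (auto simp: translate_filter_def)
  obtain c where c: "c \<in> F" "c \<in> a <# P" "c \<in> b <# P"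
    using F(4) assms(3) b(2) by blast
  have gc: "c \<in> P" "g \<otimes> c \<in> P" "g \<otimes> c \<in> p <# P"
    using translate_mono_P[of g a c] translate_mono[of g b p c] assms F(1) b c by simp_all
  define Q' where "Q' = {q \<in> Q. ((g \<otimes> c) <# P) \<inter> (q <# P) \<noteq> {}}"
  have "\<forall>q\<in>Q'. \<exists>n\<in>P. ((g \<otimes> c) <# P) \<inter> (q <# P) = (g \<otimes> n) <# P \<and> n \<notin> F"
  proof
    fix q assume q: "q \<in> Q'"
    then have qP: "q \<in> P" "q \<notin> translate_filter g F" "((g \<otimes> c) <# P) \<inter> (q <# P) \<noteq> {}"
      using Q(2) by (auto simp: Q'_def)
    then obtain m where m: "m \<in> P" "((g \<otimes> c) <# P) \<inter> (q <# P) = m <# P"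
      using right_lcm gc(2) by blast
    then have mm: "m \<in> (g \<otimes> c) <# P" "m \<in> q <# P"
      using self_in_ideal[OF P_carrier[OF m(1)]] by blast+
    define n where "n = inv g \<otimes> m"
    have n: "n \<in> carrier G" "g \<otimes> n = m"
      using m(1) assms(2) by (simp_all add: n_def)
    then have "n \<in> c <# P"
      using translate_in_ideal_iff[of g c n] mm(1) assms(2) gc(1) by simp
    then have "n \<in> P"
      using gc(1) ideal_subset_P by blast
    moreover have "n \<notin> F"
      using qP n(2) mm(2) by (auto simp: translate_filter_def)
    ultimately show "\<exists>n\<in>P. ((g \<otimes> c) <# P) \<inter> (q <# P) = (g \<otimes> n) <# P \<and> n \<notin> F"
      using m(2) n(2) by blast
  qed
  then obtain n where n: "\<And>q. q \<in> Q' \<Longrightarrow> n q \<in> P \<and> ((g \<otimes> c) <# P) \<inter> (q <# P) = (g \<otimes> n q) <# P \<and> n q \<notin> F"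
    by metis
  then have "finite (n ` Q')" "n ` Q' \<subseteq> P - F"
    using Q(1) by (auto simp: Q'_def)
  then obtain r where r: "r \<in> P" "r \<in> c <# P" "\<forall>q\<in>Q'. (r <# P) \<inter> (n q <# P) = {}"
    using assms(1) c(1) unfolding boundary_filter_def by (metis imageI)
  have gr: "g \<otimes> r \<in> P" "g \<otimes> r \<in> (g \<otimes> c) <# P" "g \<otimes> r \<in> p <# P"
    using translate_mono_P[of g c r] translate_ideal[of g c r] translate_mono[of g c p r] gc r assms(2) b(1)
    by simp_all
  have "((g \<otimes> r) <# P) \<inter> (q <# P) = {}" if q: "q \<in> Q" for q
  proof (rule ccontr)
    assume ne: "((g \<otimes> r) <# P) \<inter> (q <# P) \<noteq> {}"
    have sub: "(g \<otimes> r) <# P \<subseteq> (g \<otimes> c) <# P"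
      using ideal_mono gr(2) gc(2) by simp
    then have "q \<in> Q'"
      using ne q by (auto simp: Q'_def)
    then have "((g \<otimes> r) <# P) \<inter> ((g \<otimes> n q) <# P) \<noteq> {}" "n q \<in> P" "(r <# P) \<inter> (n q <# P) = {}"
      using n ne sub r(3) by blast+
    then show False
      using ideal_inter_translate[of g r "n q"] assms(2) r(1) by simp
  qed
  then show "\<exists>r\<in>P. r \<in> p <# P \<and> (\<forall>q\<in>Q. (r <# P) \<inter> (q <# P) = {})"
    using gr by blast
qed

section \<open>The boundary groupoid\<close>

abbreviation \<G> :: "('a \<times> 'a character, 'a character) top_groupoid" where
  "\<G> \<equiv> boundary_groupoid G P"

definition arrows :: "('a \<times> 'a character) set" where
  "arrows = topspace (arrow_topology \<G>)"

lemma in_arrows_iff: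
  "(g, \<phi>) \<in> arrows \<longleftrightarrow> g \<in> carrier G \<and> \<phi> \<in> boundary G P \<and> (\<exists>a\<in>filter_of \<phi>. g \<otimes> a \<in> P)"
  by (auto simp: arrows_def boundary_groupoid_def action_domain_iff boundary_iff)

lemma arrow_range:
  assumes "(g, \<phi>) \<in> arrows"
  shows "char_action G P g \<phi> \<in> boundary G P"
    "filter_of (char_action G P g \<phi>) = translate_filter g (filter_of \<phi>)"
proof -
  obtain a where *: "g \<in> carrier G" "\<phi> \<in> characters G P" "boundary_filter (filter_of \<phi>)"
    "a \<in> filter_of \<phi>" "g \<otimes> a \<in> P"
    using assms by (auto simp: in_arrows_iff boundary_iff)
  then have F: "boundary_filter (translate_filter g (filter_of \<phi>))"
    using boundary_filter_translate by blast
  then have filt: "ideal_filter (translate_filter g (filter_of \<phi>))"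
    by (simp add: boundary_filter_def)
  have "char_action G P g \<phi> = character_of (translate_filter g (filter_of \<phi>))"
    using * by (intro char_action_eq) (auto simp: action_domain_iff)
  then show "char_action G P g \<phi> \<in> boundary G P"
    "filter_of (char_action G P g \<phi>) = translate_filter g (filter_of \<phi>)"
    using F filt by (simp_all add: boundary_iff filter_of_character_of character_of_filter)
qed

lemma boundary_ideal_filter: "\<phi> \<in> boundary G P \<Longrightarrow> ideal_filter (filter_of \<phi>)"
  by (simp add: boundary_iff boundary_filter_def)

text \<open>
  The filter of \<open>\<phi>\<close> is directed, so the points that witness the two arrows have a common multiple in
  it.
\<close>

lemma arrows_common_point:
  assumes "(k, \<phi>) \<in> arrows" "(l, \<phi>) \<in> arrows"
  obtains c where "c \<in> filter_of \<phi>" "c \<in> P" "k \<otimes> c \<in> P" "l \<otimes> c \<in> P"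
proof -
  obtain a b where a: "a \<in> filter_of \<phi>" "k \<otimes> a \<in> P" and b: "b \<in> filter_of \<phi>" "l \<otimes> b \<in> P"
    using assms by (auto simp: in_arrows_iff)
  note F = ideal_filterD[OF boundary_ideal_filter]
  have \<phi>: "\<phi> \<in> boundary G P" "k \<in> carrier G" "l \<in> carrier G"
    using assms by (auto simp: in_arrows_iff)
  obtain c where c: "c \<in> filter_of \<phi>" "c \<in> a <# P" "c \<in> b <# P"
    using F(4)[OF \<phi>(1) a(1) b(1)] by blast
  show thesis
    using that[OF c(1)] translate_mono_P[of k a c] translate_mono_P[of l b c] F(1)[OF \<phi>(1)] a b c \<phi>
    by simp
qed

lemma quotient_arrow:
  assumes "(k, \<phi>) \<in> arrows" "(l, \<phi>) \<in> arrows"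
  shows "(k \<otimes> inv l, char_action G P l \<phi>) \<in> arrows"
proof -
  obtain c where c: "c \<in> filter_of \<phi>" "c \<in> P" "k \<otimes> c \<in> P" "l \<otimes> c \<in> P"
    using arrows_common_point[OF assms] .
  have kl: "k \<in> carrier G" "l \<in> carrier G"
    using assms by (auto simp: in_arrows_iff)
  have "k \<otimes> inv l \<otimes> (l \<otimes> c) = k \<otimes> c"
    using kl c by (simp add: m_assoc)
  moreover have "l \<otimes> c \<in> translate_filter l (filter_of \<phi>)"
    using c by (intro translate_filterI)
  ultimately show ?thesis
    using kl c arrow_range[OF assms(2)] by (auto simp: in_arrows_iff intro!: bexI[of _ "l \<otimes> c"])
qed

lemma product_arrow:
  assumes "(h, char_action G P l \<phi>) \<in> arrows" "(l, \<phi>) \<in> arrows"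
  shows "(h \<otimes> l, \<phi>) \<in> arrows"
proof -
  obtain d where "h \<in> carrier G" "d \<in> filter_of (char_action G P l \<phi>)" "h \<otimes> d \<in> P"
    using assms(1) by (auto simp: in_arrows_iff)
  then obtain c where d: "h \<in> carrier G" "d \<in> P" "h \<otimes> d \<in> P" "c \<in> filter_of \<phi>" "l \<otimes> c \<in> d <# P"
    using arrow_range(2)[OF assms(2)] by (auto simp: translate_filter_def)
  have l: "l \<in> carrier G" "\<phi> \<in> boundary G P"
    using assms(2) by (auto simp: in_arrows_iff)
  have "c \<in> P"
    using d l boundary_ideal_filter ideal_filterD(1) by blast
  then have "h \<otimes> l \<otimes> c = h \<otimes> (l \<otimes> c)"
    using d l by (simp add: m_assoc)
  then have "h \<otimes> l \<otimes> c \<in> P"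
    using translate_mono_P[of h d "l \<otimes> c"] d by simp
  then show ?thesis
    using d l by (auto simp: in_arrows_iff)
qed

lemma left_multiple_arrow:
  assumes "(k, \<phi>) \<in> arrows" "p \<in> P"
  shows "(p \<otimes> k, \<phi>) \<in> arrows" "p \<in> filter_of (char_action G P (p \<otimes> k) \<phi>)"
proof -
  obtain c where c: "k \<in> carrier G" "\<phi> \<in> boundary G P" "c \<in> filter_of \<phi>" "k \<otimes> c \<in> P"
    using assms by (auto simp: in_arrows_iff)
  then have "c \<in> P"
    using boundary_ideal_filter ideal_filterD(1) by blast
  then have *: "p \<otimes> k \<otimes> c = p \<otimes> (k \<otimes> c)"
    using c assms(2) by (simp add: m_assoc)
  then show arrow: "(p \<otimes> k, \<phi>) \<in> arrows"
    using c assms(2) by (auto simp: in_arrows_iff intro!: bexI[of _ c])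
  have "p \<otimes> k \<otimes> c \<in> p <# P"
    using * c(4) by (simp add: idealI)
  then show "p \<in> filter_of (char_action G P (p \<otimes> k) \<phi>)"
    using arrow_range(2)[OF arrow] c(3) assms(2) by (auto simp: translate_filter_def)
qed

text \<open>
  A factorization is determined by its second factor \<open>(l, \<phi>)\<close>, which may be any arrow with the same
  source. The range of that arrow is again in the boundary, so the first factor is an arrow too.
\<close>

lemma factorizations_boundary_groupoid:
  "factorizations \<G> (k, \<phi>) = (if (k, \<phi>) \<in> arrows
     then (\<lambda>l. ((k \<otimes> inv l, char_action G P l \<phi>), (l, \<phi>))) ` {l. (l, \<phi>) \<in> arrows} else {})"
proof -
  have "(k, \<phi>) \<in> arrows \<and> (l, \<phi>) \<in> arrows \<and> \<psi> = \<phi> \<and> \<eta> = char_action G P l \<phi> \<and> h = k \<otimes> inv l"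
    if "((h, \<eta>), (l, \<psi>)) \<in> factorizations \<G> (k, \<phi>)" for h \<eta> l \<psi>
  proof -
    have *: "(h, \<eta>) \<in> arrows" "(l, \<psi>) \<in> arrows" "\<eta> = char_action G P l \<psi>" "h \<otimes> l = k" "\<psi> = \<phi>"
      using that by (auto simp: factorizations_def arrows_def) (auto simp: boundary_groupoid_def)
    moreover have "h \<in> carrier G" "l \<in> carrier G"
      using * by (auto simp: in_arrows_iff)
    ultimately show ?thesis
      using product_arrow[of h l \<phi>] by (auto simp: m_assoc)
  qed
  moreover have "((k \<otimes> inv l, char_action G P l \<phi>), (l, \<phi>)) \<in> factorizations \<G> (k, \<phi>)"
    if "(k, \<phi>) \<in> arrows" "(l, \<phi>) \<in> arrows" for l
  proof -
    have "k \<in> carrier G" "l \<in> carrier G"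
      using that by (auto simp: in_arrows_iff)
    then have "k \<otimes> inv l \<otimes> l = k"
      by (simp add: m_assoc)
    then show ?thesis
      using quotient_arrow[OF that] that(2)
      by (simp add: factorizations_def flip: arrows_def) (simp add: boundary_groupoid_def)
  qed
  ultimately show ?thesis
    by (auto simp: image_iff)
qed

lemma convolution_boundary_groupoid:
  "convolution \<G> f \<xi> (k, \<phi>) = (if (k, \<phi>) \<in> arrows
     then \<Sum>\<^sub>\<infinity>l\<in>{l. (l, \<phi>) \<in> arrows}. f (k \<otimes> inv l, char_action G P l \<phi>) * \<xi> (l, \<phi>) else 0)"
proof (cases "(k, \<phi>) \<in> arrows")
  case True
  have "inj_on (\<lambda>l. ((k \<otimes> inv l, char_action G P l \<phi>), (l, \<phi>))) {l. (l, \<phi>) \<in> arrows}"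
    by (auto simp: inj_on_def)
  then show ?thesis
    using True by (simp add: convolution_def factorizations_boundary_groupoid infsum_reindex o_def)
qed (simp add: convolution_def factorizations_boundary_groupoid)

text \<open>
  Left convolution with this function is translation by \<open>g\<close>.
\<close>

definition slice_indicator :: "'a \<Rightarrow> 'a \<times> 'a character \<Rightarrow> complex" where
  "slice_indicator g = (\<lambda>\<gamma>. if \<gamma> \<in> arrows \<and> fst \<gamma> = g then 1 else 0)"

lemma convolution_slice_indicator:
  assumes "g \<in> carrier G"
  shows "convolution \<G> (slice_indicator g) \<xi> (k, \<phi>) =
    (if (k, \<phi>) \<in> arrows \<and> (inv g \<otimes> k, \<phi>) \<in> arrows then \<xi> (inv g \<otimes> k, \<phi>) else 0)"
proof (cases "(k, \<phi>) \<in> arrows")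
  case True
  then have k: "k \<in> carrier G"
    by (simp add: in_arrows_iff)
  let ?f = "\<lambda>l. slice_indicator g (k \<otimes> inv l, char_action G P l \<phi>) * \<xi> (l, \<phi>)"
  have "l = inv g \<otimes> k" if "(l, \<phi>) \<in> arrows" "k \<otimes> inv l = g" for l
  proof -
    have "l \<in> carrier G"
      using that(1) by (simp add: in_arrows_iff)
    then show ?thesis
      using that(2) k by (auto simp: inv_mult_group m_assoc)
  qed
  then have "infsum ?f {l. (l, \<phi>) \<in> arrows} =
      (if inv g \<otimes> k \<in> {l. (l, \<phi>) \<in> arrows} then ?f (inv g \<otimes> k) else 0)"
    by (intro infsum_single_term) (auto simp: slice_indicator_def)
  moreover have "k \<otimes> inv (inv g \<otimes> k) = g"
    using k assms by (simp add: inv_mult_group)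
  ultimately show ?thesis
    using True quotient_arrow[OF True, of "inv g \<otimes> k"]
    by (auto simp: convolution_boundary_groupoid slice_indicator_def)
qed (simp add: convolution_boundary_groupoid)

lemma arrow_topology_eq:
  "arrow_topology \<G> =
    subtopology (prod_topology (discrete_topology (carrier G)) (character_topology G P)) arrows"
proof -
  have "{(g, \<phi>). g \<in> carrier G \<and> \<phi> \<in> action_domain G P g \<inter> boundary G P} = arrows"
    by (auto simp: in_arrows_iff action_domain_iff boundary_iff)
  then show ?thesis
    by (simp add: boundary_groupoid_def)
qed

text \<open>
  The elements of \<open>P\<close> that \<open>g\<close> maps into \<open>P\<close> form a principal ideal \<open>mP\<close>. So \<open>g\<close> acts on the
  characters that are \<open>1\<close> on \<open>mP\<close>, a compact set; this gives the slice over \<open>g\<close> compact support.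
\<close>

lemma arrows_over:
  assumes "g \<in> carrier G" "(g <# P) \<inter> P \<noteq> {}"
  obtains m where "m \<in> P" "\<And>\<phi>. (g, \<phi>) \<in> arrows \<longleftrightarrow> \<phi> \<in> boundary G P \<and> m \<in> filter_of \<phi>"
proof -
  obtain p where p: "p \<in> P" "(g <# P) \<inter> P = p <# P"
    using principal_intersection[OF assms] .
  then have "p \<in> g <# P"
    using self_in_ideal[OF P_carrier[OF p(1)]] by blast
  then obtain m where m: "m \<in> P" "p = g \<otimes> m"
    by (rule idealE)
  have "m \<in> filter_of \<phi>" if "\<phi> \<in> boundary G P" "a \<in> filter_of \<phi>" "g \<otimes> a \<in> P" for \<phi> a
  proof -
    note F = ideal_filterD[OF boundary_ideal_filter[OF that(1)]]
    have "g \<otimes> a \<in> (g \<otimes> m) <# P"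
      using p(2) m(2) that(3) idealI[OF F(1)[OF that(2)], of g] by blast
    then have "a \<in> m <# P"
      using translate_in_ideal_iff[of g m a] assms(1) m(1) F(1)[OF that(2)] by simp
    then show ?thesis
      using F(3) that(2) m(1) by blast
  qed
  then show thesis
    using that[OF m(1)] p(1) m(2) assms(1) by (auto simp: in_arrows_iff)
qed

lemma slice_indicator_in_Cc:
  assumes "g \<in> carrier G"
  shows "slice_indicator g \<in> Cc \<G>"
proof -
  let ?T = "arrow_topology \<G>"
  let ?S = "{\<gamma> \<in> arrows. fst \<gamma> = g}"
  have "continuous_map ?T (discrete_topology (carrier G)) fst"
    unfolding arrow_topology_eq
    by (intro continuous_map_from_subtopology continuous_map_fst)
  then have "continuous_map ?T euclidean ((\<lambda>h. if h = g then 1 else 0 :: complex) \<circ> fst)"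
    by (rule continuous_map_compose) simp
  then have cont: "continuous_map ?T euclidean (slice_indicator g)"
    by (rule continuous_map_eq) (auto simp: slice_indicator_def arrows_def)
  have supp: "{\<gamma> \<in> topspace ?T. slice_indicator g \<gamma> \<noteq> 0} = ?S"
    by (auto simp: slice_indicator_def arrows_def)
  have "closedin ?T {\<gamma> \<in> topspace ?T. slice_indicator g \<gamma> \<in> {1}}"
    by (rule closedin_continuous_map_preimage[OF cont]) simp
  moreover have "{\<gamma> \<in> topspace ?T. slice_indicator g \<gamma> \<in> {1}} = ?S"
    by (auto simp: slice_indicator_def arrows_def)
  ultimately have "closedin ?T ?S"
    by simp
  then have closure: "?T closure_of ?S = ?S"
    by (rule closure_of_closedin)
  have "compactin ?T ?S"
  proof (cases "(g <# P) \<inter> P = {}")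
    case True
    have "?S = {}"
    proof (rule ccontr)
      assume "?S \<noteq> {}"
      then obtain \<phi> a where "\<phi> \<in> boundary G P" "a \<in> filter_of \<phi>" "g \<otimes> a \<in> P"
        by (auto simp: in_arrows_iff)
      moreover from this have "a \<in> P"
        using boundary_ideal_filter ideal_filterD(1) by blast
      ultimately show False
        using True idealI[of a g] by blast
    qed
    then show ?thesis
      by (metis compactin_empty)
  next
    case False
    then obtain m where m: "m \<in> P" "\<And>\<phi>. (g, \<phi>) \<in> arrows \<longleftrightarrow> \<phi> \<in> boundary G P \<and> m \<in> filter_of \<phi>"
      using arrows_over[OF assms] by blast
    have "(h, \<phi>) \<in> ?S \<longleftrightarrow> (h, \<phi>) \<in> {g} \<times> {\<phi> \<in> boundary G P. m \<in> filter_of \<phi>}" for h \<phi>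
      by (cases "h = g") (simp_all add: m(2))
    then have "?S = {g} \<times> {\<phi> \<in> boundary G P. m \<in> filter_of \<phi>}"
      unfolding set_eq_iff split_paired_All by blast
    moreover have "compactin (prod_topology (discrete_topology (carrier G)) (character_topology G P))
        ({g} \<times> {\<phi> \<in> boundary G P. m \<in> filter_of \<phi>})"
      using assms compactin_boundary_piece[OF m(1)]
      by (simp add: compactin_Times compactin_discrete_topology)
    ultimately have "compactin (prod_topology (discrete_topology (carrier G)) (character_topology G P)) ?S"
      by (simp only:)
    then show ?thesis
      unfolding arrow_topology_eq compactin_subtopology by blast
  qed
  then show ?thesis
    unfolding Cc_def mem_Collect_eq supp closure using cont
    by (simp add: slice_indicator_def arrows_def)
qed

text \<open>
  The group coordinate maps the compact support to a compact, hence finite, set of a discrete space.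
\<close>

lemma Cc_finite_support:
  assumes "f \<in> Cc \<G>"
  obtains K where "finite K" "K \<subseteq> carrier G" "\<And>g \<phi>. f (g, \<phi>) \<noteq> 0 \<Longrightarrow> g \<in> K"
proof -
  let ?T = "arrow_topology \<G>"
  let ?C = "?T closure_of {\<gamma> \<in> topspace ?T. f \<gamma> \<noteq> 0}"
  have "continuous_map ?T (discrete_topology (carrier G)) fst"
    unfolding arrow_topology_eq
    by (intro continuous_map_from_subtopology continuous_map_fst)
  then have "compactin (discrete_topology (carrier G)) (fst ` ?C)"
    using assms by (intro image_compactin) (auto simp: Cc_def)
  then have "finite (fst ` ?C)" "fst ` ?C \<subseteq> carrier G"
    by (simp_all add: compactin_discrete_topology)
  moreover have "g \<in> fst ` ?C" if "f (g, \<phi>) \<noteq> 0" for g \<phi>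
  proof -
    have "(g, \<phi>) \<in> {\<gamma> \<in> topspace ?T. f \<gamma> \<noteq> 0}"
      using assms that by (auto simp: Cc_def)
    then have "(g, \<phi>) \<in> ?C"
      by (rule subsetD[OF closure_of_subset, rotated]) simp
    then show ?thesis
      by (rule image_eqI[rotated]) simp
  qed
  ultimately show thesis
    using that by blast
qed

text \<open>
  By continuity, \<open>f\<close> is almost constant over \<open>g\<close> near the character \<open>\<phi>\<close>, and each neighbourhood of a
  boundary character contains all characters that are \<open>1\<close> on some \<open>rP\<close>.
\<close>

lemma Cc_almost_constant:
  assumes "f \<in> Cc \<G>" "(g, \<phi>) \<in> arrows" "p \<in> filter_of \<phi>" "\<epsilon> > 0"
  obtains r where "r \<in> P" "r \<in> p <# P"
    "\<And>\<psi>. (g, \<psi>) \<in> arrows \<Longrightarrow> r \<in> filter_of \<psi> \<Longrightarrow> cmod (f (g, \<psi>) - f (g, \<phi>)) < \<epsilon>"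
proof -
  let ?T = "arrow_topology \<G>"
  define B where "B = {\<gamma> \<in> topspace ?T. f \<gamma> \<in> ball (f (g, \<phi>)) \<epsilon>}"
  have "openin ?T B"
    unfolding B_def using assms(1)
    by (intro openin_continuous_map_preimage[where Y = euclidean]) (auto simp: Cc_def)
  then obtain W where W: "openin (prod_topology (discrete_topology (carrier G)) (character_topology G P)) W"
    "B = W \<inter> arrows"
    unfolding arrow_topology_eq openin_subtopology by blast
  have "(g, \<phi>) \<in> B"
    using assms(2,4) by (simp add: B_def arrows_def)
  then have "(g, \<phi>) \<in> W"
    unfolding W(2) by blast
  then have "\<exists>U V. openin (discrete_topology (carrier G)) U \<and> openin (character_topology G P) V \<and>
      g \<in> U \<and> \<phi> \<in> V \<and> U \<times> V \<subseteq> W"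
    using W(1)[unfolded openin_prod_topology_alt] by iprover
  then obtain U V where V: "openin (character_topology G P) V" "g \<in> U" "\<phi> \<in> V" "U \<times> V \<subseteq> W"
    by blast
  have \<phi>: "\<phi> \<in> characters G P" "boundary_filter (filter_of \<phi>)"
    using assms(2) by (auto simp: in_arrows_iff boundary_iff)
  obtain r where r: "r \<in> P" "r \<in> p <# P"
    "\<And>\<psi>. \<psi> \<in> characters G P \<Longrightarrow> r \<in> filter_of \<psi> \<Longrightarrow> \<psi> \<in> V"
    using boundary_filter_open[OF \<phi> V(1,3) assms(3)] by metis
  show thesis
  proof (rule that[OF r(1,2)])
    fix \<psi> assume "(g, \<psi>) \<in> arrows" "r \<in> filter_of \<psi>"
    moreover from this have "\<psi> \<in> V"
      using r(3) by (simp add: in_arrows_iff boundary_iff)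
    ultimately have "(g, \<psi>) \<in> B"
      unfolding W(2) using V(2,4) by blast
    then show "cmod (f (g, \<psi>) - f (g, \<phi>)) < \<epsilon>"
      by (simp add: B_def dist_commute flip: dist_norm)
  qed
qed

section \<open>Simplicity of the boundary quotient\<close>

lemma slice_operator_exists:
  assumes "g \<in> carrier G"
  shows "\<exists>T :: ('a \<times> 'a character) ell2 \<Rightarrow>\<^sub>L ('a \<times> 'a character) ell2. norm T \<le> 1 \<and>
    (\<forall>\<xi>. ell2_fun (blinfun_apply T \<xi>) = convolution \<G> (slice_indicator g) (ell2_fun \<xi>))"
proof -
  let ?D = "{\<gamma>. \<gamma> \<in> arrows \<and> (inv g \<otimes> fst \<gamma>, snd \<gamma>) \<in> arrows}"
  let ?\<tau> = "\<lambda>\<gamma>. (inv g \<otimes> fst \<gamma>, snd \<gamma>)"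
  have "inj_on ?\<tau> ?D"
    using assms by (auto simp: inj_on_def in_arrows_iff)
  from pullback_operator_exists[OF this]
  obtain T :: "('a \<times> 'a character) ell2 \<Rightarrow>\<^sub>L ('a \<times> 'a character) ell2" where T: "norm T \<le> 1"
    "\<And>\<xi> \<gamma>. ell2_fun (blinfun_apply T \<xi>) \<gamma> = (if \<gamma> \<in> ?D then ell2_fun \<xi> (?\<tau> \<gamma>) else 0)"
    by blast
  have "ell2_fun (blinfun_apply T \<xi>) = convolution \<G> (slice_indicator g) (ell2_fun \<xi>)" for \<xi>
    by (rule ext) (auto simp: T(2) convolution_slice_indicator[OF assms])
  then show ?thesis
    using T(1) by blast
qed

definition slice_operator ::
  "'a \<Rightarrow> ('a \<times> 'a character) ell2 \<Rightarrow>\<^sub>L ('a \<times> 'a character) ell2" where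
  "slice_operator g = (SOME T. norm T \<le> 1 \<and>
    (\<forall>\<xi>. ell2_fun (blinfun_apply T \<xi>) = convolution \<G> (slice_indicator g) (ell2_fun \<xi>)))"

lemma slice_operator:
  assumes "g \<in> carrier G"
  shows "norm (slice_operator g) \<le> 1"
    "ell2_fun (blinfun_apply (slice_operator g) \<xi>) = convolution \<G> (slice_indicator g) (ell2_fun \<xi>)"
  using someI_ex[OF slice_operator_exists[OF assms]] unfolding slice_operator_def by auto

lemma slice_operator_apply:
  assumes "g \<in> carrier G"
  shows "ell2_fun (blinfun_apply (slice_operator g) \<xi>) (k, \<phi>) =
    (if (k, \<phi>) \<in> arrows \<and> (inv g \<otimes> k, \<phi>) \<in> arrows then ell2_fun \<xi> (inv g \<otimes> k, \<phi>) else 0)"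
  by (simp add: slice_operator(2) convolution_slice_indicator assms)

lemma unit_operator_apply:
  "ell2_fun (blinfun_apply (slice_operator \<one>) \<xi>) \<gamma> = (if \<gamma> \<in> arrows then ell2_fun \<xi> \<gamma> else 0)"
  by (cases \<gamma>) (auto simp: slice_operator_apply in_arrows_iff)

lemma boundary_quotient_closure:
  "boundary_quotient G P = closure {T. \<exists>f\<in>Cc \<G>. \<forall>\<xi>.
     ell2_fun (blinfun_apply T \<xi>) = convolution \<G> f (ell2_fun \<xi>)}"
  by (simp add: boundary_quotient_def reduced_algebra_def)

lemma slice_operator_in_boundary_quotient:
  "g \<in> carrier G \<Longrightarrow> slice_operator g \<in> boundary_quotient G P"
  unfolding boundary_quotient_closure
  using slice_operator(2) slice_indicator_in_Cc by (intro subsetD[OF closure_subset]) blast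

lemma unit_of_boundary_quotient:
  assumes "S \<in> boundary_quotient G P"
  shows "S o\<^sub>L slice_operator \<one> = S" "slice_operator \<one> o\<^sub>L S = S"
proof -
  let ?E = "slice_operator \<one>"
  let ?A = "{T. \<exists>f\<in>Cc \<G>. \<forall>\<xi>. ell2_fun (blinfun_apply T \<xi>) = convolution \<G> f (ell2_fun \<xi>)}"
  have "T o\<^sub>L ?E = T \<and> ?E o\<^sub>L T = T" if T: "T \<in> ?A" for T
  proof -
    obtain f where f: "\<And>\<xi>. ell2_fun (blinfun_apply T \<xi>) = convolution \<G> f (ell2_fun \<xi>)"
      using T by blast
    have "convolution \<G> f (ell2_fun (blinfun_apply ?E \<xi>)) \<gamma> = convolution \<G> f (ell2_fun \<xi>) \<gamma>" for \<xi> \<gamma>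
      by (cases \<gamma>) (auto simp: convolution_boundary_groupoid unit_operator_apply intro!: infsum_cong)
    then have right: "T o\<^sub>L ?E = T"
      by (intro blinfun_eqI ell2_eqI) (simp add: f)
    have "convolution \<G> f \<xi> \<gamma> = 0" if "\<gamma> \<notin> arrows" for \<xi> \<gamma>
      using that by (cases \<gamma>) (auto simp: convolution_boundary_groupoid)
    then have "?E o\<^sub>L T = T"
      by (intro blinfun_eqI ell2_eqI) (simp add: f unit_operator_apply)
    then show ?thesis
      using right by simp
  qed
  then have "?A \<subseteq> {T. T o\<^sub>L ?E = T} \<inter> {T. ?E o\<^sub>L T = T}"
    by blast
  moreover have "closed ({T. T o\<^sub>L ?E = T} \<inter> {T. ?E o\<^sub>L T = T})"
    by (intro closed_Int closed_Collect_eq bounded_bilinear.continuous_on[OF bounded_bilinear_blinfun_compose]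
        continuous_on_id continuous_on_const)
  ultimately have "closure ?A \<subseteq> {T. T o\<^sub>L ?E = T} \<inter> {T. ?E o\<^sub>L T = T}"
    by (rule closure_minimal)
  then show "S o\<^sub>L ?E = S" "?E o\<^sub>L S = S"
    using assms unfolding boundary_quotient_closure by blast+
qed

text \<open>
  The choices of \<open>r\<close> and \<open>t\<close> below are the two refinements that isolate the arrow \<open>(g, \<phi>)\<close>. First \<open>r\<close>
  makes \<open>f\<close> almost constant over \<open>g\<close>. Then \<open>t\<close> removes the other \<open>k\<close> in the support: the compression
  by \<open>p = rt\<close> and \<open>q = grt\<close> moves the part of \<open>f\<close> over \<open>k\<close> to \<open>q\<inverse>kp\<close>, and no arrow lies over this
  element once \<open>tP\<close> is disjoint from its translate by \<open>(gr)\<inverse>kr\<close>. What remains is multiplication by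
  values of \<open>f\<close> over \<open>g\<close> at characters that are \<open>1\<close> on \<open>rP\<close>.
\<close>

lemma compression_near_scalar:
  assumes G0: "G0 G P = {\<one>}"
    and f: "f \<in> Cc \<G>" "\<And>\<xi>. ell2_fun (blinfun_apply T \<xi>) = convolution \<G> f (ell2_fun \<xi>)"
    and arrow: "(g, \<phi>) \<in> arrows" and "\<epsilon> > 0"
  obtains p q where "p \<in> P" "q \<in> P"
    "norm ((slice_operator (inv q) o\<^sub>L T o\<^sub>L slice_operator p) -
      (scaleC_op (f (g, \<phi>)) o\<^sub>L slice_operator \<one>)) \<le> \<epsilon>"
proof -
  obtain a where g: "g \<in> carrier G" "a \<in> filter_of \<phi>" "g \<otimes> a \<in> P"
    using arrow by (auto simp: in_arrows_iff)
  have a: "a \<in> P"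
    using g(2) by (simp add: filter_of_def)
  obtain K where K: "finite K" "K \<subseteq> carrier G" "\<And>h \<psi>. f (h, \<psi>) \<noteq> 0 \<Longrightarrow> h \<in> K"
    using Cc_finite_support[OF f(1)] by metis
  obtain r where r: "r \<in> P" "r \<in> a <# P"
    "\<And>\<psi>. (g, \<psi>) \<in> arrows \<Longrightarrow> r \<in> filter_of \<psi> \<Longrightarrow> cmod (f (g, \<psi>) - f (g, \<phi>)) < \<epsilon>"
    using Cc_almost_constant[OF f(1) arrow g(2) \<open>\<epsilon> > 0\<close>] by metis
  have gr: "g \<otimes> r \<in> P"
    using translate_mono_P[of g a r] g a r by simp
  let ?c = "\<lambda>k. inv (g \<otimes> r) \<otimes> (k \<otimes> r)"
  have "?c k \<noteq> \<one>" if "k \<in> K - {g}" for k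
  proof
    assume *: "?c k = \<one>"
    have k: "k \<in> carrier G" "k \<noteq> g"
      using that K(2) by auto
    have "k \<otimes> r = g \<otimes> r \<otimes> ?c k"
      using k gr r(1) by simp
    then show False
      using * k g(1) r(1) gr by simp
  qed
  moreover have "?c k \<in> carrier G" if "k \<in> K - {g}" for k
    using that K(2) g(1) r(1) by auto
  ultimately have "?c ` (K - {g}) \<subseteq> carrier G - {\<one>}"
    by (intro image_subsetI DiffI) (simp_all only: singleton_iff not_False_eq_True)
  then obtain t where t: "t \<in> P" "\<forall>h\<in>?c ` (K - {g}). (t <# P) \<inter> ((h \<otimes> t) <# P) = {}"
    using trivial_G0_separates_finite[OF G0, of "?c ` (K - {g})"] K(1) by auto
  define p where "p = r \<otimes> t"
  define q where "q = g \<otimes> p"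
  have pq: "p \<in> P" "q \<in> P" "p \<in> r <# P" "q = g \<otimes> r \<otimes> t"
    using r(1) t(1) gr g(1) by (simp_all add: p_def q_def idealI flip: m_assoc)
  let ?C = "slice_operator (inv q) o\<^sub>L T o\<^sub>L slice_operator p"
  have coeff: "ell2_fun (blinfun_apply ?C \<xi>) (n, \<psi>) =
      f (g, char_action G P (p \<otimes> n) \<psi>) * ell2_fun \<xi> (n, \<psi>)" if n: "(n, \<psi>) \<in> arrows" for \<xi> n \<psi>
  proof -
    let ?\<eta> = "ell2_fun (blinfun_apply (slice_operator p) \<xi>)"
    let ?F = "\<lambda>l. f (q \<otimes> n \<otimes> inv l, char_action G P l \<psi>) * ?\<eta> (l, \<psi>)"
    have nG: "n \<in> carrier G"
      using n by (simp add: in_arrows_iff)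
    have qn: "(q \<otimes> n, \<psi>) \<in> arrows" and pn: "(p \<otimes> n, \<psi>) \<in> arrows"
      using left_multiple_arrow(1)[OF n] pq by simp_all
    have zero: "?F l = 0" if l: "(l, \<psi>) \<in> arrows" "l \<noteq> p \<otimes> n" for l
    proof (rule ccontr)
      assume "?F l \<noteq> 0"
      then have nz: "f (q \<otimes> n \<otimes> inv l, char_action G P l \<psi>) \<noteq> 0" "?\<eta> (l, \<psi>) \<noteq> 0"
        by simp_all
      let ?k = "q \<otimes> n \<otimes> inv l"
      have lG: "l \<in> carrier G"
        using l by (simp add: in_arrows_iff)
      have kK: "?k \<in> K"
        using K(3) nz(1) by blast
      have m: "(inv p \<otimes> l, \<psi>) \<in> arrows"
        using nz(2) pq by (simp add: slice_operator_apply split: if_splits)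
      obtain c where c: "c \<in> P" "n \<otimes> c \<in> P" "inv p \<otimes> l \<otimes> c \<in> P"
        using arrows_common_point[OF n m] by blast
      have kl: "?k \<otimes> l = q \<otimes> n"
        using nG lG pq by (simp add: m_assoc)
      show False
      proof (cases "?k = g")
        case True
        then have "g \<otimes> l = g \<otimes> (p \<otimes> n)"
          using kl nG g(1) pq(1) by (simp add: q_def m_assoc)
        then show False
          using l(2) g(1) lG nG pq(1) by simp
      next
        case False
        \<comment> \<open>The common point \<open>c\<close> of the two arrows would give a common point of \<open>tP\<close> and its translate.\<close>
        have kG: "?k \<in> carrier G"
          using kK K(2) by blast
        have "g \<otimes> r \<otimes> (t \<otimes> (n \<otimes> c)) = q \<otimes> n \<otimes> c"
          using pq t(1) gr nG c(1) by (simp add: m_assoc)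
        also have "\<dots> = ?k \<otimes> (l \<otimes> c)"
          using kl kG lG c(1) by (simp flip: m_assoc)
        also have "l \<otimes> c = p \<otimes> (inv p \<otimes> l \<otimes> c)"
          using pq lG c(1) by (simp add: m_assoc)
        also have "?k \<otimes> (p \<otimes> (inv p \<otimes> l \<otimes> c)) = ?k \<otimes> r \<otimes> t \<otimes> (inv p \<otimes> l \<otimes> c)"
          using kG r(1) t(1) c(3) by (simp add: p_def m_assoc)
        finally have "t \<otimes> (n \<otimes> c) = inv (g \<otimes> r) \<otimes> (?k \<otimes> r \<otimes> t \<otimes> (inv p \<otimes> l \<otimes> c))"
          using gr t(1) c(2) by (metis P_carrier inv_mult_cancel(1) m_closed)
        also have "\<dots> = ?c ?k \<otimes> t \<otimes> (inv p \<otimes> l \<otimes> c)"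
          using gr t(1) c(3) kG r(1) by (simp add: m_assoc)
        finally have "t \<otimes> (n \<otimes> c) \<in> (?c ?k \<otimes> t) <# P"
          using c(3) by (simp add: idealI)
        moreover have "t \<otimes> (n \<otimes> c) \<in> t <# P"
          using c(2) by (rule idealI)
        ultimately show False
          using t(2) kK False by blast
      qed
    qed
    have "ell2_fun (blinfun_apply ?C \<xi>) (n, \<psi>) = convolution \<G> f ?\<eta> (q \<otimes> n, \<psi>)"
      using n qn pq by (simp add: slice_operator_apply f(2))
    also have "\<dots> = infsum ?F {l. (l, \<psi>) \<in> arrows}"
      using qn by (simp add: convolution_boundary_groupoid)
    also have "\<dots> = ?F (p \<otimes> n)"
      using pn zero by (subst infsum_single_term[of _ "p \<otimes> n"]) auto
    also have "?\<eta> (p \<otimes> n, \<psi>) = ell2_fun \<xi> (n, \<psi>)"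
      using pn n nG pq by (simp add: slice_operator_apply)
    also have "q \<otimes> n \<otimes> inv (p \<otimes> n) = g"
      using nG g(1) pq(1) by (simp add: q_def m_assoc inv_mult_group)
    finally show ?thesis .
  qed
  have bound: "cmod (f (g, char_action G P (p \<otimes> n) \<psi>) - f (g, \<phi>)) \<le> \<epsilon>" if n: "(n, \<psi>) \<in> arrows" for n \<psi>
  proof -
    let ?\<psi> = "char_action G P (p \<otimes> n) \<psi>"
    have nG: "n \<in> carrier G"
      using n by (simp add: in_arrows_iff)
    have "(q \<otimes> n, \<psi>) \<in> arrows" "(p \<otimes> n, \<psi>) \<in> arrows"
      using left_multiple_arrow(1)[OF n] pq by simp_all
    then have "(q \<otimes> n \<otimes> inv (p \<otimes> n), ?\<psi>) \<in> arrows"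
      by (rule quotient_arrow)
    moreover have "q \<otimes> n \<otimes> inv (p \<otimes> n) = g"
      using nG g(1) pq(1) by (simp add: q_def m_assoc inv_mult_group)
    ultimately have arr: "(g, ?\<psi>) \<in> arrows"
      by simp
    then have "ideal_filter (filter_of ?\<psi>)"
      by (simp add: in_arrows_iff boundary_ideal_filter)
    then have "r \<in> filter_of ?\<psi>"
      using left_multiple_arrow(2)[OF n pq(1)] pq(3) r(1) ideal_filterD(3) by blast
    then show ?thesis
      using r(3)[OF arr] by simp
  qed
  have "norm (blinfun_apply (?C - (scaleC_op (f (g, \<phi>)) o\<^sub>L slice_operator \<one>)) \<xi>) \<le> \<epsilon> * norm \<xi>" for \<xi>
  proof (rule ell2_norm_le_pointwise)
    fix \<gamma> :: "'a \<times> 'a character"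
    obtain n \<psi> where \<gamma>: "\<gamma> = (n, \<psi>)"
      by (cases \<gamma>)
    show "cmod (ell2_fun (blinfun_apply (?C - (scaleC_op (f (g, \<phi>)) o\<^sub>L slice_operator \<one>)) \<xi>) \<gamma>)
        \<le> \<epsilon> * cmod (ell2_fun \<xi> \<gamma>)"
    proof (cases "\<gamma> \<in> arrows")
      case True
      have "ell2_fun (blinfun_apply (?C - (scaleC_op (f (g, \<phi>)) o\<^sub>L slice_operator \<one>)) \<xi>) \<gamma> =
          (f (g, char_action G P (p \<otimes> n) \<psi>) - f (g, \<phi>)) * ell2_fun \<xi> \<gamma>"
        using coeff[of n \<psi> \<xi>] True \<gamma>
        by (simp add: blinfun.diff_left minus_ell2.rep_eq scaleC_op.rep_eq scaleC_ell2.rep_eq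
            unit_operator_apply left_diff_distrib)
      then show ?thesis
        using bound[of n \<psi>] True \<gamma> by (simp add: norm_mult mult_right_mono)
    next
      case False
      have "ell2_fun (blinfun_apply ?C \<xi>) \<gamma> = 0"
        using False \<gamma> pq by (simp add: slice_operator_apply)
      then show ?thesis
        using False \<open>\<epsilon> > 0\<close>
        by (simp add: blinfun.diff_left minus_ell2.rep_eq scaleC_op.rep_eq scaleC_ell2.rep_eq
            unit_operator_apply)
    qed
  qed (use \<open>\<epsilon> > 0\<close> in simp)
  then have "norm (?C - (scaleC_op (f (g, \<phi>)) o\<^sub>L slice_operator \<one>)) \<le> \<epsilon>"
    using \<open>\<epsilon> > 0\<close> by (intro norm_blinfun_bound) auto
  then show thesis
    using that pq(1,2) by blast
qed

lemma boundary_quotient_nonzero: "boundary_quotient G P \<noteq> {0}"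
proof
  assume zero: "boundary_quotient G P = {0}"
  obtain \<phi> where \<phi>: "\<phi> \<in> boundary G P"
    using boundary_nonempty by blast
  then have "(\<one>, \<phi>) \<in> arrows"
    using ideal_filterD(2)[OF boundary_ideal_filter[OF \<phi>]] by (auto simp: in_arrows_iff intro!: bexI[of _ \<one>])
  then have "ell2_fun (blinfun_apply (slice_operator \<one>) (ell2_single (\<one>, \<phi>) 1)) (\<one>, \<phi>) = 1"
    by (simp add: unit_operator_apply ell2_single.rep_eq)
  moreover have "slice_operator \<one> = 0"
    using zero slice_operator_in_boundary_quotient[of \<one>] by simp
  ultimately show False
    by (simp add: zero_ell2.rep_eq)
qed

text \<open>
  A nonzero coefficient \<open>w\<close> of \<open>T\<close> at the vector \<open>c \<delta>\<^sub>\<beta>\<close> fixes the scale \<open>\<epsilon>\<close>. For every approximation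
  of \<open>T\<close> within \<open>\<epsilon>\<close> the corresponding value \<open>z\<close> of the convolving function has absolute value at
  least \<open>3\<epsilon>\<close>, while the compression of \<open>T\<close> differs from \<open>z\<close> times the unit by less than \<open>2\<epsilon>\<close>. So after division by \<open>z\<close> the
  distance to the unit is less than \<open>1\<close>.
\<close>

theorem simple_boundary_quotient:
  assumes G0: "G0 G P = {\<one>}"
  shows "simple_algebra (boundary_quotient G P)"
  unfolding simple_algebra_def
proof (intro conjI allI impI boundary_quotient_nonzero)
  fix I assume ideal: "closed_ideal (boundary_quotient G P) I"
  let ?A = "boundary_quotient G P"
  let ?E = "slice_operator \<one>"
  have I: "I \<subseteq> ?A" "0 \<in> I" "\<And>c T. T \<in> I \<Longrightarrow> scaleC_op c o\<^sub>L T \<in> I"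
    "\<And>S T. S \<in> ?A \<Longrightarrow> T \<in> I \<Longrightarrow> S o\<^sub>L T \<in> I" "\<And>S T. S \<in> ?A \<Longrightarrow> T \<in> I \<Longrightarrow> T o\<^sub>L S \<in> I"
    using ideal by (auto simp: closed_ideal_def)
  show "I = {0} \<or> I = ?A"
  proof (cases "I = {0}")
    case False
    then obtain T where T: "T \<in> I" "T \<noteq> 0"
      using I(2) by blast
    obtain \<beta> c where "blinfun_apply T (ell2_single \<beta> c) \<noteq> 0"
      using blinfun_eq_zero_on_singles[of T] T(2) by auto
    then obtain \<gamma> where w: "ell2_fun (blinfun_apply T (ell2_single \<beta> c)) \<gamma> \<noteq> 0"
      using ell2_eqI[of "blinfun_apply T (ell2_single \<beta> c)" 0] by (auto simp: zero_ell2.rep_eq)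
    define w where "w = ell2_fun (blinfun_apply T (ell2_single \<beta> c)) \<gamma>"
    have c: "c \<noteq> 0"
    proof
      assume "c = 0"
      then have "ell2_single \<beta> c = 0"
        by (intro ell2_eqI) (simp add: ell2_single.rep_eq zero_ell2.rep_eq)
      then show False
        using w by (simp add: zero_ell2.rep_eq)
    qed
    define \<epsilon> where "\<epsilon> = cmod w / (4 * cmod c)"
    have \<epsilon>: "\<epsilon> > 0" "cmod w = 4 * \<epsilon> * cmod c"
      using w c by (simp_all add: \<epsilon>_def w_def)
    have "T \<in> ?A"
      using T I by blast
    then obtain T\<^sub>0 f where f: "f \<in> Cc \<G>"
        "\<And>\<xi>. ell2_fun (blinfun_apply T\<^sub>0 \<xi>) = convolution \<G> f (ell2_fun \<xi>)"
      and near: "dist T\<^sub>0 T < \<epsilon>"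
      using \<epsilon>(1) unfolding boundary_quotient_closure closure_approachable by blast
    obtain k \<phi> l \<psi> where kl: "\<gamma> = (k, \<phi>)" "\<beta> = (l, \<psi>)"
      by (metis surj_pair)
    define z where "z = f (k \<otimes> inv l, char_action G P l \<phi>)"
    let ?w\<^sub>0 = "ell2_fun (blinfun_apply T\<^sub>0 (ell2_single \<beta> c)) \<gamma>"
    have w\<^sub>0: "?w\<^sub>0 = (if (k, \<phi>) \<in> arrows \<and> (l, \<phi>) \<in> arrows \<and> \<psi> = \<phi> then z * c else 0)"
      unfolding f(2) kl convolution_boundary_groupoid
      by (subst infsum_single_term[of _ l]) (auto simp: ell2_single.rep_eq z_def)
    have "cmod (w - ?w\<^sub>0) \<le> norm (blinfun_apply (T - T\<^sub>0) (ell2_single \<beta> c))"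
      using ell2_coefficient_le_norm[of "blinfun_apply (T - T\<^sub>0) (ell2_single \<beta> c)" \<gamma>]
      by (simp add: w_def blinfun.diff_left minus_ell2.rep_eq)
    also have "\<dots> \<le> norm (T - T\<^sub>0) * norm (ell2_single \<beta> c)"
      by (rule norm_blinfun)
    also have "\<dots> \<le> \<epsilon> * cmod c"
      using near norm_ell2_single[of \<beta> c] \<epsilon>(1)
      by (intro mult_mono) (simp_all add: dist_norm norm_minus_commute)
    finally have "cmod (w - ?w\<^sub>0) \<le> \<epsilon> * cmod c" .
    then have big: "3 * \<epsilon> * cmod c \<le> cmod ?w\<^sub>0"
      using norm_triangle_ineq2[of w ?w\<^sub>0] \<epsilon>(2) by linarith
    then have "?w\<^sub>0 \<noteq> 0"
      using \<epsilon>(1) c by (auto simp: mult_le_0_iff)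
    then have arr: "(k, \<phi>) \<in> arrows" "(l, \<phi>) \<in> arrows" and "?w\<^sub>0 = z * c"
      using w\<^sub>0 by (auto split: if_splits)
    then have z: "3 * \<epsilon> \<le> cmod z"
      using big c by (simp add: norm_mult)
    obtain p q where pq: "p \<in> P" "q \<in> P"
      and comp: "norm ((slice_operator (inv q) o\<^sub>L T\<^sub>0 o\<^sub>L slice_operator p) - (scaleC_op z o\<^sub>L ?E)) \<le> \<epsilon>"
      using compression_near_scalar[OF G0 f quotient_arrow[OF arr] \<epsilon>(1)] unfolding z_def by metis
    let ?V = "slice_operator (inv q)" and ?U = "slice_operator p"
    define t where "t = scaleC_op (1 / z) o\<^sub>L (?V o\<^sub>L T o\<^sub>L ?U)"
    have "?V \<in> ?A" "?U \<in> ?A"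
      using pq by (simp_all add: slice_operator_in_boundary_quotient)
    then have "t \<in> I"
      unfolding t_def using T(1) I(3-5) by blast
    have "norm (?V o\<^sub>L (T\<^sub>0 - T) o\<^sub>L ?U) \<le> norm (?V o\<^sub>L (T\<^sub>0 - T)) * norm ?U"
      by (rule norm_blinfun_compose)
    also have "\<dots> \<le> norm ?V * norm (T\<^sub>0 - T) * norm ?U"
      by (intro mult_right_mono norm_blinfun_compose norm_ge_zero)
    also have "\<dots> \<le> 1 * norm (T\<^sub>0 - T) * 1"
      using slice_operator(1) pq by (intro mult_mono) simp_all
    finally have VU: "norm (?V o\<^sub>L (T\<^sub>0 - T) o\<^sub>L ?U) < \<epsilon>"
      using near by (simp add: dist_norm)
    have "(scaleC_op z o\<^sub>L ?E) - (?V o\<^sub>L T o\<^sub>L ?U) =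
        (?V o\<^sub>L (T\<^sub>0 - T) o\<^sub>L ?U) - ((?V o\<^sub>L T\<^sub>0 o\<^sub>L ?U) - (scaleC_op z o\<^sub>L ?E))"
      by (simp add: blinfun_compose_diff)
    then have "norm ((scaleC_op z o\<^sub>L ?E) - (?V o\<^sub>L T o\<^sub>L ?U)) \<le>
        norm (?V o\<^sub>L (T\<^sub>0 - T) o\<^sub>L ?U) + norm ((?V o\<^sub>L T\<^sub>0 o\<^sub>L ?U) - (scaleC_op z o\<^sub>L ?E))"
      by (simp only: norm_triangle_ineq4)
    then have "norm ((scaleC_op z o\<^sub>L ?E) - (?V o\<^sub>L T o\<^sub>L ?U)) < 2 * \<epsilon>"
      using VU comp by linarith
    moreover have "?E - t = scaleC_op (1 / z) o\<^sub>L ((scaleC_op z o\<^sub>L ?E) - (?V o\<^sub>L T o\<^sub>L ?U))"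
      using z \<epsilon>(1)
      by (intro blinfun_eqI ell2_eqI)
        (auto simp: t_def blinfun.diff_left minus_ell2.rep_eq scaleC_op.rep_eq scaleC_ell2.rep_eq
          right_diff_distrib)
    ultimately have "norm (?E - t) \<le> cmod (1 / z) * (2 * \<epsilon>)"
      using order_trans[OF norm_scaleC_op_compose_le mult_left_mono[OF less_imp_le norm_ge_zero]]
      by metis
    also have "\<dots> < 1"
    proof -
      have "2 * \<epsilon> < cmod z"
        using z \<epsilon>(1) by linarith
      then show ?thesis
        using \<epsilon>(1) by (simp add: norm_divide divide_less_eq)
    qed
    finally have "norm (?E - t) < 1" .
    then have "I = ?A"
      using closed_ideal_eq_if_near_unit[OF ideal _ unit_of_boundary_quotient \<open>t \<in> I\<close>]
        slice_operator_in_boundary_quotient[of \<one>] by simp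
    then show ?thesis
      by simp
  qed simp
qed

end

section \<open>Presented monoids\<close>

text \<open>
  A nonempty word \<open>ux\<close> represents an element whose right ideal misses \<open>vP\<close>, where \<open>v\<close> is the
  generator that has no relation with \<open>u\<close>. So only \<open>a = 1\<close> can generate an ideal \<open>gP \<inter> P\<close> that meets every principal ideal.
\<close>

lemma presented_monoid_G0_trivial:
  fixes G :: "('g, 'm) monoid_scheme"
  assumes pres: "presentation \<Sigma> R" "complete_presentation \<Sigma> R"
    and unrelated: "\<forall>u\<in>\<Sigma>. \<exists>v\<in>\<Sigma>. v \<noteq> u \<and> \<not> (\<exists>x y. is_relation R (u # x) (v # y))"
    and lattice: "quasi_lattice_submonoid G P"
    and hom: "\<iota> \<in> hom (presented_monoid \<Sigma> R) G"
    and inj: "inj_on \<iota> (carrier (presented_monoid \<Sigma> R))"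
    and P: "P = \<iota> ` carrier (presented_monoid \<Sigma> R)"
  shows "G0 G P = {\<one>\<^bsub>G\<^esub>}"
proof -
  interpret quasi_lattice_submonoid G P
    by (rule lattice)
  define w where "w = (\<lambda>u. \<iota> (word_class \<Sigma> R u))"
  have w_append: "w (u @ v) = w u \<otimes>\<^bsub>G\<^esub> w v" if "u \<in> lists \<Sigma>" "v \<in> lists \<Sigma>" for u v
    using that hom_mult[OF hom, of "word_class \<Sigma> R u" "word_class \<Sigma> R v"]
    by (simp add: w_def mult_presented_monoid[OF pres(1)] carrier_presented_monoid)
  have P_eq: "P = w ` lists \<Sigma>"
    by (auto simp: P w_def carrier_presented_monoid)
  have w_eq: "(u, v) \<in> presentation_congruence \<Sigma> R" if "w u = w v" "u \<in> lists \<Sigma>" "v \<in> lists \<Sigma>" for u v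
  proof -
    have "word_class \<Sigma> R u = word_class \<Sigma> R v"
      using that inj by (auto simp: w_def carrier_presented_monoid inj_on_def)
    then show ?thesis
      using word_class_eq_iff[OF pres(1) that(2,3)] by simp
  qed
  have w_Nil: "w [] = \<one>\<^bsub>G\<^esub>"
  proof -
    have "w [] \<in> P"
      by (auto simp: P_eq)
    moreover have "w [] \<otimes>\<^bsub>G\<^esub> w [] = w []"
      using w_append[of "[]" "[]"] by simp
    ultimately show ?thesis
      by simp
  qed
  have unrelated_disjoint: "\<exists>q\<in>P. (w (u # x) <#\<^bsub>G\<^esub> P) \<inter> (q <#\<^bsub>G\<^esub> P) = {}" if ux: "u # x \<in> lists \<Sigma>" for u x
  proof -
    obtain v where v: "v \<in> \<Sigma>" "v \<noteq> u" "\<nexists>x y. is_relation R (u # x) (v # y)"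
      using unrelated ux by auto
    have "w (u # x) \<otimes>\<^bsub>G\<^esub> w y \<noteq> w [v] \<otimes>\<^bsub>G\<^esub> w y'" if "y \<in> lists \<Sigma>" "y' \<in> lists \<Sigma>" for y y'
    proof
      assume "w (u # x) \<otimes>\<^bsub>G\<^esub> w y = w [v] \<otimes>\<^bsub>G\<^esub> w y'"
      then have "w (u # (x @ y)) = w (v # y')"
        using w_append[of "u # x" y] w_append[of "[v]" y'] ux v(1) that by simp
      then have "(u # (x @ y), v # y') \<in> presentation_congruence \<Sigma> R"
        using w_eq ux v(1) that by simp
      then show False
        using no_common_multiple_of_unrelated_generators[OF pres _ v(3), of "x @ y" y'] ux v that
        by simp
    qed
    then have "(w (u # x) <#\<^bsub>G\<^esub> P) \<inter> (w [v] <#\<^bsub>G\<^esub> P) = {}"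
      by (auto simp: P_eq elim!: idealE) (auto simp: l_coset_def)
    then show ?thesis
      using v(1) by (auto simp: P_eq)
  qed
  have inv_in_P: "inv\<^bsub>G\<^esub> g \<in> P" if g: "g \<in> carrier G" "\<And>q. q \<in> P \<Longrightarrow> (q <#\<^bsub>G\<^esub> P) \<inter> (g <#\<^bsub>G\<^esub> P) \<noteq> {}" for g
  proof -
    have "(g <#\<^bsub>G\<^esub> P) \<inter> P \<noteq> {}"
      using g(2)[of "\<one>\<^bsub>G\<^esub>"] by (simp add: Int_commute)
    then obtain a where a: "a \<in> P" "(g <#\<^bsub>G\<^esub> P) \<inter> P = a <#\<^bsub>G\<^esub> P"
      using principal_intersection g(1) by blast
    then obtain s where s: "s \<in> lists \<Sigma>" "a = w s"
      by (auto simp: P_eq)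
    show ?thesis
    proof (cases s)
      case Nil
      then have "(g <#\<^bsub>G\<^esub> P) \<inter> P = P"
        using s(2) w_Nil unfolding a(2) by simp
      then have "\<one>\<^bsub>G\<^esub> \<in> g <#\<^bsub>G\<^esub> P"
        using submonoid(2) by blast
      then show ?thesis
        using g(1) by (simp add: in_ideal_iff)
    next
      case (Cons u x)
      then obtain q where q: "q \<in> P" "(a <#\<^bsub>G\<^esub> P) \<inter> (q <#\<^bsub>G\<^esub> P) = {}"
        using unrelated_disjoint s by metis
      have "q <#\<^bsub>G\<^esub> P \<subseteq> P"
        using ideal_subset_P[OF q(1)] by blast
      then show ?thesis
        using g(2)[OF q(1)] q(2) a(2) by blast
    qed
  qed
  have "g = \<one>\<^bsub>G\<^esub>" if "g \<in> G0 G P" for g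
  proof -
    have "g \<in> carrier G" "inv\<^bsub>G\<^esub> g \<in> P" "inv\<^bsub>G\<^esub> (inv\<^bsub>G\<^esub> g) \<in> P"
      using that inv_in_P[of g] inv_in_P[of "inv\<^bsub>G\<^esub> g"] by (simp_all add: G0_def)
    then show ?thesis
      using trivial_units[of g] by simp
  qed
  moreover have "(p <#\<^bsub>G\<^esub> P) \<inter> P \<noteq> {}" if "p \<in> P" for p
    using self_in_ideal[OF P_carrier[OF that]] that by blast
  then have "\<one>\<^bsub>G\<^esub> \<in> G0 G P"
    by (simp add: G0_def)
  ultimately show ?thesis
    by blast
qed

theorem theorem7p15:
  fixes \<Sigma> :: "'a set" and R :: "('a list \<times> 'a list) set"
    and G :: "('g, 'm) monoid_scheme" and P :: "'g set" and \<iota> :: "'a list set \<Rightarrow> 'g"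
  assumes "presentation \<Sigma> R"
    and "complete_presentation \<Sigma> R"
    and "\<forall>u\<in>\<Sigma>. \<exists>v\<in>\<Sigma>. v \<noteq> u \<and> \<not> (\<exists>x y. is_relation R (u # x) (v # y))"
    and "group G" and "countable (carrier G)"
    and "\<iota> \<in> hom (presented_monoid \<Sigma> R) G"
    and "inj_on \<iota> (carrier (presented_monoid \<Sigma> R))"
    and "P = \<iota> ` carrier (presented_monoid \<Sigma> R)"
    and "quasi_lattice_ordered G P"
  shows "G0 G P = {\<one>\<^bsub>G\<^esub>} \<and> simple_algebra (boundary_quotient G P)"
proof -
  let ?M = "presented_monoid \<Sigma> R"
  interpret group G
    by (rule assms(4))
  have mult: "x \<otimes>\<^bsub>?M\<^esub> y \<in> carrier ?M" if xy: "x \<in> carrier ?M" "y \<in> carrier ?M" for x y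
  proof -
    obtain u v where "u \<in> lists \<Sigma>" "x = word_class \<Sigma> R u" "v \<in> lists \<Sigma>" "y = word_class \<Sigma> R v"
      using xy by (auto simp: carrier_presented_monoid)
    then show ?thesis
      unfolding carrier_presented_monoid
      by (intro image_eqI[of _ _ "u @ v"]) (simp_all add: mult_presented_monoid[OF assms(1)])
  qed
  have one: "\<one>\<^bsub>?M\<^esub> \<in> carrier ?M" "\<one>\<^bsub>?M\<^esub> \<otimes>\<^bsub>?M\<^esub> \<one>\<^bsub>?M\<^esub> = \<one>\<^bsub>?M\<^esub>"
    using mult_presented_monoid[OF assms(1), of "[]" "[]"]
    by (auto simp: carrier_presented_monoid one_presented_monoid)
  have lattice: "quasi_lattice_submonoid G P"
  proof
    show sub: "P \<subseteq> carrier G"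
      using assms(6,8) by (auto simp: hom_def)
    have "\<iota> \<one>\<^bsub>?M\<^esub> \<otimes>\<^bsub>G\<^esub> \<iota> \<one>\<^bsub>?M\<^esub> = \<iota> \<one>\<^bsub>?M\<^esub>"
      using hom_mult[OF assms(6) one(1) one(1)] one(2) by simp
    moreover have "\<iota> \<one>\<^bsub>?M\<^esub> \<in> carrier G"
      using one(1) assms(8) sub by blast
    ultimately have "\<iota> \<one>\<^bsub>?M\<^esub> = \<one>\<^bsub>G\<^esub>"
      by simp
    then show "\<one>\<^bsub>G\<^esub> \<in> P"
      using one(1) assms(8) by (metis imageI)
    show "p \<otimes>\<^bsub>G\<^esub> q \<in> P" if "p \<in> P" "q \<in> P" for p q
      using that mult hom_mult[OF assms(6)] unfolding assms(8) by (auto simp flip: hom_mult[OF assms(6)])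
    show "quasi_lattice_ordered G P"
      by (rule assms(9))
  qed
  have "G0 G P = {\<one>\<^bsub>G\<^esub>}"
    by (rule presented_monoid_G0_trivial[OF assms(1-3) lattice assms(6-8)])
  then show ?thesis
    using quasi_lattice_submonoid.simple_boundary_quotient[OF lattice] by blast
qed

end
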